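(* Let $\mathcal A$, $\mathcal B$ be contextual categories such that $\mathcal A$ is small and cofibrant and $\mathcal B$ is locally small. Then the inclusion functor $\mathbf{Cont}(\mathcal A,\mathcal B)\hookrightarrow\mathbf{DMC}_r(\mathcal A_w,\mathcal B_w)$, from the category of strict morphisms $\mathcal A\to\mathcal B$ to the category of morphisms of rooted display map categories $\mathcal A_w\to\mathcal B_w$ (with all natural transformations as morphisms in both cases), is an equivalence of categories.
   Context: **Contextual categories.** A contextual category $\mathcal A$ consists of a category $|\mathcal A|$, a length function $\ell:\mathrm{Ob}(|\mathcal A|)\to\mathbb N$, a function $\partial$ on objects with $\ell(\partial a)=\ell(a)-1$ if $\ell(a)\ge1$ and $\ell(\partial a)=0$ if $\ell(a)=0$, for each $a$ with $\ell(a)\ge 1$ an arrow $\mathbf p_a:a\to\partial a$ (a strict display map), and a set of pullback squares, called distinguished squares, each with top arrow $f':a\to b$, bottom arrow $f:\partial a\to\partial b$, left side $\mathbf p_a$ and right side $\mathbf p_b$; it is required that there is a unique object $1_{\mathcal A}$ of length $0$, which is terminal; that for each $b$ with $\ell(b)\ge1$ and each arrow $f$ with codomain $\partial b$ there is a unique distinguished square with right side $\mathbf p_b$ and bottom $f$; and that distinguished squares are closed under horizontal composition and contain the identity squares of all $\mathbf p_a$. $\mathcal A$ is (locally) small if $|\mathcal A|$ is. A strict morphism is a functor strictly preserving $\ell$, $\partial$, $\mathbf p$ and distinguished squares. $\mathrm{Cont}$ is the category of small contextual categories and strict morphisms. **Display map categories.** A display map category (dmc) is a pair $(A,P)$ of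 a category and a set $P$ of arrows (display maps) having pullbacks along arbitrary arrows, all such pullbacks being in $P$. It is rooted if $A$ has a terminal object and every object $\Gamma$ fits into a finite sequence of display maps $\Gamma=\Gamma_n\to\dots\to\Gamma_0$ with $\Gamma_0$ terminal. A morphism of rooted dmcs is a functor preserving display maps, their pullbacks, and terminal objects. For a contextual category $\mathcal A$, $\mathcal A_w$ is the rooted dmc with underlying category $|\mathcal A|$ whose display maps are the arrows isomorphic (in the arrow category) to a strict display map. **Cofibrant.** $\mathcal O_n$ ($n\ge0$) represents the functor $\mathrm{Cont}\to\mathrm{Set}$ sending $\mathcal A$ to its set of length-$n$ objects (so $\mathcal O_0$ is initial); $\mathcal O_n^+$ ($n\ge1$) represents $\mathcal A\mapsto\{(a,t):\ell(a)=n,\ t\text{ a section of }\mathbf p_a\}$. The morphism $\iota_n^S:\mathcal O_{n-1}\to\mathcal O_n$ corresponds to $a\mapsto\partial a$; $\iota_n^T:\mathcal O_n\to\mathcal O_n^+$ corresponds to $(a,t)\mapsto a$; $\mathcal O_n^{++}=\mathcal O_n^+\sqcup_{\mathcal O_n}\mathcal O_n^+$ and $\pi_n^T:\mathcal O_n^{++}\to\mathcal O_n^+$ is the fold map. Acyclic fibrations are the morphisms of $\mathrm{Cont}$ with the right lifting property against $\iota_n^S,\iota_n^T,\pi_n^T$ for all $n\ge1$; cofibrations are the morphisms with the left lifting property against all acyclic fibrations; $\mathcal A$ is cofibrant if $\mathcal O_0\to\mathcal A$ is a cofibration. *)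

theory Defs
  imports Main "HOL-Library.FuncSet"
begin

section \<open>Categories\<close>

record ('o, 'a) cat =
  ob :: "'o set"
  ar :: "'a set"
  src :: "'a \<Rightarrow> 'o"
  tgt :: "'a \<Rightarrow> 'o"
  ide :: "'o \<Rightarrow> 'a"
  cmp :: "'a \<Rightarrow> 'a \<Rightarrow> 'a"  (infixr "\<cdot>\<index>" 70)

definition hom :: "('o, 'a, 'x) cat_scheme \<Rightarrow> 'o \<Rightarrow> 'o \<Rightarrow> 'a set" where
  "hom C x y = {f \<in> ar C. src C f = x \<and> tgt C f = y}"

locale category =
  fixes C :: "('o, 'a, 'x) cat_scheme" (structure)
  assumes src_ob: "f \<in> ar C \<Longrightarrow> src C f \<in> ob C"
    and tgt_ob: "f \<in> ar C \<Longrightarrow> tgt C f \<in> ob C"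
    and ide_hom: "x \<in> ob C \<Longrightarrow> ide C x \<in> hom C x x"
    and cmp_hom: "f \<in> hom C x y \<Longrightarrow> g \<in> hom C y z \<Longrightarrow> g \<cdot> f \<in> hom C x z"
    and ide_left: "f \<in> hom C x y \<Longrightarrow> ide C y \<cdot> f = f"
    and ide_right: "f \<in> hom C x y \<Longrightarrow> f \<cdot> ide C x = f"
    and cmp_assoc: "f \<in> hom C w x \<Longrightarrow> g \<in> hom C x y \<Longrightarrow> h \<in> hom C y z \<Longrightarrow>
      h \<cdot> (g \<cdot> f) = (h \<cdot> g) \<cdot> f"

definition terminal :: "('o, 'a, 'x) cat_scheme \<Rightarrow> 'o \<Rightarrow> bool" where
  "terminal C t \<longleftrightarrow> t \<in> ob C \<and> (\<forall>x\<in>ob C. \<exists>!f. f \<in> hom C x t)"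

definition iso :: "('o, 'a, 'x) cat_scheme \<Rightarrow> 'a \<Rightarrow> bool" where
  "iso C f \<longleftrightarrow> f \<in> ar C \<and>
    (\<exists>g \<in> hom C (tgt C f) (src C f).
      g \<cdot>\<^bsub>C\<^esub> f = ide C (src C f) \<and> f \<cdot>\<^bsub>C\<^esub> g = ide C (tgt C f))"

text \<open>Isomorphism of \<open>f\<close> and \<open>g\<close> in the arrow category.\<close>

definition arrow_iso :: "('o, 'a, 'x) cat_scheme \<Rightarrow> 'a \<Rightarrow> 'a \<Rightarrow> bool" where
  "arrow_iso C f g \<longleftrightarrow> f \<in> ar C \<and> g \<in> ar C \<and>
    (\<exists>u v. iso C u \<and> iso C v \<and> u \<in> hom C (src C f) (src C g) \<and> v \<in> hom C (tgt C f) (tgt C g) \<and>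
      g \<cdot>\<^bsub>C\<^esub> u = v \<cdot>\<^bsub>C\<^esub> f)"

text \<open>The arguments of \<open>pullback\<close> are the top, left, right and bottom sides of the square;
  the horizontal sides point to the right and the vertical ones downwards.\<close>

definition pullback :: "('o, 'a, 'x) cat_scheme \<Rightarrow> 'a \<Rightarrow> 'a \<Rightarrow> 'a \<Rightarrow> 'a \<Rightarrow> bool" where
  "pullback C t l r b \<longleftrightarrow>
    t \<in> ar C \<and> l \<in> ar C \<and> r \<in> ar C \<and> b \<in> ar C \<and>
    src C t = src C l \<and> tgt C t = src C r \<and> tgt C l = src C b \<and> tgt C b = tgt C r \<and>
    r \<cdot>\<^bsub>C\<^esub> t = b \<cdot>\<^bsub>C\<^esub> l \<and>
    (\<forall>z\<in>ob C. \<forall>u \<in> hom C z (src C r). \<forall>v \<in> hom C z (src C b).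
      r \<cdot>\<^bsub>C\<^esub> u = b \<cdot>\<^bsub>C\<^esub> v \<longrightarrow>
      (\<exists>!h. h \<in> hom C z (src C t) \<and> t \<cdot>\<^bsub>C\<^esub> h = u \<and> l \<cdot>\<^bsub>C\<^esub> h = v))"

text \<open>Smallness is relative to a type \<open>'u\<close>: small sets are those that inject into \<open>'u\<close>.\<close>

definition locally_small :: "'u itself \<Rightarrow> ('o, 'a, 'x) cat_scheme \<Rightarrow> bool" where
  "locally_small U C \<longleftrightarrow> (\<forall>x\<in>ob C. \<forall>y\<in>ob C. \<exists>e :: 'a \<Rightarrow> 'u. inj_on e (hom C x y))"


section \<open>Functors and natural transformations\<close>

text \<open>Object and arrow maps, and the components of natural transformations, are \<open>undefined\<close>
  outside of the source category, so that HOL equality is equality of functors and of natural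
  transformations.\<close>

record ('o, 'a, 'p, 'b) fctr =
  fob :: "'o \<Rightarrow> 'p"
  far :: "'a \<Rightarrow> 'b"

locale cat_functor = A: category A + B: category B
  for A :: "('o, 'a, 'x) cat_scheme" and B :: "('p, 'b, 'y) cat_scheme" +
  fixes F :: "('o, 'a, 'p, 'b) fctr"
  assumes fob_ext: "fob F \<in> extensional (ob A)"
    and far_ext: "far F \<in> extensional (ar A)"
    and fob_ob: "x \<in> ob A \<Longrightarrow> fob F x \<in> ob B"
    and far_hom: "f \<in> hom A x y \<Longrightarrow> far F f \<in> hom B (fob F x) (fob F y)"
    and far_ide: "x \<in> ob A \<Longrightarrow> far F (ide A x) = ide B (fob F x)"
    and far_cmp: "f \<in> hom A x y \<Longrightarrow> g \<in> hom A y z \<Longrightarrow>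
      far F (g \<cdot>\<^bsub>A\<^esub> f) = far F g \<cdot>\<^bsub>B\<^esub> far F f"

definition idf :: "('o, 'a, 'x) cat_scheme \<Rightarrow> ('o, 'a, 'o, 'a) fctr" where
  "idf A = \<lparr>fob = (\<lambda>x\<in>ob A. x), far = (\<lambda>f\<in>ar A. f)\<rparr>"

text \<open>\<open>fcmp A G F\<close> is the composite of \<open>F\<close>, with source \<open>A\<close>, followed by \<open>G\<close>.\<close>

definition fcmp :: "('o, 'a, 'x) cat_scheme \<Rightarrow> ('p, 'b, 'q, 'c) fctr \<Rightarrow>
    ('o, 'a, 'p, 'b) fctr \<Rightarrow> ('o, 'a, 'q, 'c) fctr" where
  "fcmp A G F = \<lparr>fob = compose (ob A) (fob G) (fob F), far = compose (ar A) (far G) (far F)\<rparr>"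

record ('o, 'a, 'p, 'b) ntrans =
  ndom :: "('o, 'a, 'p, 'b) fctr"
  ncod :: "('o, 'a, 'p, 'b) fctr"
  ncmp :: "'o \<Rightarrow> 'b"

locale nat_trans =
  F: cat_functor A B "ndom t" + G: cat_functor A B "ncod t"
  for A :: "('o, 'a, 'x) cat_scheme" and B :: "('p, 'b, 'y) cat_scheme"
    and t :: "('o, 'a, 'p, 'b) ntrans" +
  assumes ncmp_ext: "ncmp t \<in> extensional (ob A)"
    and ncmp_hom: "x \<in> ob A \<Longrightarrow> ncmp t x \<in> hom B (fob (ndom t) x) (fob (ncod t) x)"
    and natural: "f \<in> hom A x y \<Longrightarrow>
      ncmp t y \<cdot>\<^bsub>B\<^esub> far (ndom t) f = far (ncod t) f \<cdot>\<^bsub>B\<^esub> ncmp t x"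

definition nat_isomorphic :: "('o, 'a, 'x) cat_scheme \<Rightarrow> ('p, 'b, 'y) cat_scheme \<Rightarrow>
    ('o, 'a, 'p, 'b) fctr \<Rightarrow> ('o, 'a, 'p, 'b) fctr \<Rightarrow> bool" where
  "nat_isomorphic A B F G \<longleftrightarrow>
    (\<exists>t. nat_trans A B t \<and> ndom t = F \<and> ncod t = G \<and> (\<forall>x\<in>ob A. iso B (ncmp t x)))"

definition equivalence :: "('o, 'a, 'x) cat_scheme \<Rightarrow> ('p, 'b, 'y) cat_scheme \<Rightarrow>
    ('o, 'a, 'p, 'b) fctr \<Rightarrow> bool" where
  "equivalence A B F \<longleftrightarrow> cat_functor A B F \<and>
    (\<exists>G. cat_functor B A G \<and>
      nat_isomorphic A A (idf A) (fcmp A G F) \<and>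
      nat_isomorphic B B (fcmp B F G) (idf B))"

text \<open>The full subcategory on a set \<open>S\<close> of functors of the category of functors from \<open>A\<close>
  to \<open>B\<close> and natural transformations.\<close>

definition functor_cat :: "('o, 'a, 'x) cat_scheme \<Rightarrow> ('p, 'b, 'y) cat_scheme \<Rightarrow>
    ('o, 'a, 'p, 'b) fctr set \<Rightarrow> (('o, 'a, 'p, 'b) fctr, ('o, 'a, 'p, 'b) ntrans) cat" where
  "functor_cat A B S =
    \<lparr>ob = S,
     ar = {t. nat_trans A B t \<and> ndom t \<in> S \<and> ncod t \<in> S},
     src = ndom,
     tgt = ncod,
     ide = (\<lambda>F. \<lparr>ndom = F, ncod = F, ncmp = (\<lambda>x\<in>ob A. ide B (fob F x))\<rparr>),
     cmp = (\<lambda>s t. \<lparr>ndom = ndom t, ncod = ncod s, ncmp = (\<lambda>x\<in>ob A. ncmp s x \<cdot>\<^bsub>B\<^esub> ncmp t x)\<rparr>)\<rparr>"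


section \<open>Contextual categories\<close>

text \<open>A distinguished square is recorded as the pair of its top arrow \<open>f'\<close> and its bottom arrow
  \<open>f\<close>; its left and right sides are the strict display maps of the source and the target
  of \<open>f'\<close>.\<close>

record ('o, 'a) ctx = "('o, 'a) cat" +
  len :: "'o \<Rightarrow> nat"
  par :: "'o \<Rightarrow> 'o"  ("\<partial>\<index>")
  dsp :: "'o \<Rightarrow> 'a"  ("\<p>\<index>")
  dsq :: "('a \<times> 'a) set"

text \<open>In \<open>len_par\<close>, subtraction is truncated, so that the parent of an object of length 0
  has length 0. In \<open>dsq_ex1\<close>, a square with right side \<open>\<p> b\<close> is one whose top arrow
  has target \<open>b\<close>.\<close>

locale contextual = category A for A :: "('o, 'a, 'x) ctx_scheme" (structure) +
  assumes par_ob: "a \<in> ob A \<Longrightarrow> \<partial> a \<in> ob A"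
    and len_par: "a \<in> ob A \<Longrightarrow> len A (\<partial> a) = len A a - 1"
    and dsp_hom: "a \<in> ob A \<Longrightarrow> len A a \<ge> 1 \<Longrightarrow> \<p> a \<in> hom A a (\<partial> a)"
    and dsq_shape: "(f', f) \<in> dsq A \<Longrightarrow>
      f' \<in> ar A \<and> len A (src A f') \<ge> 1 \<and> len A (tgt A f') \<ge> 1 \<and>
      f \<in> hom A (\<partial> (src A f')) (\<partial> (tgt A f'))"
    and dsq_pullback: "(f', f) \<in> dsq A \<Longrightarrow> pullback A f' (\<p> (src A f')) (\<p> (tgt A f')) f"
    and len_0_ex1: "\<exists>!a. a \<in> ob A \<and> len A a = 0"
    and len_0_terminal: "a \<in> ob A \<Longrightarrow> len A a = 0 \<Longrightarrow> terminal A a"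
    and dsq_ex1: "b \<in> ob A \<Longrightarrow> len A b \<ge> 1 \<Longrightarrow> f \<in> ar A \<Longrightarrow> tgt A f = \<partial> b \<Longrightarrow>
      \<exists>!f'. (f', f) \<in> dsq A \<and> tgt A f' = b"
    and dsq_cmp: "(f', f) \<in> dsq A \<Longrightarrow> (g', g) \<in> dsq A \<Longrightarrow> tgt A f' = src A g' \<Longrightarrow>
      (g' \<cdot> f', g \<cdot> f) \<in> dsq A"
    and dsq_ide: "a \<in> ob A \<Longrightarrow> len A a \<ge> 1 \<Longrightarrow> (ide A a, ide A (\<partial> a)) \<in> dsq A"

locale strict_morphism = A: contextual A + B: contextual B + cat_functor A B F
  for A :: "('o, 'a, 'x) ctx_scheme" and B :: "('p, 'b, 'y) ctx_scheme"
    and F :: "('o, 'a, 'p, 'b) fctr" +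
  assumes fob_len: "a \<in> ob A \<Longrightarrow> len B (fob F a) = len A a"
    and fob_par: "a \<in> ob A \<Longrightarrow> fob F (\<partial>\<^bsub>A\<^esub> a) = \<partial>\<^bsub>B\<^esub> (fob F a)"
    and far_dsp: "a \<in> ob A \<Longrightarrow> len A a \<ge> 1 \<Longrightarrow> far F (\<p>\<^bsub>A\<^esub> a) = \<p>\<^bsub>B\<^esub> (fob F a)"
    and far_dsq: "(f', f) \<in> dsq A \<Longrightarrow> (far F f', far F f) \<in> dsq B"

definition Cont_cat :: "('o, 'a, 'x) ctx_scheme \<Rightarrow> ('p, 'b, 'y) ctx_scheme \<Rightarrow>
    (('o, 'a, 'p, 'b) fctr, ('o, 'a, 'p, 'b) ntrans) cat" where
  "Cont_cat A B = functor_cat A B {F. strict_morphism A B F}"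


section \<open>Display map categories\<close>

record ('o, 'a) dmc = "('o, 'a) cat" +
  dmaps :: "'a set"

locale display_map_category = category A for A :: "('o, 'a, 'x) dmc_scheme" (structure) +
  assumes dmaps_ar: "dmaps A \<subseteq> ar A"
    and dmaps_pullback_ex: "p \<in> dmaps A \<Longrightarrow> f \<in> ar A \<Longrightarrow> tgt A f = tgt A p \<Longrightarrow>
      \<exists>t l. pullback A t l p f"
    and dmaps_pullback: "p \<in> dmaps A \<Longrightarrow> pullback A t l p f \<Longrightarrow> l \<in> dmaps A"

locale rooted_dmc = display_map_category A for A :: "('o, 'a, 'x) dmc_scheme" (structure) +
  assumes terminal_ex: "\<exists>x. terminal A x"
    and rooted: "x \<in> ob A \<Longrightarrow>
      \<exists>n \<Gamma> d. \<Gamma> n = x \<and> terminal A (\<Gamma> 0) \<and>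
        (\<forall>i<n. d i \<in> dmaps A \<and> d i \<in> hom A (\<Gamma> (Suc i)) (\<Gamma> i))"

locale dmc_morphism = A: rooted_dmc A + B: rooted_dmc B + cat_functor A B F
  for A :: "('o, 'a, 'x) dmc_scheme" and B :: "('p, 'b, 'y) dmc_scheme"
    and F :: "('o, 'a, 'p, 'b) fctr" +
  assumes far_dmaps: "p \<in> dmaps A \<Longrightarrow> far F p \<in> dmaps B"
    and far_pullback: "p \<in> dmaps A \<Longrightarrow> pullback A t l p f \<Longrightarrow>
      pullback B (far F t) (far F l) (far F p) (far F f)"
    and fob_terminal: "terminal A x \<Longrightarrow> terminal B (fob F x)"

definition DMC_cat :: "('o, 'a, 'x) dmc_scheme \<Rightarrow> ('p, 'b, 'y) dmc_scheme \<Rightarrow>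
    (('o, 'a, 'p, 'b) fctr, ('o, 'a, 'p, 'b) ntrans) cat" where
  "DMC_cat A B = functor_cat A B {F. dmc_morphism A B F}"

text \<open>The display map category \<open>A\<^sub>w\<close> of a contextual category \<open>A\<close>.\<close>

definition weak :: "('o, 'a, 'x) ctx_scheme \<Rightarrow> ('o, 'a) dmc" where
  "weak A =
    \<lparr>ob = ob A, ar = ar A, src = src A, tgt = tgt A, ide = ide A, cmp = cmp A,
     dmaps = {f \<in> ar A. \<exists>a\<in>ob A. len A a \<ge> 1 \<and> arrow_iso A f (\<p>\<^bsub>A\<^esub> a)}\<rparr>"

text \<open>It is the identity on strict morphisms and on natural transformations; that it is a functor
  into the category of morphisms of rooted display map categories is part of \<open>equivalence\<close>.\<close>

definition inclusion :: "('o, 'a, 'x) ctx_scheme \<Rightarrow> ('p, 'b, 'y) ctx_scheme \<Rightarrow>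
    (('o, 'a, 'p, 'b) fctr, ('o, 'a, 'p, 'b) ntrans,
     ('o, 'a, 'p, 'b) fctr, ('o, 'a, 'p, 'b) ntrans) fctr" where
  "inclusion A B =
    \<lparr>fob = (\<lambda>F\<in>ob (Cont_cat A B). F), far = (\<lambda>t\<in>ar (Cont_cat A B). t)\<rparr>"


section \<open>Cofibrant contextual categories\<close>

text \<open>The category Cont of small contextual categories consists of the contextual categories whose
  objects and arrows form subsets of a type \<open>'u\<close>; every contextual category that is
  small relative to \<open>'u\<close> is isomorphic to one of these. The type is meant to be infinite:
  the contextual categories \<open>O\<^sub>n\<close>, \<open>O\<^sub>n\<^sup>+\<close> and
  \<open>O\<^sub>n\<^sup>+\<^sup>+\<close> are countable, so they then exist in Cont. They are only determined up to
  isomorphism and are given here by their universal elements and universal cocones.\<close>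

type_synonym 'u sctx = "('u, 'u) ctx"
type_synonym 'u smor = "('u, 'u, 'u, 'u) fctr"

definition represents_O :: "nat \<Rightarrow> 'u sctx \<Rightarrow> 'u \<Rightarrow> bool" where
  "represents_O n R u \<longleftrightarrow> contextual R \<and> u \<in> ob R \<and> len R u = n \<and>
    (\<forall>X :: 'u sctx. \<forall>a. contextual X \<and> a \<in> ob X \<and> len X a = n \<longrightarrow>
      (\<exists>!F. strict_morphism R X F \<and> fob F u = a))"

definition is_section :: "('o, 'a, 'x) ctx_scheme \<Rightarrow> 'o \<Rightarrow> 'a \<Rightarrow> bool" where
  "is_section A a t \<longleftrightarrow> t \<in> hom A (\<partial>\<^bsub>A\<^esub> a) a \<and> \<p>\<^bsub>A\<^esub> a \<cdot>\<^bsub>A\<^esub> t = ide A (\<partial>\<^bsub>A\<^esub> a)"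

definition represents_O_plus :: "nat \<Rightarrow> 'u sctx \<Rightarrow> 'u \<Rightarrow> 'u \<Rightarrow> bool" where
  "represents_O_plus n R u s \<longleftrightarrow> n \<ge> 1 \<and>
    contextual R \<and> u \<in> ob R \<and> len R u = n \<and> is_section R u s \<and>
    (\<forall>X :: 'u sctx. \<forall>a t. contextual X \<and> a \<in> ob X \<and> len X a = n \<and> is_section X a t \<longrightarrow>
      (\<exists>!F. strict_morphism R X F \<and> fob F u = a \<and> far F s = t))"

definition is_iota_S :: "nat \<Rightarrow> 'u sctx \<Rightarrow> 'u sctx \<Rightarrow> 'u smor \<Rightarrow> bool" where
  "is_iota_S n X Y i \<longleftrightarrow> n \<ge> 1 \<and> strict_morphism X Y i \<and>
    (\<exists>u v. represents_O (n - 1) X u \<and> represents_O n Y v \<and> fob i u = \<partial>\<^bsub>Y\<^esub> v)"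

definition is_iota_T :: "nat \<Rightarrow> 'u sctx \<Rightarrow> 'u sctx \<Rightarrow> 'u smor \<Rightarrow> bool" where
  "is_iota_T n X Y i \<longleftrightarrow> n \<ge> 1 \<and> strict_morphism X Y i \<and>
    (\<exists>u v s. represents_O n X u \<and> represents_O_plus n Y v s \<and> fob i u = v)"

definition is_pushout :: "'u sctx \<Rightarrow> 'u sctx \<Rightarrow> 'u sctx \<Rightarrow> 'u sctx \<Rightarrow>
    'u smor \<Rightarrow> 'u smor \<Rightarrow> 'u smor \<Rightarrow> 'u smor \<Rightarrow> bool" where
  "is_pushout X Y Y' Z i i' j j' \<longleftrightarrow>
    strict_morphism X Y i \<and> strict_morphism X Y' i' \<and>
    strict_morphism Y Z j \<and> strict_morphism Y' Z j' \<and> fcmp X j i = fcmp X j' i' \<and>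
    (\<forall>(W :: 'u sctx) k k'.
      strict_morphism Y W k \<and> strict_morphism Y' W k' \<and> fcmp X k i = fcmp X k' i' \<longrightarrow>
      (\<exists>!h. strict_morphism Z W h \<and> fcmp Y h j = k \<and> fcmp Y' h j' = k'))"

definition is_pi_T :: "nat \<Rightarrow> 'u sctx \<Rightarrow> 'u sctx \<Rightarrow> 'u smor \<Rightarrow> bool" where
  "is_pi_T n Z Y p \<longleftrightarrow> n \<ge> 1 \<and> strict_morphism Z Y p \<and>
    (\<exists>X i j j'. is_iota_T n X Y i \<and> is_pushout X Y Y Z i i j j' \<and>
      fcmp Y p j = idf Y \<and> fcmp Y p j' = idf Y)"

text \<open>\<open>lifts X Y i P Q p\<close>: the morphism \<open>i\<close> from \<open>X\<close> to \<open>Y\<close> has the left lifting property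
  against the morphism \<open>p\<close> from \<open>P\<close> to \<open>Q\<close>.\<close>

definition lifts :: "'u sctx \<Rightarrow> 'u sctx \<Rightarrow> 'u smor \<Rightarrow> 'u sctx \<Rightarrow> 'u sctx \<Rightarrow> 'u smor \<Rightarrow> bool" where
  "lifts X Y i P Q p \<longleftrightarrow>
    (\<forall>F G. strict_morphism X P F \<and> strict_morphism Y Q G \<and> fcmp X p F = fcmp X G i \<longrightarrow>
      (\<exists>H. strict_morphism Y P H \<and> fcmp X H i = F \<and> fcmp Y p H = G))"

definition acyclic_fibration :: "'u sctx \<Rightarrow> 'u sctx \<Rightarrow> 'u smor \<Rightarrow> bool" where
  "acyclic_fibration P Q p \<longleftrightarrow> strict_morphism P Q p \<and>
    (\<forall>n\<ge>1. \<forall>X Y i. is_iota_S n X Y i \<or> is_iota_T n X Y i \<or> is_pi_T n X Y i \<longrightarrow>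
      lifts X Y i P Q p)"

definition cofibration :: "'u sctx \<Rightarrow> 'u sctx \<Rightarrow> 'u smor \<Rightarrow> bool" where
  "cofibration X Y i \<longleftrightarrow> strict_morphism X Y i \<and>
    (\<forall>P Q p. acyclic_fibration P Q p \<longrightarrow> lifts X Y i P Q p)"

definition cofibrant :: "'u sctx \<Rightarrow> bool" where
  "cofibrant A \<longleftrightarrow> (\<exists>R u i. represents_O 0 R u \<and> cofibration R A i)"

end

theory Submission
  imports Defs
begin

text \<open>Both categories are full subcategories of the category of all functors from \<open>A\<close> to \<open>B\<close>, so only
  essential surjectivity has content: a morphism \<open>F\<close> from \<open>A\<^sub>w\<close> to \<open>B\<^sub>w\<close>, which preserves display
  maps and their pullbacks up to isomorphism, has to be replaced by an isomorphic functor that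
  preserves strict display maps and distinguished squares on the nose
  (\<open>cofibrant_strictification\<close>; \<open>equivalence_inclusion\<close> deduces the theorem).

  For \<open>a\<close> of positive length, \<open>F (\<p> a)\<close> is a pullback of some strict display map \<open>\<p> d\<close> of \<open>B\<close>, along
  an arrow \<open>v\<close> and with top side \<open>w\<close>. Call such a pair \<open>(w, v)\<close> a name of \<open>F (\<p> a)\<close>. If \<open>(f', f)\<close> is a
  distinguished square from \<open>a\<close> to \<open>b\<close>, a name \<open>(w, v)\<close> of \<open>F (\<p> b)\<close> yields the name
  \<open>(w \<cdot> F f', v \<cdot> F f)\<close> of \<open>F (\<p> a)\<close>, and this operation is strictly functorial because it is just
  composition. Consequently the objects of \<open>A\<close>, equipped with a name for each of the display maps
  that lead down to the terminal object, form a contextual category \<open>named_ctx\<close>, whose arrows are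
  those of \<open>A\<close>.

  There are two strict morphisms out of it. Forgetting the names is full, faithful and surjective in
  the sense that every extension of an object of \<open>A\<close> lifts, hence an acyclic fibration
  (\<open>acyclic_fibration_lifting_equivalence\<close>). In the other direction, a named object is realized in
  \<open>B\<close> by successively pulling back the strict display maps that its names refer to, along
  distinguished squares. Comparing pullbacks gives an isomorphism from \<open>F a\<close> to the realization of \<open>a\<close>
  with any names (\<open>comparison\<close>), and uniqueness of distinguished squares makes the realization
  strict (\<open>strict_morphism_realization\<close>). As \<open>A\<close> is cofibrant, the forgetful morphism has a strict
  section, which chooses names coherently; followed by the realization, it is the required strict
  morphism, and the comparison isomorphisms are natural (\<open>strict_morphism_nat_isomorphic\<close>).

  Cofibrancy only speaks about contextual categories that are small relative to \<open>'u\<close>. Since \<open>B\<close> is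
  locally small and the arrows in names run between objects from a small set, \<open>named_ctx\<close> is small
  (\<open>small_named_ctx\<close>), and a copy of it on a subset of \<open>'u\<close> can be used instead
  (\<open>cofibrant_lifting_section\<close>).\<close>

section \<open>Isomorphisms and pullbacks\<close>

context category
begin

lemma cmp_closed [simp]:
  assumes "f \<in> ar C" "g \<in> ar C" "tgt C f = src C g"
  shows "g \<cdot> f \<in> ar C" "src C (g \<cdot> f) = src C f" "tgt C (g \<cdot> f) = tgt C g"
  using cmp_hom[of f "src C f" "tgt C f" g "tgt C g"] assms by (auto simp: hom_def)

lemma ide_closed [simp]:
  assumes "x \<in> ob C"
  shows "ide C x \<in> ar C" "src C (ide C x) = x" "tgt C (ide C x) = x"
  using ide_hom[OF assms] by (auto simp: hom_def)

lemma cmp_ide_left [simp]: "f \<in> ar C \<Longrightarrow> tgt C f = y \<Longrightarrow> ide C y \<cdot> f = f"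
  using ide_left[of f "src C f" y] by (auto simp: hom_def)

lemma cmp_ide_right [simp]: "f \<in> ar C \<Longrightarrow> src C f = x \<Longrightarrow> f \<cdot> ide C x = f"
  using ide_right[of f x "tgt C f"] by (auto simp: hom_def)

lemma assoc:
  assumes "f \<in> ar C" "g \<in> ar C" "h \<in> ar C" "tgt C f = src C g" "tgt C g = src C h"
  shows "(h \<cdot> g) \<cdot> f = h \<cdot> (g \<cdot> f)"
  using cmp_assoc[of f "src C f" "tgt C f" g "tgt C g" h "tgt C h"] assms by (auto simp: hom_def)

lemma commute_cmp:
  assumes "r \<cdot> t = b \<cdot> l" "h \<in> ar C" "t \<in> ar C" "r \<in> ar C" "l \<in> ar C" "b \<in> ar C"
    and "tgt C h = src C t" "tgt C t = src C r" "src C t = src C l" "tgt C l = src C b"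
  shows "r \<cdot> (t \<cdot> h) = b \<cdot> (l \<cdot> h)"
  using assms assoc[of h t r] assoc[of h l b] by simp

lemma src_tgt_ob [simp]: "f \<in> ar C \<Longrightarrow> src C f \<in> ob C" "f \<in> ar C \<Longrightarrow> tgt C f \<in> ob C"
  using src_ob tgt_ob by auto

lemma isoI:
  assumes "f \<in> ar C" "g \<in> ar C" "src C g = tgt C f" "tgt C g = src C f"
    and "g \<cdot> f = ide C (src C f)" "f \<cdot> g = ide C (tgt C f)"
  shows "iso C f"
  using assms unfolding iso_def hom_def by auto

lemma iso_ar: "iso C f \<Longrightarrow> f \<in> ar C"
  by (simp add: iso_def)

end

definition inverse_of :: "('o, 'a, 'x) cat_scheme \<Rightarrow> 'a \<Rightarrow> 'a" where
  "inverse_of C f = (SOME g. g \<in> hom C (tgt C f) (src C f) \<and>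
    g \<cdot>\<^bsub>C\<^esub> f = ide C (src C f) \<and> f \<cdot>\<^bsub>C\<^esub> g = ide C (tgt C f))"

context category
begin

lemma inverse_of:
  assumes "iso C f"
  shows "inverse_of C f \<in> ar C" "src C (inverse_of C f) = tgt C f" "tgt C (inverse_of C f) = src C f"
    "inverse_of C f \<cdot> f = ide C (src C f)" "f \<cdot> inverse_of C f = ide C (tgt C f)"
proof -
  have "\<exists>g. g \<in> hom C (tgt C f) (src C f) \<and> g \<cdot> f = ide C (src C f) \<and> f \<cdot> g = ide C (tgt C f)"
    using assms unfolding iso_def by auto
  from someI_ex[OF this, folded inverse_of_def]
  show "inverse_of C f \<in> ar C" "src C (inverse_of C f) = tgt C f"
    "tgt C (inverse_of C f) = src C f"
    "inverse_of C f \<cdot> f = ide C (src C f)" "f \<cdot> inverse_of C f = ide C (tgt C f)"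
    by (auto simp: hom_def)
qed

lemma inverse_of_cancel:
  assumes "iso C f" "h \<in> ar C"
  shows "tgt C h = src C f \<Longrightarrow> inverse_of C f \<cdot> (f \<cdot> h) = h"
    and "tgt C h = tgt C f \<Longrightarrow> f \<cdot> (inverse_of C f \<cdot> h) = h"
  using assms by (simp_all add: assoc[symmetric] inverse_of iso_ar)

lemma iso_ide: "x \<in> ob C \<Longrightarrow> iso C (ide C x)"
  by (rule isoI[where g = "ide C x"]) auto

lemma iso_inverse_of: "iso C f \<Longrightarrow> iso C (inverse_of C f)"
  by (rule isoI[where g = f]) (auto simp: inverse_of iso_ar)

lemma iso_between_terminal:
  assumes "terminal C x" "terminal C y" "f \<in> hom C x y"
  shows "iso C f"
proof -
  have x: "x \<in> ob C" and y: "y \<in> ob C" using assms by (auto simp: terminal_def)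
  then obtain g where g: "g \<in> hom C y x" using assms(1) by (auto simp: terminal_def)
  have "g \<cdot> f = ide C x" "f \<cdot> g = ide C y"
    using assms x y g cmp_hom[OF assms(3) g] cmp_hom[OF g assms(3)] ide_hom[OF x] ide_hom[OF y]
    unfolding terminal_def by blast+
  then show ?thesis using g assms(3) by (auto simp: hom_def intro!: isoI[of f g])
qed

lemma terminal_iso:
  assumes "terminal C t" "iso C m" "tgt C m = t"
  shows "terminal C (src C m)"
  unfolding terminal_def
proof (intro conjI ballI)
  show "src C m \<in> ob C" using assms(2) by (simp add: iso_ar)
  fix x assume x: "x \<in> ob C"
  obtain f where f: "f \<in> ar C" "src C f = x" "tgt C f = t"
    using assms(1) x unfolding terminal_def hom_def by auto
  show "\<exists>!g. g \<in> hom C x (src C m)"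
  proof (rule ex1I[of _ "inverse_of C m \<cdot> f"])
    show "inverse_of C m \<cdot> f \<in> hom C x (src C m)" using f assms by (simp add: hom_def inverse_of)
    fix g assume g: "g \<in> hom C x (src C m)"
    then have "m \<cdot> g \<in> hom C x t" "f \<in> hom C x t" using f assms by (simp_all add: hom_def iso_ar)
    then have "m \<cdot> g = f" using assms(1) x unfolding terminal_def by blast
    then show "g = inverse_of C m \<cdot> f" using g inverse_of_cancel(1)[OF assms(2), of g]
      by (simp add: hom_def)
  qed
qed

lemma pullbackI:
  assumes "t \<in> ar C" "l \<in> ar C" "r \<in> ar C" "b \<in> ar C"
    and "src C t = src C l" "tgt C t = src C r" "tgt C l = src C b" "tgt C b = tgt C r"
    and "r \<cdot> t = b \<cdot> l"
    and "\<And>u v. u \<in> ar C \<Longrightarrow> v \<in> ar C \<Longrightarrow> src C u = src C v \<Longrightarrow> tgt C u = src C r \<Longrightarrow>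
      tgt C v = src C b \<Longrightarrow> r \<cdot> u = b \<cdot> v \<Longrightarrow>
      \<exists>h. h \<in> ar C \<and> src C h = src C v \<and> tgt C h = src C l \<and> t \<cdot> h = u \<and> l \<cdot> h = v"
    and "\<And>h k. h \<in> ar C \<Longrightarrow> k \<in> ar C \<Longrightarrow> src C h = src C k \<Longrightarrow> tgt C h = src C l \<Longrightarrow>
      tgt C k = src C l \<Longrightarrow> t \<cdot> h = t \<cdot> k \<Longrightarrow> l \<cdot> h = l \<cdot> k \<Longrightarrow> h = k"
  shows "pullback C t l r b"
  unfolding pullback_def
proof (intro conjI ballI impI)
  fix z u v assume "u \<in> hom C z (src C r)" "v \<in> hom C z (src C b)" "r \<cdot> u = b \<cdot> v"
  then have uv: "u \<in> ar C" "v \<in> ar C" "src C u = src C v" "tgt C u = src C r"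
    "tgt C v = src C b" "r \<cdot> u = b \<cdot> v" "src C v = z" by (auto simp: hom_def)
  obtain h where h: "h \<in> ar C" "src C h = src C v" "tgt C h = src C l" "t \<cdot> h = u" "l \<cdot> h = v"
    using assms(10)[OF uv(1-6)] by blast
  show "\<exists>!h. h \<in> hom C z (src C t) \<and> t \<cdot> h = u \<and> l \<cdot> h = v"
  proof (rule ex1I[of _ h])
    show "h \<in> hom C z (src C t) \<and> t \<cdot> h = u \<and> l \<cdot> h = v" using h uv assms(5) by (simp add: hom_def)
    fix k assume "k \<in> hom C z (src C t) \<and> t \<cdot> k = u \<and> l \<cdot> k = v"
    then have "k \<in> ar C" "src C k = z" "tgt C k = src C t" "t \<cdot> k = u" "l \<cdot> k = v"
      by (simp_all add: hom_def)
    then show "k = h" using assms(5) h uv(7) by - (rule assms(11), simp_all)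
  qed
qed (use assms(1-9) in simp_all)

lemma pullbackD:
  assumes "pullback C t l r b"
  shows "t \<in> ar C" "l \<in> ar C" "r \<in> ar C" "b \<in> ar C"
    "src C t = src C l" "tgt C t = src C r" "tgt C l = src C b" "tgt C b = tgt C r"
    "r \<cdot> t = b \<cdot> l"
  using assms by (auto simp: pullback_def)

lemma pullback_ex:
  assumes "pullback C t l r b"
    and "u \<in> ar C" "v \<in> ar C" "src C u = src C v" "tgt C u = src C r" "tgt C v = src C b"
    and "r \<cdot> u = b \<cdot> v"
  shows "\<exists>h. h \<in> ar C \<and> src C h = src C v \<and> tgt C h = src C l \<and> t \<cdot> h = u \<and> l \<cdot> h = v"
proof -
  have "\<exists>!h. h \<in> hom C (src C v) (src C t) \<and> t \<cdot> h = u \<and> l \<cdot> h = v"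
    using assms(1) unfolding pullback_def
    by (elim conjE ballE[of _ _ "src C v"] ballE[of _ _ u] ballE[of _ _ v])
      (use assms in \<open>simp_all add: hom_def\<close>)
  then obtain h where "h \<in> hom C (src C v) (src C t)" "t \<cdot> h = u" "l \<cdot> h = v" by blast
  then show ?thesis using pullbackD(5)[OF assms(1)] by (intro exI[of _ h]) (simp_all add: hom_def)
qed

lemma pullback_unique:
  assumes "pullback C t l r b"
    and "h \<in> ar C" "k \<in> ar C" "src C h = src C k" "tgt C h = src C l" "tgt C k = src C l"
    and "t \<cdot> h = t \<cdot> k" "l \<cdot> h = l \<cdot> k"
  shows "h = k"
proof -
  note pb = pullbackD[OF assms(1)]
  have "r \<cdot> (t \<cdot> h) = b \<cdot> (l \<cdot> h)" using pb assms by (simp add: assoc[symmetric])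
  then have "\<exists>!m. m \<in> hom C (src C h) (src C t) \<and> t \<cdot> m = t \<cdot> h \<and> l \<cdot> m = l \<cdot> h"
    using assms pb unfolding pullback_def hom_def by simp
  moreover have "h \<in> hom C (src C h) (src C t)" "k \<in> hom C (src C h) (src C t)"
    using assms pb by (auto simp: hom_def)
  ultimately show ?thesis using assms(7,8) by metis
qed

lemma pullback_of_isos:
  assumes "iso C t" "iso C b" "l \<in> ar C" "r \<in> ar C"
    and "src C t = src C l" "tgt C t = src C r" "tgt C l = src C b" "tgt C b = tgt C r"
    and "r \<cdot> t = b \<cdot> l"
  shows "pullback C t l r b"
proof (rule pullbackI)
  show t: "t \<in> ar C" and b: "b \<in> ar C" using assms by (simp_all add: iso_ar)
  fix u v assume uv: "u \<in> ar C" "v \<in> ar C" "src C u = src C v" "tgt C u = src C r"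
    "tgt C v = src C b" "r \<cdot> u = b \<cdot> v"
  let ?h = "inverse_of C t \<cdot> u"
  have h: "?h \<in> ar C" "src C ?h = src C v" "tgt C ?h = src C l" "t \<cdot> ?h = u"
    using assms t uv by (simp_all add: inverse_of inverse_of_cancel)
  have "b \<cdot> (l \<cdot> ?h) = b \<cdot> v"
    using commute_cmp[OF assms(9) h(1)] assms h uv t b by simp
  then have "inverse_of C b \<cdot> (b \<cdot> (l \<cdot> ?h)) = inverse_of C b \<cdot> (b \<cdot> v)" by simp
  then have "l \<cdot> ?h = v"
    using assms(2-8) uv(1-5) h(1-3) by (simp add: inverse_of_cancel)
  then show "\<exists>h. h \<in> ar C \<and> src C h = src C v \<and> tgt C h = src C l \<and> t \<cdot> h = u \<and> l \<cdot> h = v"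
    using h by (intro exI[of _ ?h] conjI)
next
  fix h k assume "h \<in> ar C" "k \<in> ar C" "tgt C h = src C l" "tgt C k = src C l" "t \<cdot> h = t \<cdot> k"
  then show "h = k" using inverse_of_cancel(1)[OF assms(1)] assms(5) by metis
qed (use assms in \<open>simp_all add: iso_ar\<close>)

lemma pullback_paste:
  assumes "pullback C t l r b" "pullback C t' r r' b'"
  shows "pullback C (t' \<cdot> t) l r' (b' \<cdot> b)"
proof (rule pullbackI)
  note pb = pullbackD[OF assms(1)] and pb' = pullbackD[OF assms(2)]
  show "r' \<cdot> (t' \<cdot> t) = (b' \<cdot> b) \<cdot> l"
    using commute_cmp[OF pb'(9), of t] pb pb' by (simp add: assoc)
  { fix u v assume uv: "u \<in> ar C" "v \<in> ar C" "src C u = src C v" "tgt C u = src C r'"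
      "tgt C v = src C (b' \<cdot> b)" "r' \<cdot> u = (b' \<cdot> b) \<cdot> v"
    have "\<exists>k. k \<in> ar C \<and> src C k = src C (b \<cdot> v) \<and> tgt C k = src C r \<and> t' \<cdot> k = u \<and>
        r \<cdot> k = b \<cdot> v"
      by (rule pullback_ex[OF assms(2)]) (use uv pb pb' in \<open>simp_all add: assoc\<close>)
    then obtain k where k: "k \<in> ar C" "src C k = src C (b \<cdot> v)" "tgt C k = src C r"
      "t' \<cdot> k = u" "r \<cdot> k = b \<cdot> v" by blast
    have "\<exists>h. h \<in> ar C \<and> src C h = src C v \<and> tgt C h = src C l \<and> t \<cdot> h = k \<and> l \<cdot> h = v"
      by (rule pullback_ex[OF assms(1)]) (use k uv pb pb' in simp_all)
    then obtain h where "h \<in> ar C" "src C h = src C v" "tgt C h = src C l" "t \<cdot> h = k" "l \<cdot> h = v"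
      by blast
    then show "\<exists>h. h \<in> ar C \<and> src C h = src C v \<and> tgt C h = src C l \<and> (t' \<cdot> t) \<cdot> h = u \<and> l \<cdot> h = v"
      using k pb pb' by (intro exI[of _ h]) (simp_all add: assoc) }
  { fix h k assume hk: "h \<in> ar C" "k \<in> ar C" "src C h = src C k" "tgt C h = src C l"
      "tgt C k = src C l" "(t' \<cdot> t) \<cdot> h = (t' \<cdot> t) \<cdot> k" "l \<cdot> h = l \<cdot> k"
    have c: "r \<cdot> (t \<cdot> m) = b \<cdot> (l \<cdot> m)" if "m \<in> ar C" "tgt C m = src C l" for m
      by (rule commute_cmp[OF pb(9)]) (use that pb in simp_all)
    have "t \<cdot> h = t \<cdot> k"
      by (rule pullback_unique[OF assms(2)]) (use hk pb pb' c[of h] c[of k] in \<open>simp_all add: assoc\<close>)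
    then show "h = k" by (rule pullback_unique[OF assms(1) hk(1,2,3,4,5) _ hk(7)]) }
qed (use pullbackD[OF assms(1)] pullbackD[OF assms(2)] in simp_all)

lemma pullback_precompose_iso:
  assumes "pullback C t l r b" "iso C m" "tgt C m = src C l"
  shows "pullback C (t \<cdot> m) (l \<cdot> m) r b"
proof (rule pullbackI)
  note pb = pullbackD[OF assms(1)]
  show "r \<cdot> (t \<cdot> m) = b \<cdot> (l \<cdot> m)"
    by (rule commute_cmp[OF pb(9)]) (use pb assms in \<open>simp_all add: iso_ar\<close>)
  { fix u v assume uv: "u \<in> ar C" "v \<in> ar C" "src C u = src C v" "tgt C u = src C r"
      "tgt C v = src C b" "r \<cdot> u = b \<cdot> v"
    obtain h where "h \<in> ar C" "src C h = src C v" "tgt C h = src C l" "t \<cdot> h = u" "l \<cdot> h = v"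
      using pullback_ex[OF assms(1) uv] by blast
    then show "\<exists>h. h \<in> ar C \<and> src C h = src C v \<and> tgt C h = src C (l \<cdot> m) \<and>
        (t \<cdot> m) \<cdot> h = u \<and> (l \<cdot> m) \<cdot> h = v"
      using pb assms by (intro exI[of _ "inverse_of C m \<cdot> h"])
        (simp_all add: assoc inverse_of inverse_of_cancel iso_ar) }
  { fix h k assume hk: "h \<in> ar C" "k \<in> ar C" "src C h = src C k" "tgt C h = src C (l \<cdot> m)"
      "tgt C k = src C (l \<cdot> m)" "(t \<cdot> m) \<cdot> h = (t \<cdot> m) \<cdot> k" "(l \<cdot> m) \<cdot> h = (l \<cdot> m) \<cdot> k"
    have "m \<cdot> h = m \<cdot> k"
      by (rule pullback_unique[OF assms(1)]) (use hk pb assms in \<open>simp_all add: assoc iso_ar\<close>)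
    then have "inverse_of C m \<cdot> (m \<cdot> h) = inverse_of C m \<cdot> (m \<cdot> k)" by simp
    then show "h = k" using hk pb assms by (simp add: inverse_of_cancel iso_ar) }
qed (use pullbackD[OF assms(1)] assms in \<open>simp_all add: iso_ar\<close>)

lemma pullback_comparison_iso:
  assumes "pullback C t l r b" "pullback C t' l' r b"
  obtains m where "iso C m" "src C m = src C l'" "tgt C m = src C l" "t \<cdot> m = t'" "l \<cdot> m = l'"
proof -
  note pb = pullbackD[OF assms(1)] and pb' = pullbackD[OF assms(2)]
  obtain m where m: "m \<in> ar C" "src C m = src C l'" "tgt C m = src C l" "t \<cdot> m = t'" "l \<cdot> m = l'"
    using pullback_ex[OF assms(1) pb'(1,2,5,6,7,9)] by blast
  obtain n where n: "n \<in> ar C" "src C n = src C l" "tgt C n = src C l'" "t' \<cdot> n = t" "l' \<cdot> n = l"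
    using pullback_ex[OF assms(2) pb(1,2,5,6,7,9)] by blast
  have "n \<cdot> m = ide C (src C l')"
    by (rule pullback_unique[OF assms(2)])
      (use m n pb pb' in \<open>simp_all add: assoc[symmetric]\<close>)
  moreover have "m \<cdot> n = ide C (src C l)"
    by (rule pullback_unique[OF assms(1)])
      (use m n pb pb' in \<open>simp_all add: assoc[symmetric]\<close>)
  ultimately show thesis using m n by - (rule that[of m], simp_all add: isoI[of m n])
qed

end

section \<open>Functors\<close>

context cat_functor
begin

lemma far_closed [simp]:
  assumes "f \<in> ar A"
  shows "far F f \<in> ar B" "src B (far F f) = fob F (src A f)" "tgt B (far F f) = fob F (tgt A f)"
  using far_hom[of f "src A f" "tgt A f"] assms by (auto simp: hom_def)

lemma far_comp [simp]:
  "f \<in> ar A \<Longrightarrow> g \<in> ar A \<Longrightarrow> tgt A f = src A g \<Longrightarrow> far F (g \<cdot>\<^bsub>A\<^esub> f) = far F g \<cdot>\<^bsub>B\<^esub> far F f"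
  using far_cmp[of f "src A f" "tgt A f" g "tgt A g"] by (auto simp: hom_def)

lemma far_square:
  assumes "g \<cdot>\<^bsub>A\<^esub> f = k \<cdot>\<^bsub>A\<^esub> h" "f \<in> ar A" "g \<in> ar A" "h \<in> ar A" "k \<in> ar A"
    and "tgt A f = src A g" "tgt A h = src A k"
  shows "far F g \<cdot>\<^bsub>B\<^esub> far F f = far F k \<cdot>\<^bsub>B\<^esub> far F h"
  using assms far_comp by metis

lemma far_iso: "iso A f \<Longrightarrow> iso B (far F f)"
  by (rule B.isoI[where g = "far F (inverse_of A f)"])
    (simp_all add: A.inverse_of A.iso_ar far_ide far_comp[symmetric] del: far_comp)

end

lemma cat_functorI:
  assumes "category A" "category B" "fob F \<in> extensional (ob A)" "far F \<in> extensional (ar A)"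
    and "\<And>x. x \<in> ob A \<Longrightarrow> fob F x \<in> ob B"
    and "\<And>f. f \<in> ar A \<Longrightarrow> far F f \<in> ar B \<and> src B (far F f) = fob F (src A f) \<and>
      tgt B (far F f) = fob F (tgt A f)"
    and "\<And>x. x \<in> ob A \<Longrightarrow> far F (ide A x) = ide B (fob F x)"
    and "\<And>f g. f \<in> ar A \<Longrightarrow> g \<in> ar A \<Longrightarrow> tgt A f = src A g \<Longrightarrow>
      far F (g \<cdot>\<^bsub>A\<^esub> f) = far F g \<cdot>\<^bsub>B\<^esub> far F f"
  shows "cat_functor A B F"
  using assms unfolding cat_functor_def cat_functor_axioms_def by (simp add: hom_def)

lemma fctr_eqI:
  assumes "cat_functor A B F" "cat_functor A B G"
    and "\<And>x. x \<in> ob A \<Longrightarrow> fob F x = fob G x" "\<And>f. f \<in> ar A \<Longrightarrow> far F f = far G f"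
  shows "F = G"
proof -
  have "fob F = fob G" "far F = far G"
    using assms by (auto simp: cat_functor_def cat_functor_axioms_def intro: extensionalityI)
  then show ?thesis by (simp add: fctr.equality)
qed

lemma fcmp_apply [simp]:
  "x \<in> ob A \<Longrightarrow> fob (fcmp A G F) x = fob G (fob F x)"
  "f \<in> ar A \<Longrightarrow> far (fcmp A G F) f = far G (far F f)"
  by (simp_all add: fcmp_def compose_eq)

lemma idf_apply [simp]:
  "x \<in> ob A \<Longrightarrow> fob (idf A) x = x" "f \<in> ar A \<Longrightarrow> far (idf A) f = f"
  by (simp_all add: idf_def)

lemma cat_functor_idf: "category A \<Longrightarrow> cat_functor A A (idf A)"
  by (rule cat_functorI) (simp_all add: idf_def category.cmp_closed category.ide_closed
    category.src_tgt_ob)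

lemma cat_functor_fcmp:
  assumes "cat_functor A B F" "cat_functor B C G"
  shows "cat_functor A C (fcmp A G F)"
proof -
  interpret F: cat_functor A B F by fact
  interpret G: cat_functor B C G by fact
  show ?thesis
    by (rule cat_functorI)
      (simp_all add: F.A.category_axioms G.B.category_axioms F.fob_ob G.fob_ob F.far_ide G.far_ide,
        simp_all add: fcmp_def compose_def)
qed

lemma nat_transI:
  assumes "cat_functor A B (ndom t)" "cat_functor A B (ncod t)" "ncmp t \<in> extensional (ob A)"
    and "\<And>x. x \<in> ob A \<Longrightarrow> ncmp t x \<in> ar B \<and> src B (ncmp t x) = fob (ndom t) x \<and>
      tgt B (ncmp t x) = fob (ncod t) x"
    and "\<And>f. f \<in> ar A \<Longrightarrow>
      ncmp t (tgt A f) \<cdot>\<^bsub>B\<^esub> far (ndom t) f = far (ncod t) f \<cdot>\<^bsub>B\<^esub> ncmp t (src A f)"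
  shows "nat_trans A B t"
  using assms unfolding nat_trans_def nat_trans_axioms_def hom_def by simp

context nat_trans
begin

lemma ncmp_closed [simp]:
  assumes "x \<in> ob A"
  shows "ncmp t x \<in> ar B" "src B (ncmp t x) = fob (ndom t) x" "tgt B (ncmp t x) = fob (ncod t) x"
  using ncmp_hom[OF assms] by (auto simp: hom_def)

lemma ncmp_natural:
  "f \<in> ar A \<Longrightarrow> ncmp t (tgt A f) \<cdot>\<^bsub>B\<^esub> far (ndom t) f = far (ncod t) f \<cdot>\<^bsub>B\<^esub> ncmp t (src A f)"
  using natural[of f "src A f" "tgt A f"] by (simp add: hom_def)

end

section \<open>Inclusions of full subcategories\<close>

definition full_sub :: "('o, 'a, 'x) cat_scheme \<Rightarrow> 'o set \<Rightarrow> ('o, 'a) cat" where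
  "full_sub C S = \<lparr>ob = S, ar = {f \<in> ar C. src C f \<in> S \<and> tgt C f \<in> S},
    src = src C, tgt = tgt C, ide = ide C, cmp = cmp C\<rparr>"

lemma full_sub_simps [simp]:
  "ob (full_sub C S) = S" "f \<in> ar (full_sub C S) \<longleftrightarrow> f \<in> ar C \<and> src C f \<in> S \<and> tgt C f \<in> S"
  "src (full_sub C S) = src C" "tgt (full_sub C S) = tgt C" "ide (full_sub C S) = ide C"
  "cmp (full_sub C S) = cmp C"
  by (simp_all add: full_sub_def)

context category
begin

lemma category_full_sub:
  assumes "S \<subseteq> ob C"
  shows "category (full_sub C S)"
  by unfold_locales (use assms in \<open>auto simp: hom_def assoc\<close>)

lemma iso_full_sub:
  assumes "iso C f" "src C f \<in> S" "tgt C f \<in> S"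
  shows "iso (full_sub C S) f"
  unfolding iso_def hom_def
  by (intro conjI bexI[of _ "inverse_of C f"]) (use assms in \<open>simp_all add: iso_ar inverse_of\<close>)

text \<open>The quasi-inverse sends an object to a chosen isomorphic object of the subcategory, and an
  arrow to its conjugate by the chosen isomorphisms; these isomorphisms are the components of both
  natural isomorphisms.\<close>

lemma equivalence_full_sub:
  assumes S: "S \<subseteq> ob C"
    and ex: "\<And>x. x \<in> ob C \<Longrightarrow> \<exists>e. iso C e \<and> src C e = x \<and> tgt C e \<in> S"
  shows "equivalence (full_sub C S) C
    \<lparr>fob = (\<lambda>x\<in>S. x), far = (\<lambda>f\<in>ar (full_sub C S). f)\<rparr>" (is "equivalence ?S C ?I")
proof -
  interpret S: category ?S by (rule category_full_sub[OF S])
  obtain e where e: "\<And>x. x \<in> ob C \<Longrightarrow> iso C (e x) \<and> src C (e x) = x \<and> tgt C (e x) \<in> S"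
    using ex by metis
  have e_ar: "e x \<in> ar C" if "x \<in> ob C" for x using e[OF that] iso_ar by blast
  have e_ob: "tgt C (e x) \<in> ob C" if "x \<in> ob C" for x using e[OF that] S by blast
  note e = e e_ar e_ob inverse_of inverse_of_cancel assoc
  define G where "G = \<lparr>fob = (\<lambda>x\<in>ob C. tgt C (e x)),
    far = (\<lambda>f\<in>ar C. e (tgt C f) \<cdot> (f \<cdot> inverse_of C (e (src C f))))\<rparr>"
  have G [simp]: "fob G x = tgt C (e x)" if "x \<in> ob C" for x using that by (simp add: G_def)
  have G' [simp]: "far G f = e (tgt C f) \<cdot> (f \<cdot> inverse_of C (e (src C f)))"
    if "f \<in> ar C" for f using that by (simp add: G_def)
  have I [simp]: "fob ?I x = x" if "x \<in> S" for x using that by simp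
  have I' [simp]: "far ?I f = f" if "f \<in> ar ?S" for f using that by simp
  have SC: "x \<in> ob C" if "x \<in> S" for x using S that by blast
  have "cat_functor ?S C ?I"
    by (rule cat_functorI) (auto simp: S.category_axioms category_axioms SC)
  moreover have funG: "cat_functor C ?S G"
  proof (rule cat_functorI)
    show "fob G \<in> extensional (ob C)" "far G \<in> extensional (ar C)" by (simp_all add: G_def)
  qed (simp_all add: S.category_axioms category_axioms e)
  moreover have "nat_isomorphic ?S ?S (idf ?S) (fcmp ?S G ?I)"
    unfolding nat_isomorphic_def
  proof (intro exI conjI ballI)
    let ?t = "\<lparr>ndom = idf ?S, ncod = fcmp ?S G ?I, ncmp = (\<lambda>x\<in>S. e x)\<rparr>"
    show "nat_trans ?S ?S ?t"
    proof (rule nat_transI)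
      show "cat_functor ?S ?S (ndom ?t)" by (simp add: cat_functor_idf S.category_axioms)
      show "cat_functor ?S ?S (ncod ?t)"
        using cat_functor_fcmp[OF calculation(1,2)] by simp
    qed (auto simp: SC e)
    fix x assume "x \<in> ob ?S"
    then show "iso ?S (ncmp ?t x)" by (auto simp: SC e intro!: iso_full_sub)
  qed simp_all
  moreover have "nat_isomorphic C C (fcmp C ?I G) (idf C)"
    unfolding nat_isomorphic_def
  proof (intro exI conjI ballI)
    let ?t = "\<lparr>ndom = fcmp C ?I G, ncod = idf C, ncmp = (\<lambda>x\<in>ob C. inverse_of C (e x))\<rparr>"
    show "nat_trans C C ?t"
    proof (rule nat_transI)
      show "cat_functor C C (ncod ?t)" by (simp add: cat_functor_idf category_axioms)
      show "cat_functor C C (ndom ?t)"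
        using cat_functor_fcmp[OF funG calculation(1)] by simp
    qed (simp_all add: SC e)
    fix x assume "x \<in> ob C"
    then show "iso C (ncmp ?t x)" by (simp add: e iso_inverse_of)
  qed simp_all
  ultimately show ?thesis unfolding equivalence_def by blast
qed

end

section \<open>Functor categories\<close>

lemma functor_cat_simps [simp]:
  "ob (functor_cat A B S) = S"
  "t \<in> ar (functor_cat A B S) \<longleftrightarrow> nat_trans A B t \<and> ndom t \<in> S \<and> ncod t \<in> S"
  "src (functor_cat A B S) = ndom" "tgt (functor_cat A B S) = ncod"
  by (simp_all add: functor_cat_def)

lemma functor_cat_ide:
  "ide (functor_cat A B S) F = \<lparr>ndom = F, ncod = F, ncmp = (\<lambda>x\<in>ob A. ide B (fob F x))\<rparr>"
  by (simp add: functor_cat_def)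

lemma functor_cat_cmp:
  "s \<cdot>\<^bsub>functor_cat A B S\<^esub> t =
    \<lparr>ndom = ndom t, ncod = ncod s, ncmp = (\<lambda>x\<in>ob A. ncmp s x \<cdot>\<^bsub>B\<^esub> ncmp t x)\<rparr>"
  by (simp add: functor_cat_def)

text \<open>This turns the inclusion of strict morphisms into weak ones into an instance of
  \<open>equivalence_full_sub\<close>.\<close>

lemma full_sub_functor_cat:
  assumes "S \<subseteq> T"
  shows "full_sub (functor_cat A B T) S = functor_cat A B S"
  using assms by (auto simp: full_sub_def functor_cat_def)

lemma ntrans_eqI:
  assumes "nat_trans A B s" "nat_trans A B t" "ndom s = ndom t" "ncod s = ncod t"
    and "\<And>x. x \<in> ob A \<Longrightarrow> ncmp s x = ncmp t x"
  shows "s = t"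
proof -
  have "ncmp s = ncmp t"
    using assms by (auto simp: nat_trans_def nat_trans_axioms_def intro: extensionalityI)
  then show ?thesis using assms(3,4) by (simp add: ntrans.equality)
qed

lemma nat_trans_ide:
  assumes "cat_functor A B F"
  shows "nat_trans A B \<lparr>ndom = F, ncod = F, ncmp = (\<lambda>x\<in>ob A. ide B (fob F x))\<rparr>"
proof -
  interpret cat_functor A B F by fact
  show ?thesis by (rule nat_transI) (simp_all add: assms fob_ob)
qed

lemma nat_trans_cmp:
  assumes "nat_trans A B s" "nat_trans A B t" "ndom s = ncod t"
  shows "nat_trans A B
    \<lparr>ndom = ndom t, ncod = ncod s, ncmp = (\<lambda>x\<in>ob A. ncmp s x \<cdot>\<^bsub>B\<^esub> ncmp t x)\<rparr>" (is "nat_trans A B ?u")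
proof -
  interpret s: nat_trans A B s by fact
  interpret t: nat_trans A B t by fact
  show ?thesis
  proof (rule nat_transI)
    fix f assume f: "f \<in> ar A"
    let ?x = "src A f" and ?y = "tgt A f"
    have "(ncmp s ?y \<cdot>\<^bsub>B\<^esub> ncmp t ?y) \<cdot>\<^bsub>B\<^esub> far (ndom t) f =
        ncmp s ?y \<cdot>\<^bsub>B\<^esub> (ncmp t ?y \<cdot>\<^bsub>B\<^esub> far (ndom t) f)"
      using f assms(3) by (intro s.F.B.assoc) simp_all
    also have "\<dots> = (ncmp s ?y \<cdot>\<^bsub>B\<^esub> far (ndom s) f) \<cdot>\<^bsub>B\<^esub> ncmp t ?x"
      using f assms(3) s.F.B.assoc[of "ncmp t ?x" "far (ndom s) f" "ncmp s ?y"]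
      by (simp add: t.ncmp_natural)
    also have "\<dots> = far (ncod s) f \<cdot>\<^bsub>B\<^esub> (ncmp s ?x \<cdot>\<^bsub>B\<^esub> ncmp t ?x)"
      by (subst s.ncmp_natural[OF f], rule s.F.B.assoc) (use f assms(3) in simp_all)
    finally show "ncmp ?u ?y \<cdot>\<^bsub>B\<^esub> far (ndom ?u) f = far (ncod ?u) f \<cdot>\<^bsub>B\<^esub> ncmp ?u ?x"
      using f by simp
  qed (simp_all add: assms(3) s.G.cat_functor_axioms t.F.cat_functor_axioms)
qed

lemma category_functor_cat:
  assumes S: "\<And>F. F \<in> S \<Longrightarrow> cat_functor A B F"
  shows "category (functor_cat A B S)" (is "category ?C")
proof
  fix f assume "f \<in> ar ?C"
  then show "src ?C f \<in> ob ?C" "tgt ?C f \<in> ob ?C" by simp_all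
next
  fix F assume "F \<in> ob ?C"
  then show "ide ?C F \<in> hom ?C F F" using S by (simp add: hom_def functor_cat_ide nat_trans_ide)
next
  fix t s F G H assume "t \<in> hom ?C F G" "s \<in> hom ?C G H"
  then show "s \<cdot>\<^bsub>?C\<^esub> t \<in> hom ?C F H" using nat_trans_cmp[of A B s t] by (auto simp: hom_def functor_cat_cmp)
next
  fix t F G assume "t \<in> hom ?C F G"
  then have t: "nat_trans A B t" "F \<in> S" "G \<in> S" "ndom t = F" "ncod t = G"
    by (auto simp: hom_def)
  interpret nat_trans A B t by fact
  show "ide ?C G \<cdot>\<^bsub>?C\<^esub> t = t" "t \<cdot>\<^bsub>?C\<^esub> ide ?C F = t" unfolding functor_cat_cmp functor_cat_ide
    by (rule ntrans_eqI[of A B]; use t nat_trans_cmp[OF nat_trans_ide[OF S] t(1)]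
      nat_trans_cmp[OF t(1) nat_trans_ide[OF S]] in simp)+
next
  fix r s t F G H K assume "t \<in> hom ?C F G" "s \<in> hom ?C G H" "r \<in> hom ?C H K"
  then have t: "nat_trans A B t" "nat_trans A B s" "nat_trans A B r" "ndom s = ncod t"
    "ndom r = ncod s" by (auto simp: hom_def)
  interpret r: nat_trans A B r by fact
  interpret s: nat_trans A B s by fact
  interpret t: nat_trans A B t by fact
  show "r \<cdot>\<^bsub>?C\<^esub> (s \<cdot>\<^bsub>?C\<^esub> t) = (r \<cdot>\<^bsub>?C\<^esub> s) \<cdot>\<^bsub>?C\<^esub> t"
    using t by (simp add: functor_cat_cmp r.F.B.assoc cong: restrict_cong)
qed

lemma iso_functor_cat:
  assumes "t \<in> ar (functor_cat A B S)" and iso: "\<And>x. x \<in> ob A \<Longrightarrow> iso B (ncmp t x)"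
  shows "iso (functor_cat A B S) t"
proof -
  have S: "nat_trans A B t" "ndom t \<in> S" "ncod t \<in> S" using assms(1) by auto
  interpret nat_trans A B t by fact
  let ?u = "\<lparr>ndom = ncod t, ncod = ndom t, ncmp = (\<lambda>x\<in>ob A. inverse_of B (ncmp t x))\<rparr>"
  note inv = iso F.B.inverse_of F.B.inverse_of_cancel
  have "nat_trans A B ?u"
  proof (rule nat_transI)
    fix f assume f: "f \<in> ar A"
    let ?x = "src A f" and ?y = "tgt A f"
    have "inverse_of B (ncmp t ?y) \<cdot>\<^bsub>B\<^esub> (ncmp t ?y \<cdot>\<^bsub>B\<^esub> (far (ndom t) f \<cdot>\<^bsub>B\<^esub> inverse_of B (ncmp t ?x)))
      = far (ndom t) f \<cdot>\<^bsub>B\<^esub> inverse_of B (ncmp t ?x)"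
      using f by (simp add: inv)
    moreover have "ncmp t ?y \<cdot>\<^bsub>B\<^esub> (far (ndom t) f \<cdot>\<^bsub>B\<^esub> inverse_of B (ncmp t ?x)) =
        far (ncod t) f \<cdot>\<^bsub>B\<^esub> (ncmp t ?x \<cdot>\<^bsub>B\<^esub> inverse_of B (ncmp t ?x))"
      by (rule F.B.commute_cmp[OF ncmp_natural[OF f]]) (use f in \<open>simp_all add: inv\<close>)
    ultimately show "ncmp ?u ?y \<cdot>\<^bsub>B\<^esub> far (ndom ?u) f = far (ncod ?u) f \<cdot>\<^bsub>B\<^esub> ncmp ?u ?x"
      using f by (simp add: inv)
  qed (simp_all add: inv F.cat_functor_axioms G.cat_functor_axioms)
  then show ?thesis unfolding iso_def hom_def
    by (intro conjI bexI[of _ ?u])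
      (use S in \<open>simp_all add: functor_cat_cmp functor_cat_ide inv cong: restrict_cong\<close>)
qed

section \<open>Strict morphisms and acyclic fibrations\<close>

lemma fcmp_assoc:
  assumes "cat_functor A B F"
  shows "fcmp A H (fcmp A G F) = fcmp A (fcmp B H G) F"
proof -
  interpret cat_functor A B F by fact
  show ?thesis by (simp add: fcmp_def compose_def fob_ob cong: restrict_cong)
qed

lemma fcmp_idf:
  assumes "cat_functor A B F"
  shows "fcmp A F (idf A) = F"
  by (rule fctr_eqI[OF cat_functor_fcmp[OF cat_functor_idf assms] assms])
    (use assms in \<open>simp_all add: cat_functor_def\<close>)

context contextual
begin

lemma dsp_closed [simp]:
  assumes "a \<in> ob A" "len A a \<ge> 1"
  shows "\<p> a \<in> ar A" "src A (\<p> a) = a" "tgt A (\<p> a) = \<partial> a"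
  using dsp_hom[OF assms] by (auto simp: hom_def)

lemma dsqD:
  assumes "(f', f) \<in> dsq A"
  shows "f' \<in> ar A" "f \<in> ar A" "src A f = \<partial> (src A f')" "tgt A f = \<partial> (tgt A f')"
    "len A (src A f') \<ge> 1" "len A (tgt A f') \<ge> 1"
  using dsq_shape[OF assms] by (auto simp: hom_def)

lemma dsq_unique:
  assumes "(f', f) \<in> dsq A" "(f'', f) \<in> dsq A" "tgt A f' = tgt A f''"
  shows "f' = f''"
  using dsq_ex1[of "tgt A f'" f] dsqD[OF assms(1)] assms src_tgt_ob(2) by metis

end

lemma strict_morphismD: "strict_morphism A B F \<Longrightarrow> cat_functor A B F"
  "strict_morphism A B F \<Longrightarrow> contextual A" "strict_morphism A B F \<Longrightarrow> contextual B"
  by (simp_all add: strict_morphism_def)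

lemma strict_morphism_idf:
  assumes "contextual A"
  shows "strict_morphism A A (idf A)"
proof -
  interpret contextual A by fact
  interpret I: cat_functor A A "idf A" by (rule cat_functor_idf) (rule category_axioms)
  show ?thesis
    by unfold_locales (simp_all add: par_ob dsqD)
qed

lemma strict_morphism_fcmp:
  assumes "strict_morphism A B F" "strict_morphism B C G"
  shows "strict_morphism A C (fcmp A G F)"
proof -
  interpret F: strict_morphism A B F by fact
  interpret G: strict_morphism B C G by fact
  interpret GF: cat_functor A C "fcmp A G F"
    by (rule cat_functor_fcmp[OF F.cat_functor_axioms G.cat_functor_axioms])
  show ?thesis
    by unfold_locales (simp_all add: F.A.par_ob F.A.dsqD F.fob_ob F.fob_len G.fob_len F.fob_par
      G.fob_par F.far_dsp G.far_dsp F.far_dsq G.far_dsq)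
qed

text \<open>Morphisms out of the representing objects are compared on the universal elements only. This
  settles all equations between morphisms in the lifting arguments.\<close>

lemma represents_O_unique:
  fixes R X :: "'u sctx"
  assumes "represents_O n R u" "strict_morphism R X F" "strict_morphism R X G" "fob F u = fob G u"
  shows "F = G"
proof -
  interpret F: strict_morphism R X F by fact
  have "\<exists>!H. strict_morphism R X H \<and> fob H u = fob F u"
    using assms(1) F.B.contextual_axioms F.fob_ob[of u] F.fob_len[of u]
    unfolding represents_O_def by simp
  then show ?thesis using assms(2-4) by (metis (no_types))
qed

lemma (in strict_morphism) far_section:
  assumes "a \<in> ob A" "len A a \<ge> 1" "is_section A a t"
  shows "is_section B (fob F a) (far F t)"
proof -
  have t: "t \<in> ar A" "src A t = \<partial>\<^bsub>A\<^esub> a" "tgt A t = a" "\<p>\<^bsub>A\<^esub> a \<cdot>\<^bsub>A\<^esub> t = ide A (\<partial>\<^bsub>A\<^esub> a)"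
    using assms(3) by (auto simp: is_section_def hom_def)
  have "\<p>\<^bsub>B\<^esub> (fob F a) \<cdot>\<^bsub>B\<^esub> far F t = far F (\<p>\<^bsub>A\<^esub> a \<cdot>\<^bsub>A\<^esub> t)"
    using t(1-3) assms(1,2) by (simp add: far_dsp)
  then show ?thesis
    using t assms by (simp add: is_section_def hom_def far_ide fob_par A.par_ob)
qed

lemma represents_O_plus_unique:
  fixes R X :: "'u sctx"
  assumes "represents_O_plus n R u s" "strict_morphism R X F" "strict_morphism R X G"
    and "fob F u = fob G u" "far F s = far G s"
  shows "F = G"
proof -
  interpret F: strict_morphism R X F by fact
  have r: "u \<in> ob R" "len R u = n" "n \<ge> 1" "is_section R u s"
    using assms(1) by (auto simp: represents_O_plus_def)
  have "\<exists>!H. strict_morphism R X H \<and> fob H u = fob F u \<and> far H s = far F s"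
    using assms(1) F.B.contextual_axioms F.fob_ob[of u] F.fob_len[of u] F.far_section[of u s] r
    unfolding represents_O_plus_def by simp
  then show ?thesis using assms(2-5) by (metis (no_types))
qed

text \<open>These conditions are the concrete content of lifting against \<open>\<iota>\<^sup>S\<close>, \<open>\<iota>\<^sup>T\<close> and \<open>\<pi>\<^sup>T\<close>: objects lift along
  \<open>\<partial>\<close>, and sections lift, uniquely. They make sense for contextual categories of any size.\<close>

locale lifting_equivalence = strict_morphism P Q p
  for P :: "('o, 'a, 'x) ctx_scheme" and Q :: "('p, 'b, 'y) ctx_scheme"
    and p :: "('o, 'a, 'p, 'b) fctr" +
  assumes full: "x \<in> ob P \<Longrightarrow> y \<in> ob P \<Longrightarrow> k \<in> hom Q (fob p x) (fob p y) \<Longrightarrow>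
      \<exists>f \<in> hom P x y. far p f = k"
    and faithful: "f \<in> ar P \<Longrightarrow> g \<in> ar P \<Longrightarrow> src P f = src P g \<Longrightarrow> tgt P f = tgt P g \<Longrightarrow>
      far p f = far p g \<Longrightarrow> f = g"
    and extend: "x \<in> ob P \<Longrightarrow> a \<in> ob Q \<Longrightarrow> len Q a \<ge> 1 \<Longrightarrow> \<partial>\<^bsub>Q\<^esub> a = fob p x \<Longrightarrow>
      \<exists>y\<in>ob P. \<partial>\<^bsub>P\<^esub> y = x \<and> fob p y = a"

text \<open>By the universal properties, a lifting problem against \<open>\<iota>\<^sup>S\<close> asks for an object of \<open>P\<close> with given parent
  and given image, which is \<open>extend\<close>. One against \<open>\<iota>\<^sup>T\<close> asks for a section with given image: fullness
  gives the arrow, and faithfulness that it is a section. In one against \<open>\<pi>\<^sup>T\<close> there are two sections of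
  the same display with the same image, so they agree by faithfulness.\<close>

lemma acyclic_fibration_lifting_equivalence:
  fixes P Q :: "'u sctx"
  assumes "lifting_equivalence P Q p"
  shows "acyclic_fibration P Q p"
proof -
  interpret p: lifting_equivalence P Q p by fact
  note p = p.strict_morphism_axioms and full = p.full and faithful = p.faithful
    and extend = p.extend
  have S: "lifts X Y i P Q p" if i: "is_iota_S n X Y i" for n X Y i
    unfolding lifts_def
  proof (intro allI impI)
    obtain u v where u: "represents_O (n - 1) X u" and v: "represents_O n Y v"
      and iu: "fob i u = \<partial>\<^bsub>Y\<^esub> v" and n: "n \<ge> 1" and si: "strict_morphism X Y i"
      using i unfolding is_iota_S_def by blast
    have u': "u \<in> ob X" and v': "v \<in> ob Y" "len Y v = n" using u v by (auto simp: represents_O_def)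
    fix F G assume *: "strict_morphism X P F \<and> strict_morphism Y Q G \<and> fcmp X p F = fcmp X G i"
    then have F: "strict_morphism X P F" and G: "strict_morphism Y Q G"
      and sq: "fcmp X p F = fcmp X G i" by blast+
    interpret F: strict_morphism X P F by fact
    interpret G: strict_morphism Y Q G by fact
    have "fob p (fob F u) = fob G (fob i u)" using arg_cong[OF sq, of "\<lambda>H. fob H u"] u' by simp
    then have "\<exists>y\<in>ob P. \<partial>\<^bsub>P\<^esub> y = fob F u \<and> fob p y = fob G v"
      using u' v' n iu by (intro extend) (simp_all add: F.fob_ob G.fob_ob G.fob_len G.fob_par)
    then obtain y where y: "y \<in> ob P" "\<partial>\<^bsub>P\<^esub> y = fob F u" "fob p y = fob G v" by blast
    have "len P y = n" using p.fob_len[OF y(1)] y(3) G.fob_len[OF v'(1)] v'(2) by simp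
    then obtain H where H: "strict_morphism Y P H" "fob H v = y"
      using v y(1) p.A.contextual_axioms unfolding represents_O_def by blast
    interpret H: strict_morphism Y P H by fact
    have "fcmp X H i = F"
      by (rule represents_O_unique[OF u strict_morphism_fcmp[OF si H(1)] F])
        (use u' v' iu H(2) y in \<open>simp add: H.fob_par\<close>)
    moreover have "fcmp Y p H = G"
      by (rule represents_O_unique[OF v strict_morphism_fcmp[OF H(1) p] G])
        (use v' H(2) y in simp)
    ultimately show "\<exists>H. strict_morphism Y P H \<and> fcmp X H i = F \<and> fcmp Y p H = G"
      using H(1) by blast
  qed
  have T: "lifts X Y i P Q p" if i: "is_iota_T n X Y i" for n X Y i
    unfolding lifts_def
  proof (intro allI impI)
    obtain u v s where u: "represents_O n X u" and v: "represents_O_plus n Y v s"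
      and iu: "fob i u = v" and n: "n \<ge> 1" and si: "strict_morphism X Y i"
      using i unfolding is_iota_T_def by blast
    have u': "u \<in> ob X" "len X u = n" using u by (auto simp: represents_O_def)
    have v': "v \<in> ob Y" "len Y v = n" "is_section Y v s" using v
      by (auto simp: represents_O_plus_def)
    then have s: "s \<in> ar Y" "src Y s = \<partial>\<^bsub>Y\<^esub> v" "tgt Y s = v" by (auto simp: is_section_def hom_def)
    fix F G assume *: "strict_morphism X P F \<and> strict_morphism Y Q G \<and> fcmp X p F = fcmp X G i"
    then have F: "strict_morphism X P F" and G: "strict_morphism Y Q G"
      and sq: "fcmp X p F = fcmp X G i" by blast+
    interpret F: strict_morphism X P F by fact
    interpret G: strict_morphism Y Q G by fact
    let ?x = "fob F u"
    have x: "?x \<in> ob P" "len P ?x = n" using u' by (simp_all add: F.fob_ob F.fob_len)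
    have px: "fob p ?x = fob G v"
      using arg_cong[OF sq, of "\<lambda>H. fob H u"] u' iu by simp
    have "\<exists>t \<in> hom P (\<partial>\<^bsub>P\<^esub> ?x) ?x. far p t = far G s"
      using x s px v' by (intro full) (simp_all add: p.A.par_ob hom_def p.fob_par G.fob_par)
    then obtain t where t: "t \<in> ar P" "src P t = \<partial>\<^bsub>P\<^esub> ?x" "tgt P t = ?x" "far p t = far G s"
      by (auto simp: hom_def)
    have "is_section Q (fob p ?x) (far G s)"
      using G.far_section[OF v'(1) _ v'(3)] n v'(2) px by simp
    then have "far p (\<p>\<^bsub>P\<^esub> ?x \<cdot>\<^bsub>P\<^esub> t) = far p (ide P (\<partial>\<^bsub>P\<^esub> ?x))"
      using x n t by (simp add: is_section_def p.far_dsp p.far_ide p.A.par_ob p.fob_par)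
    then have "\<p>\<^bsub>P\<^esub> ?x \<cdot>\<^bsub>P\<^esub> t = ide P (\<partial>\<^bsub>P\<^esub> ?x)"
      by (rule faithful[rotated 4]) (use x n t in \<open>simp_all add: p.A.par_ob\<close>)
    then have "is_section P ?x t" using t by (simp add: is_section_def hom_def)
    then obtain H where H: "strict_morphism Y P H" "fob H v = ?x" "far H s = t"
      using v x p.A.contextual_axioms unfolding represents_O_plus_def by blast
    have "fcmp X H i = F"
      by (rule represents_O_unique[OF u strict_morphism_fcmp[OF si H(1)] F])
        (use u' iu H(2) in simp)
    moreover have "fcmp Y p H = G"
      by (rule represents_O_plus_unique[OF v strict_morphism_fcmp[OF H(1) p] G])
        (use v' s H px t in simp_all)
    ultimately show "\<exists>H. strict_morphism Y P H \<and> fcmp X H i = F \<and> fcmp Y p H = G"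
      using H(1) by blast
  qed
  have Pi: "lifts Z Y q P Q p" if q: "is_pi_T n Z Y q" for n Z Y q
    unfolding lifts_def
  proof (intro allI impI)
    obtain X i j j' where i: "is_iota_T n X Y i" and po: "is_pushout X Y Y Z i i j j'"
      and qj: "fcmp Y q j = idf Y" "fcmp Y q j' = idf Y" and sq: "strict_morphism Z Y q"
      using q unfolding is_pi_T_def by blast
    obtain u v s where u: "represents_O n X u" and v: "represents_O_plus n Y v s"
      and iu: "fob i u = v" and n: "n \<ge> 1" and si: "strict_morphism X Y i"
      using i unfolding is_iota_T_def by blast
    have sj: "strict_morphism Y Z j" "strict_morphism Y Z j'" and ji: "fcmp X j i = fcmp X j' i"
      using po unfolding is_pushout_def by blast+
    have u': "u \<in> ob X" using u by (simp add: represents_O_def)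
    have v': "v \<in> ob Y" "is_section Y v s" using v by (auto simp: represents_O_plus_def)
    then have s: "s \<in> ar Y" "src Y s = \<partial>\<^bsub>Y\<^esub> v" "tgt Y s = v" by (auto simp: is_section_def hom_def)
    fix F G assume *: "strict_morphism Z P F \<and> strict_morphism Y Q G \<and> fcmp Z p F = fcmp Z G q"
    then have F: "strict_morphism Z P F" and G: "strict_morphism Y Q G"
      and pF: "fcmp Z p F = fcmp Z G q" by blast+
    note cf = strict_morphismD(1)
    \<comment> \<open>The two legs of \<open>F\<close> are morphisms to \<open>P\<close> that turn out to agree, and their common value is the lift.\<close>
    let ?H = "fcmp Y F j" and ?H' = "fcmp Y F j'"
    have H: "strict_morphism Y P ?H" "strict_morphism Y P ?H'"
      using sj F by (simp_all add: strict_morphism_fcmp)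
    interpret H: strict_morphism Y P ?H by fact
    interpret H': strict_morphism Y P ?H' by fact
    have pH: "fcmp Y p ?H = G" "fcmp Y p ?H' = G"
      using qj fcmp_assoc[OF cf[OF sj(1)]] fcmp_assoc[OF cf[OF sj(2)]] pF fcmp_idf[OF cf[OF G]]
      by metis+
    have "fob j v = fob j' v" using arg_cong[OF ji, of "\<lambda>H. fob H u"] u' iu by simp
    then have eq: "fob ?H v = fob ?H' v" using v' by simp
    have "far p (far ?H s) = far p (far ?H' s)"
      using arg_cong[OF pH(1), of "\<lambda>H. far H s"] arg_cong[OF pH(2), of "\<lambda>H. far H s"] s
      by (simp del: fcmp_apply(2) add: fcmp_apply(2)[of s Y p])
    then have "far ?H s = far ?H' s"
      by (rule faithful[rotated 4])
        (use s v' eq in \<open>simp_all del: fcmp_apply add: H.fob_par H'.fob_par\<close>)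
    then have HH': "?H = ?H'" by (rule represents_O_plus_unique[OF v H eq])
    let ?K = "fcmp Z ?H q"
    have K: "strict_morphism Z P ?K" by (rule strict_morphism_fcmp[OF sq H(1)])
    have Kj: "fcmp Y ?K j = ?H" "fcmp Y ?K j' = ?H'"
      using fcmp_assoc[OF cf[OF sj(1)], of ?H q] fcmp_assoc[OF cf[OF sj(2)], of ?H q] qj HH'
        fcmp_idf[OF cf[OF H(1)]] by simp_all
    have "fcmp X ?H i = fcmp X ?H' i" using HH' by simp
    then have "\<exists>!h. strict_morphism Z P h \<and> fcmp Y h j = ?H \<and> fcmp Y h j' = ?H'"
      using po H unfolding is_pushout_def by blast
    then have "?K = F" using K Kj F by blast
    then show "\<exists>H. strict_morphism Y P H \<and> fcmp Z H q = F \<and> fcmp Y p H = G"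
      using H(1) pH(1) by blast
  qed
  show ?thesis unfolding acyclic_fibration_def using p S T Pi by blast
qed

text \<open>A section is a lift of the identity along \<open>p\<close>, relative to the initial object; both composites
  from the initial object agree because there is only one object of length 0.\<close>

lemma cofibrant_section:
  fixes A P :: "'u sctx"
  assumes "cofibrant A" "acyclic_fibration P A p"
  obtains s where "strict_morphism A P s" "fcmp A p s = idf A"
proof -
  obtain R u i where u: "represents_O 0 R u" and i: "cofibration R A i"
    using assms(1) unfolding cofibrant_def by blast
  have p: "strict_morphism P A p" and si: "strict_morphism R A i"
    and lift: "lifts R A i P A p"
    using assms(2) i by (simp_all add: acyclic_fibration_def cofibration_def)
  interpret p: strict_morphism P A p by fact
  have id: "strict_morphism A A (idf A)" by (rule strict_morphism_idf[OF p.B.contextual_axioms])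
  have u': "u \<in> ob R" "len R u = 0" using u by (auto simp: represents_O_def)
  obtain x where "x \<in> ob P" "len P x = 0" using p.A.len_0_ex1 by blast
  then obtain F where F: "strict_morphism R P F" 
    using u p.A.contextual_axioms unfolding represents_O_def by blast
  have pF: "strict_morphism R A (fcmp R p F)" and ii: "strict_morphism R A (fcmp R (idf A) i)"
    by (rule strict_morphism_fcmp[OF F p], rule strict_morphism_fcmp[OF si id])
  interpret pF: strict_morphism R A "fcmp R p F" by fact
  interpret ii: strict_morphism R A "fcmp R (idf A) i" by fact
  have "fob (fcmp R p F) u = fob (fcmp R (idf A) i) u"
    using p.B.len_0_ex1 pF.fob_ob[of u] ii.fob_ob[of u] pF.fob_len[of u] ii.fob_len[of u] u'
    by metis
  then have "fcmp R p F = fcmp R (idf A) i" by (rule represents_O_unique[OF u pF ii])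
  then show thesis using lift F id that unfolding lifts_def by blast
qed

section \<open>The display map category of a contextual category\<close>

lemma weak_simps [simp]:
  "ob (weak A) = ob A" "ar (weak A) = ar A" "src (weak A) = src A" "tgt (weak A) = tgt A"
  "ide (weak A) = ide A" "cmp (weak A) = cmp A"
  by (simp_all add: weak_def)

lemma weak_eqs [simp]:
  "hom (weak A) = hom A" "terminal (weak A) = terminal A" "iso (weak A) = iso A"
  "pullback (weak A) = pullback A" "category (weak A) = category A"
  by (simp_all add: fun_eq_iff hom_def terminal_def iso_def pullback_def category_def)

lemma cat_functor_weak [simp]: "cat_functor (weak A) (weak B) = cat_functor A B"
  by (simp add: fun_eq_iff cat_functor_def cat_functor_axioms_def)

lemma nat_trans_weak [simp]: "nat_trans (weak A) (weak B) = nat_trans A B"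
  by (simp add: fun_eq_iff nat_trans_def nat_trans_axioms_def)

lemma functor_cat_weak [simp]: "functor_cat (weak A) (weak B) = functor_cat A B"
  by (simp add: fun_eq_iff functor_cat_def)

context category
begin

lemma pullback_cmp_isos:
  assumes "pullback C t l r b" "iso C u" "iso C v" "r' \<in> ar C" "src C u = src C r"
    "tgt C u = src C r'" "src C v = tgt C r" "tgt C v = tgt C r'" "r' \<cdot> u = v \<cdot> r"
  shows "pullback C (u \<cdot> t) l r' (v \<cdot> b)"
  by (rule pullback_paste[OF assms(1) pullback_of_isos])
    (use assms pullbackD[OF assms(1)] in simp_all)

lemma inverse_square:
  assumes "iso C u" "iso C v" "r \<in> ar C" "r' \<in> ar C" "src C u = src C r"
    "tgt C u = src C r'" "src C v = tgt C r" "tgt C v = tgt C r'" "r' \<cdot> u = v \<cdot> r"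
  shows "r \<cdot> inverse_of C u = inverse_of C v \<cdot> r'"
proof -
  have "inverse_of C v \<cdot> r' = inverse_of C v \<cdot> (r' \<cdot> (u \<cdot> inverse_of C u))"
    using assms by (simp add: inverse_of)
  also have "r' \<cdot> (u \<cdot> inverse_of C u) = v \<cdot> (r \<cdot> inverse_of C u)"
    by (rule commute_cmp) (use assms in \<open>simp_all add: inverse_of iso_ar\<close>)
  also have "inverse_of C v \<cdot> (v \<cdot> (r \<cdot> inverse_of C u)) = r \<cdot> inverse_of C u"
    using assms by (simp add: inverse_of inverse_of_cancel)
  finally show ?thesis by simp
qed

lemma pullback_cancel_isos:
  assumes "pullback C (u \<cdot> t) l r' (v \<cdot> b)" "iso C u" "iso C v" "r \<in> ar C" "t \<in> ar C" "b \<in> ar C"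
    and "src C u = src C r" "tgt C u = src C r'" "src C v = tgt C r" "tgt C v = tgt C r'"
    and "tgt C t = src C r" "tgt C b = tgt C r" "r' \<cdot> u = v \<cdot> r"
  shows "pullback C t l r b"
proof -
  have r': "r' \<in> ar C" using pullbackD[OF assms(1)] by simp
  have "r \<cdot> inverse_of C u = inverse_of C v \<cdot> r'"
    by (rule inverse_square) (use assms r' in simp_all)
  then have "pullback C (inverse_of C u \<cdot> (u \<cdot> t)) l r (inverse_of C v \<cdot> (v \<cdot> b))"
    by (intro pullback_cmp_isos[OF assms(1)]) (use assms in \<open>simp_all add: inverse_of iso_inverse_of\<close>)
  then show ?thesis using assms by (simp add: inverse_of_cancel)
qed

end

lemma dmaps_weak_iff:
  "f \<in> dmaps (weak A) \<longleftrightarrow> f \<in> ar A \<and> (\<exists>a u v. a \<in> ob A \<and> len A a \<ge> 1 \<and> \<p>\<^bsub>A\<^esub> a \<in> ar A \<and> iso A u \<and> iso A v \<and>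
    src A u = src A f \<and> tgt A u = src A (\<p>\<^bsub>A\<^esub> a) \<and> src A v = tgt A f \<and> tgt A v = tgt A (\<p>\<^bsub>A\<^esub> a) \<and>
    \<p>\<^bsub>A\<^esub> a \<cdot>\<^bsub>A\<^esub> u = v \<cdot>\<^bsub>A\<^esub> f)"
  by (auto simp: weak_def arrow_iso_def hom_def iso_def)

context contextual
begin

lemma dmaps_weakE:
  assumes "f \<in> dmaps (weak A)"
  obtains a u v where "f \<in> ar A" "a \<in> ob A" "len A a \<ge> 1" "iso A u" "iso A v" "src A u = src A f"
    "tgt A u = a" "src A v = tgt A f" "tgt A v = \<partial> a" "\<p> a \<cdot> u = v \<cdot> f"
  using assms unfolding dmaps_weak_iff by auto

lemma dsp_dmaps: "a \<in> ob A \<Longrightarrow> len A a \<ge> 1 \<Longrightarrow> \<p> a \<in> dmaps (weak A)"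
  unfolding dmaps_weak_iff
  by (intro conjI exI[of _ a] exI[of _ "ide A a"] exI[of _ "ide A (\<partial> a)"])
    (simp_all add: par_ob iso_ide)

lemma display_pullback:
  assumes "p \<in> dmaps (weak A)" "f \<in> ar A" "tgt A f = tgt A p"
  obtains a u v g where "a \<in> ob A" "len A a \<ge> 1" "iso A u" "iso A v" "src A u = src A p"
    "tgt A u = a" "src A v = tgt A p" "tgt A v = \<partial> a" "\<p> a \<cdot> u = v \<cdot> p"
    "(g, v \<cdot> f) \<in> dsq A" "tgt A g = a"
proof -
  obtain a u v where *: "p \<in> ar A" "a \<in> ob A" "len A a \<ge> 1" "iso A u" "iso A v" "src A u = src A p"
    "tgt A u = a" "src A v = tgt A p" "tgt A v = \<partial> a" "\<p> a \<cdot> u = v \<cdot> p"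
    by (rule dmaps_weakE[OF assms(1)])
  then obtain g where "(g, v \<cdot> f) \<in> dsq A" "tgt A g = a"
    using dsq_ex1[of a "v \<cdot> f"] assms iso_ar by auto
  with * that show thesis by blast
qed

text \<open>Through \<open>m\<close>, an arbitrary pullback of a display map becomes a distinguished square. This reduces
  stability of display maps, and preservation of their pullbacks by strict morphisms, to the axioms
  about distinguished squares.\<close>

lemma display_pullback_comparison:
  assumes "p \<in> dmaps (weak A)" "pullback A t l p f"
  obtains a u v g m where "a \<in> ob A" "len A a \<ge> 1" "iso A u" "iso A v" "src A u = src A p"
    "tgt A u = a" "src A v = tgt A p" "tgt A v = \<partial> a" "\<p> a \<cdot> u = v \<cdot> p"
    "(g, v \<cdot> f) \<in> dsq A" "tgt A g = a"
    "iso A m" "src A m = src A l" "tgt A m = src A g" "g \<cdot> m = u \<cdot> t" "\<p> (src A g) \<cdot> m = l"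
proof -
  note pb = pullbackD[OF assms(2)]
  obtain a u v g where *: "a \<in> ob A" "len A a \<ge> 1" "iso A u" "iso A v" "src A u = src A p"
    "tgt A u = a" "src A v = tgt A p" "tgt A v = \<partial> a" "\<p> a \<cdot> u = v \<cdot> p"
    "(g, v \<cdot> f) \<in> dsq A" "tgt A g = a"
    by (rule display_pullback[OF assms(1) pb(4,8)])
  have "pullback A (u \<cdot> t) l (\<p> a) (v \<cdot> f)"
    by (rule pullback_cmp_isos[OF assms(2)]) (use * in simp_all)
  moreover have "pullback A g (\<p> (src A g)) (\<p> a) (v \<cdot> f)"
    using dsq_pullback[OF *(10)] *(11) by simp
  ultimately obtain m where "iso A m" "src A m = src A l" "tgt A m = src A (\<p> (src A g))"
    "g \<cdot> m = u \<cdot> t" "\<p> (src A g) \<cdot> m = l"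
    using pullback_comparison_iso by blast
  then show thesis using * dsqD[OF *(10)] by (intro that[of a u v g m]) simp_all
qed

lemma dmaps_weak_ar: "dmaps (weak A) \<subseteq> ar A"
  by (auto simp: weak_def)

lemma rooted_dmc_weak: "rooted_dmc (weak A)"
proof -
  have 1: "\<exists>t l. pullback A t l p f"
    if p: "p \<in> dmaps (weak A)" and f: "f \<in> ar A" "tgt A f = tgt A p" for p f
  proof -
    obtain a u v g where *: "a \<in> ob A" "len A a \<ge> 1" "iso A u" "iso A v" "src A u = src A p"
      "tgt A u = a" "src A v = tgt A p" "tgt A v = \<partial> a" "\<p> a \<cdot> u = v \<cdot> p"
      "(g, v \<cdot> f) \<in> dsq A" "tgt A g = a"
      by (rule display_pullback[OF p f])
    have pa: "p \<in> ar A" using p unfolding dmaps_weak_iff by blast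
    have g: "g \<in> ar A" using dsqD[OF *(10)] by simp
    have "pullback A (u \<cdot> (inverse_of A u \<cdot> g)) (\<p> (src A g)) (\<p> a) (v \<cdot> f)"
      using dsq_pullback[OF *(10)] * g by (simp add: inverse_of_cancel)
    then have "pullback A (inverse_of A u \<cdot> g) (\<p> (src A g)) p f"
      by (rule pullback_cancel_isos) (use * f g pa in \<open>simp_all add: inverse_of\<close>)
    then show ?thesis by blast
  qed
  have 2: "l \<in> dmaps (weak A)" if p: "p \<in> dmaps (weak A)" and pb: "pullback A t l p f" for t l p f
  proof -
    obtain a u v g m where *: "a \<in> ob A" "len A a \<ge> 1" "iso A u" "iso A v" "src A u = src A p"
      "tgt A u = a" "src A v = tgt A p" "tgt A v = \<partial> a" "\<p> a \<cdot> u = v \<cdot> p"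
      "(g, v \<cdot> f) \<in> dsq A" "tgt A g = a" "iso A m" "src A m = src A l" "tgt A m = src A g"
      "g \<cdot> m = u \<cdot> t" "\<p> (src A g) \<cdot> m = l"
      by (rule display_pullback_comparison[OF p pb])
    have "src A (v \<cdot> f) = \<partial> (src A g)" using dsqD[OF *(10)] by simp
    then have "tgt A l = \<partial> (src A g)" "\<partial> (src A g) \<in> ob A"
      using pullbackD[OF pb] * dsqD[OF *(10)] by (simp_all add: iso_ar par_ob)
    then show ?thesis unfolding dmaps_weak_iff
      by (intro conjI exI[of _ "src A g"] exI[of _ m] exI[of _ "ide A (\<partial> (src A g))"])
        (use * dsqD[OF *(10)] pullbackD[OF pb] in \<open>simp_all add: iso_ide\<close>)
  qed
  have 3: "\<exists>x. terminal A x" using len_0_ex1 len_0_terminal by blast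
  have 4: "\<exists>n \<Gamma> d. \<Gamma> n = x \<and> terminal A (\<Gamma> 0) \<and>
      (\<forall>i<n. d i \<in> dmaps (weak A) \<and> d i \<in> hom A (\<Gamma> (Suc i)) (\<Gamma> i))" if x: "x \<in> ob A" for x
  proof -
    let ?n = "len A x" and ?\<Gamma> = "\<lambda>i. (par A ^^ (len A x - i)) x"
    have ob: "(par A ^^ k) x \<in> ob A \<and> len A ((par A ^^ k) x) = len A x - k" for k
      by (induction k) (simp_all add: x par_ob len_par)
    have "\<p> (?\<Gamma> (Suc i)) \<in> dmaps (weak A) \<and> \<p> (?\<Gamma> (Suc i)) \<in> hom A (?\<Gamma> (Suc i)) (?\<Gamma> i)"
      if i: "i < ?n" for i
    proof -
      have "?n - i = Suc (?n - Suc i)" using i by simp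
      then have "?\<Gamma> i = \<partial> (?\<Gamma> (Suc i))" by (simp only: funpow.simps(2) o_apply)
      then show ?thesis using dsp_dmaps[of "?\<Gamma> (Suc i)"] dsp_hom[of "?\<Gamma> (Suc i)"] ob i by simp
    qed
    moreover have "terminal A (?\<Gamma> 0)" using ob[of ?n] len_0_terminal by simp
    ultimately show ?thesis
      by (intro exI[of _ ?n] exI[of _ ?\<Gamma>] exI[of _ "\<lambda>i. \<p> (?\<Gamma> (Suc i))"]) simp
  qed
  show ?thesis
    unfolding rooted_dmc_def rooted_dmc_axioms_def display_map_category_def
      display_map_category_axioms_def
    using 1 2 3 4 category_axioms by (simp add: dmaps_weak_ar)
qed

end

text \<open>A pullback of a display map is sent to a square that is isomorphic to the image of a distinguished
  square, hence to a distinguished square of \<open>B\<close>.\<close>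

lemma (in strict_morphism) dmc_morphism_weak: "dmc_morphism (weak A) (weak B) F"
proof -
  have 1: "far F p \<in> dmaps (weak B)" if p: "p \<in> dmaps (weak A)" for p
  proof -
    obtain a u v where *: "p \<in> ar A" "a \<in> ob A" "len A a \<ge> 1" "iso A u" "iso A v"
      "src A u = src A p" "tgt A u = a" "src A v = tgt A p" "tgt A v = \<partial>\<^bsub>A\<^esub> a"
      "\<p>\<^bsub>A\<^esub> a \<cdot>\<^bsub>A\<^esub> u = v \<cdot>\<^bsub>A\<^esub> p"
      by (rule A.dmaps_weakE[OF p])
    have "far F (\<p>\<^bsub>A\<^esub> a) \<cdot>\<^bsub>B\<^esub> far F u = far F v \<cdot>\<^bsub>B\<^esub> far F p"
      by (rule far_square) (use * in \<open>simp_all add: A.iso_ar\<close>)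
    then have "\<p>\<^bsub>B\<^esub> (fob F a) \<cdot>\<^bsub>B\<^esub> far F u = far F v \<cdot>\<^bsub>B\<^esub> far F p"
      using * by (simp add: far_dsp)
    then show ?thesis unfolding dmaps_weak_iff
      by (intro conjI exI[of _ "fob F a"] exI[of _ "far F u"] exI[of _ "far F v"])
        (use * in \<open>simp_all add: A.iso_ar far_iso fob_ob fob_len fob_par\<close>)
  qed
  have 2: "pullback B (far F t) (far F l) (far F p) (far F f)"
    if p: "p \<in> dmaps (weak A)" and pb: "pullback A t l p f" for t l p f
  proof -
    obtain a u v g m where *: "a \<in> ob A" "len A a \<ge> 1" "iso A u" "iso A v" "src A u = src A p"
      "tgt A u = a" "src A v = tgt A p" "tgt A v = \<partial>\<^bsub>A\<^esub> a" "\<p>\<^bsub>A\<^esub> a \<cdot>\<^bsub>A\<^esub> u = v \<cdot>\<^bsub>A\<^esub> p"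
      "(g, v \<cdot>\<^bsub>A\<^esub> f) \<in> dsq A" "tgt A g = a" "iso A m" "src A m = src A l" "tgt A m = src A g"
      "g \<cdot>\<^bsub>A\<^esub> m = u \<cdot>\<^bsub>A\<^esub> t" "\<p>\<^bsub>A\<^esub> (src A g) \<cdot>\<^bsub>A\<^esub> m = l"
      by (rule A.display_pullback_comparison[OF p pb])
    note pbD = A.pullbackD[OF pb] and g = A.dsqD[OF *(10)]
    have g_ob: "src A g \<in> ob A" using g by simp
    have "pullback B (far F g) (\<p>\<^bsub>B\<^esub> (fob F (src A g))) (\<p>\<^bsub>B\<^esub> (fob F a)) (far F (v \<cdot>\<^bsub>A\<^esub> f))"
      using B.dsq_pullback[OF far_dsq[OF *(10)]] g *(11) by simp
    from B.pullback_precompose_iso[OF this far_iso[OF *(12)]]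
    have "pullback B (far F g \<cdot>\<^bsub>B\<^esub> far F m) (\<p>\<^bsub>B\<^esub> (fob F (src A g)) \<cdot>\<^bsub>B\<^esub> far F m) (\<p>\<^bsub>B\<^esub> (fob F a))
        (far F (v \<cdot>\<^bsub>A\<^esub> f))"
      using * g by (simp add: A.iso_ar fob_ob fob_len)
    moreover have "far F g \<cdot>\<^bsub>B\<^esub> far F m = far F u \<cdot>\<^bsub>B\<^esub> far F t"
      by (rule far_square[OF *(15)]) (use * g pbD in \<open>simp_all add: A.iso_ar\<close>)
    moreover have "\<p>\<^bsub>B\<^esub> (fob F (src A g)) \<cdot>\<^bsub>B\<^esub> far F m = far F l"
      using far_comp[of m "\<p>\<^bsub>A\<^esub> (src A g)"] * g by (simp add: A.iso_ar far_dsp)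
    moreover have "far F (v \<cdot>\<^bsub>A\<^esub> f) = far F v \<cdot>\<^bsub>B\<^esub> far F f"
      using * pbD by (simp add: A.iso_ar)
    moreover have "far F (\<p>\<^bsub>A\<^esub> a) \<cdot>\<^bsub>B\<^esub> far F u = far F v \<cdot>\<^bsub>B\<^esub> far F p"
      by (rule far_square[OF *(9)]) (use * pbD in \<open>simp_all add: A.iso_ar\<close>)
    then have sq: "\<p>\<^bsub>B\<^esub> (fob F a) \<cdot>\<^bsub>B\<^esub> far F u = far F v \<cdot>\<^bsub>B\<^esub> far F p"
      using * by (simp add: far_dsp)
    ultimately have "pullback B (far F u \<cdot>\<^bsub>B\<^esub> far F t) (far F l) (\<p>\<^bsub>B\<^esub> (fob F a))
        (far F v \<cdot>\<^bsub>B\<^esub> far F f)" by simp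
    then show ?thesis
      by (rule B.pullback_cancel_isos)
        (use * sq pbD in \<open>simp_all add: A.iso_ar far_iso fob_ob fob_len fob_par\<close>)
  qed
  have 3: "terminal B (fob F x)" if x: "terminal A x" for x
  proof -
    obtain o1 where o1: "o1 \<in> ob A" "len A o1 = 0" using A.len_0_ex1 by blast
    have t: "terminal A o1" "terminal B (fob F o1)"
      using o1 by (simp_all add: A.len_0_terminal B.len_0_terminal fob_ob fob_len)
    have x': "x \<in> ob A" using x by (simp add: terminal_def)
    then obtain f where f: "f \<in> hom A x o1" using t(1) by (auto simp: terminal_def)
    have i: "iso B (far F f)" by (rule far_iso[OF A.iso_between_terminal[OF x t(1) f]])
    then show ?thesis using B.terminal_iso[OF t(2) i] f by (simp add: hom_def)
  qed
  show ?thesis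
    unfolding dmc_morphism_def dmc_morphism_axioms_def
    using 1 2 3 A.rooted_dmc_weak B.rooted_dmc_weak cat_functor_axioms by simp
qed

text \<open>Both categories are full subcategories of the category of all functors, so the inclusion is
  automatically full and faithful.\<close>

lemma equivalence_inclusion:
  assumes "contextual A" "contextual B"
    and strictify: "\<And>F. dmc_morphism (weak A) (weak B) F \<Longrightarrow>
      \<exists>G. strict_morphism A B G \<and> nat_isomorphic A B F G"
  shows "equivalence (Cont_cat A B) (DMC_cat (weak A) (weak B)) (inclusion A B)"
proof -
  let ?T = "{F. dmc_morphism (weak A) (weak B) F}" and ?S = "{F. strict_morphism A B F}"
  let ?C = "functor_cat A B ?T"
  have T: "cat_functor A B F" if "F \<in> ?T" for F
    using that cat_functor_weak[of A B] by (auto simp: dmc_morphism_def)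
  interpret C: category ?C by (rule category_functor_cat[OF T])
  have sub: "?S \<subseteq> ?T" using strict_morphism.dmc_morphism_weak by blast
  have "equivalence (full_sub ?C ?S) ?C
    \<lparr>fob = (\<lambda>x\<in>?S. x), far = (\<lambda>f\<in>ar (full_sub ?C ?S). f)\<rparr>"
  proof (rule C.equivalence_full_sub)
    fix F assume "F \<in> ob ?C"
    then have F: "F \<in> ?T" by simp
    then obtain G t where G: "G \<in> ?S" and t: "nat_trans A B t" "ndom t = F" "ncod t = G"
      "\<And>x. x \<in> ob A \<Longrightarrow> iso B (ncmp t x)"
      using strictify unfolding nat_isomorphic_def by blast
    then have "iso ?C t" using F sub by (intro iso_functor_cat) auto
    then show "\<exists>e. iso ?C e \<and> src ?C e = F \<and> tgt ?C e \<in> ?S" using t G by (intro exI[of _ t]) simp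
  qed (use sub in simp)
  then show ?thesis
    using full_sub_functor_cat[OF sub, of A B] functor_cat_weak[of A B]
    unfolding Cont_cat_def DMC_cat_def inclusion_def by simp
qed

section \<open>Sections over cofibrant contextual categories\<close>

text \<open>A copy of a small contextual category on subsets of \<open>'u\<close>, obtained by transport of structure along
  encodings of its objects and arrows. The morphism \<open>decode\<close> is the isomorphism back.\<close>

definition image_ctx :: "('p \<Rightarrow> 'u) \<Rightarrow> ('q \<Rightarrow> 'u) \<Rightarrow> ('p, 'q, 'x) ctx_scheme \<Rightarrow> 'u sctx" where
  "image_ctx i j P =
    \<lparr>ob = i ` ob P, ar = j ` ar P,
     src = (\<lambda>g. i (src P (inv_into (ar P) j g))), tgt = (\<lambda>g. i (tgt P (inv_into (ar P) j g))),
     ide = (\<lambda>u. j (ide P (inv_into (ob P) i u))),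
     cmp = (\<lambda>g f. j (inv_into (ar P) j g \<cdot>\<^bsub>P\<^esub> inv_into (ar P) j f)),
     len = (\<lambda>u. len P (inv_into (ob P) i u)), par = (\<lambda>u. i (\<partial>\<^bsub>P\<^esub> (inv_into (ob P) i u))),
     dsp = (\<lambda>u. j (\<p>\<^bsub>P\<^esub> (inv_into (ob P) i u))), dsq = (\<lambda>(f', f). (j f', j f)) ` dsq P\<rparr>"

definition decode :: "('p \<Rightarrow> 'u) \<Rightarrow> ('q \<Rightarrow> 'u) \<Rightarrow> ('p, 'q, 'x) ctx_scheme \<Rightarrow>
    ('u, 'u, 'p, 'q) fctr" where
  "decode i j P =
    \<lparr>fob = (\<lambda>u \<in> i ` ob P. inv_into (ob P) i u), far = (\<lambda>g \<in> j ` ar P. inv_into (ar P) j g)\<rparr>"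

context contextual
begin

lemma decode_strict:
  fixes i :: "'o \<Rightarrow> 'u" and j :: "'a \<Rightarrow> 'u"
  assumes i: "inj_on i (ob A)" and j: "inj_on j (ar A)"
  shows "strict_morphism (image_ctx i j A) A (decode i j A)"
proof -
  let ?T = "image_ctx i j A"
  have I [simp]: "inv_into (ob A) i (i x) = x" if "x \<in> ob A" for x using i that by simp
  have J [simp]: "inv_into (ar A) j (j f) = f" if "f \<in> ar A" for f using j that by simp
  have i_eq [simp]: "i x = i y \<longleftrightarrow> x = y" if "x \<in> ob A" "y \<in> ob A" for x y
    using i that by (auto dest: inj_onD)
  have j_eq [simp]: "j f = j g \<longleftrightarrow> f = g" if "f \<in> ar A" "g \<in> ar A" for f g
    using j that by (auto dest: inj_onD)
  have T: "ob ?T = i ` ob A" "ar ?T = j ` ar A" by (simp_all add: image_ctx_def)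
  have Ts [simp]: "src ?T (j f) = i (src A f)" "tgt ?T (j f) = i (tgt A f)" if "f \<in> ar A" for f
    using that by (simp_all add: image_ctx_def)
  have Tc [simp]: "j g \<cdot>\<^bsub>?T\<^esub> j f = j (g \<cdot> f)" if "f \<in> ar A" "g \<in> ar A" for f g
    using that by (simp add: image_ctx_def)
  have To [simp]: "ide ?T (i x) = j (ide A x)" "len ?T (i x) = len A x"
      "\<partial>\<^bsub>?T\<^esub> (i x) = i (\<partial> x)" "\<p>\<^bsub>?T\<^esub> (i x) = j (\<p> x)" if "x \<in> ob A" for x
    using that by (simp_all add: image_ctx_def)
  have homT: "hom ?T (i x) (i y) = j ` hom A x y" if "x \<in> ob A" "y \<in> ob A" for x y
    using that by (auto simp: hom_def T)
  have dsqT: "(j f', j f) \<in> dsq ?T \<longleftrightarrow> (f', f) \<in> dsq A" if "f' \<in> ar A" "f \<in> ar A" for f' f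
  proof -
    have "(g', g) = (f', f)" if "(g', g) \<in> dsq A" "j f' = j g'" "j f = j g" for g' g
      using that \<open>f' \<in> ar A\<close> \<open>f \<in> ar A\<close> dsqD[OF that(1)] by simp
    moreover have "(j f', j f) \<in> dsq ?T \<longleftrightarrow> (\<exists>(g', g) \<in> dsq A. j f' = j g' \<and> j f = j g)"
      by (auto simp: image_ctx_def)
    ultimately show ?thesis by blast
  qed
  have dsqE: "\<exists>f' f. g' = j f' \<and> g = j f \<and> (f', f) \<in> dsq A" if "(g', g) \<in> dsq ?T" for g' g
    using that by (auto simp: image_ctx_def)
  interpret T: category ?T
  proof
    fix f x y assume "f \<in> hom ?T x y"
    then show "ide ?T y \<cdot>\<^bsub>?T\<^esub> f = f" "f \<cdot>\<^bsub>?T\<^esub> ide ?T x = f" by (auto simp: hom_def T)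
  next
    fix f g x y z assume "f \<in> hom ?T x y" "g \<in> hom ?T y z"
    then show "g \<cdot>\<^bsub>?T\<^esub> f \<in> hom ?T x z" by (auto simp: hom_def T)
  next
    fix f g h w x y z assume "f \<in> hom ?T w x" "g \<in> hom ?T x y" "h \<in> hom ?T y z"
    then show "h \<cdot>\<^bsub>?T\<^esub> (g \<cdot>\<^bsub>?T\<^esub> f) = (h \<cdot>\<^bsub>?T\<^esub> g) \<cdot>\<^bsub>?T\<^esub> f" by (auto simp: hom_def T assoc)
  qed (auto simp: hom_def T)
  have pbT: "pullback ?T (j t) (j l) (j r) (j b)" if pb: "pullback A t l r b" for t l r b
  proof (rule T.pullbackI)
    note pbD = pullbackD[OF pb]
    { fix u v assume "u \<in> ar ?T" "v \<in> ar ?T" "src ?T u = src ?T v" "tgt ?T u = src ?T (j r)"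
        "tgt ?T v = src ?T (j b)" "j r \<cdot>\<^bsub>?T\<^esub> u = j b \<cdot>\<^bsub>?T\<^esub> v"
      then obtain u' v' where uv: "u = j u'" "v = j v'" "u' \<in> ar A" "v' \<in> ar A"
        "src A u' = src A v'" "tgt A u' = src A r" "tgt A v' = src A b" "r \<cdot> u' = b \<cdot> v'"
        using pbD by (auto simp: T)
      then obtain h where "h \<in> ar A" "src A h = src A v'" "tgt A h = src A l" "t \<cdot> h = u'"
        "l \<cdot> h = v'" using pullback_ex[OF pb uv(3-)] by blast
      then show "\<exists>h. h \<in> ar ?T \<and> src ?T h = src ?T v \<and> tgt ?T h = src ?T (j l) \<and>
          j t \<cdot>\<^bsub>?T\<^esub> h = u \<and> j l \<cdot>\<^bsub>?T\<^esub> h = v"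
        using uv(1-4) pbD by (intro exI[of _ "j h"]) (simp add: T) }
    { fix h k assume "h \<in> ar ?T" "k \<in> ar ?T" "src ?T h = src ?T k" "tgt ?T h = src ?T (j l)"
        "tgt ?T k = src ?T (j l)" "j t \<cdot>\<^bsub>?T\<^esub> h = j t \<cdot>\<^bsub>?T\<^esub> k" "j l \<cdot>\<^bsub>?T\<^esub> h = j l \<cdot>\<^bsub>?T\<^esub> k"
      then obtain h' k' where hk: "h = j h'" "k = j k'" "h' \<in> ar A" "k' \<in> ar A"
        "src A h' = src A k'" "tgt A h' = src A l" "tgt A k' = src A l" "t \<cdot> h' = t \<cdot> k'"
        "l \<cdot> h' = l \<cdot> k'"
        using pbD by (auto simp: T)
      then show "h = k" using pullback_unique[OF pb hk(3-)] by simp }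
  qed (use pullbackD[OF pb] in \<open>auto simp: T\<close>)
  interpret T: contextual ?T
  proof
    fix a assume "a \<in> ob ?T"
    then show "\<partial>\<^bsub>?T\<^esub> a \<in> ob ?T" "len ?T (\<partial>\<^bsub>?T\<^esub> a) = len ?T a - 1" by (auto simp: T par_ob len_par)
  next
    fix a assume "a \<in> ob ?T" "1 \<le> len ?T a"
    then show "\<p>\<^bsub>?T\<^esub> a \<in> hom ?T a (\<partial>\<^bsub>?T\<^esub> a)" "(ide ?T a, ide ?T (\<partial>\<^bsub>?T\<^esub> a)) \<in> dsq ?T"
      by (auto simp: T hom_def dsqT par_ob dsq_ide)
  next
    fix g' g assume "(g', g) \<in> dsq ?T"
    then obtain f' f where f: "g' = j f'" "g = j f" "(f', f) \<in> dsq A" using dsqE by blast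
    note D = dsqD[OF f(3)]
    show "g' \<in> ar ?T \<and> 1 \<le> len ?T (src ?T g') \<and> 1 \<le> len ?T (tgt ?T g') \<and>
        g \<in> hom ?T (\<partial>\<^bsub>?T\<^esub> (src ?T g')) (\<partial>\<^bsub>?T\<^esub> (tgt ?T g'))"
      using f D by (auto simp: T hom_def)
    show "pullback ?T g' (\<p>\<^bsub>?T\<^esub> (src ?T g')) (\<p>\<^bsub>?T\<^esub> (tgt ?T g')) g"
      using pbT[OF dsq_pullback[OF f(3)]] f D by simp
  next
    obtain a where a: "a \<in> ob A" "len A a = 0" "\<And>b. b \<in> ob A \<Longrightarrow> len A b = 0 \<Longrightarrow> b = a"
      using len_0_ex1 by blast
    show "\<exists>!a. a \<in> ob ?T \<and> len ?T a = 0"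
    proof (rule ex1I[of _ "i a"])
      fix u assume "u \<in> ob ?T \<and> len ?T u = 0"
      then obtain b where b: "u = i b" "b \<in> ob A" "len A b = 0" by (auto simp: T)
      show "u = i a" unfolding b(1) a(3)[OF b(2,3)] ..
    qed (use a(1,2) in \<open>simp add: T\<close>)
  next
    fix a assume "a \<in> ob ?T" "len ?T a = 0"
    then obtain b where b: "a = i b" "b \<in> ob A" "len A b = 0" by (auto simp: T)
    have t: "terminal A b" by (rule len_0_terminal[OF b(2,3)])
    show "terminal ?T a" unfolding terminal_def
    proof (intro conjI ballI)
      show "a \<in> ob ?T" using b by (simp add: T)
      fix z assume "z \<in> ob ?T"
      then obtain x where x: "z = i x" "x \<in> ob A" by (auto simp: T)
      then obtain f where f: "f \<in> hom A x b" "\<And>g. g \<in> hom A x b \<Longrightarrow> g = f"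
        using t unfolding terminal_def by blast
      show "\<exists>!f. f \<in> hom ?T z a" unfolding b(1) x(1) homT[OF x(2) b(2)] using f by blast
    qed
  next
    fix b g assume "b \<in> ob ?T" "1 \<le> len ?T b" "g \<in> ar ?T" "tgt ?T g = \<partial>\<^bsub>?T\<^esub> b"
    then obtain c f where c: "b = i c" "c \<in> ob A" "1 \<le> len A c" "g = j f" "f \<in> ar A"
      "tgt A f = \<partial> c" by (auto simp: T par_ob)
    then obtain f' where f': "(f', f) \<in> dsq A" "tgt A f' = c" using dsq_ex1 by blast
    show "\<exists>!g'. (g', g) \<in> dsq ?T \<and> tgt ?T g' = b"
    proof (rule ex1I[of _ "j f'"])
      show "(j f', g) \<in> dsq ?T \<and> tgt ?T (j f') = b" using c f' dsqD[OF f'(1)] by (simp add: dsqT)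
      fix g' assume g': "(g', g) \<in> dsq ?T \<and> tgt ?T g' = b"
      then obtain k' k where k: "g' = j k'" "g = j k" "(k', k) \<in> dsq A" using dsqE by blast
      then have "k = f" "tgt A k' = c" using g' c dsqD[OF k(3)] by auto
      then have "k' = f'" using dsq_unique k(3) f' by blast
      then show "g' = j f'" using k by simp
    qed
  next
    fix f' f g' g assume "(f', f) \<in> dsq ?T" "(g', g) \<in> dsq ?T" "tgt ?T f' = src ?T g'"
    then obtain h' h k' k where "f' = j h'" "f = j h" "(h', h) \<in> dsq A" "g' = j k'" "g = j k"
      "(k', k) \<in> dsq A" using dsqE by metis
    with \<open>tgt ?T f' = src ?T g'\<close> show "(g' \<cdot>\<^bsub>?T\<^esub> f', g \<cdot>\<^bsub>?T\<^esub> f) \<in> dsq ?T"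
      using dsq_cmp[of h' h k' k] dsqD[of h' h] dsqD[of k' k] by (simp add: dsqT)
  qed
  have D [simp]: "fob (decode i j A) (i x) = x" if "x \<in> ob A" for x
    using that by (simp add: decode_def)
  have D' [simp]: "far (decode i j A) (j f) = f" if "f \<in> ar A" for f
    using that by (simp add: decode_def)
  interpret D: cat_functor ?T A "decode i j A"
    by (rule cat_functorI)
      (auto simp: T.category_axioms category_axioms T, simp_all add: decode_def T)
  show ?thesis
  proof
    fix a assume "a \<in> ob ?T"
    then obtain b where b: "a = i b" "b \<in> ob A" by (auto simp: T)
    then show "len A (fob (decode i j A) a) = len ?T a"
      "fob (decode i j A) (\<partial>\<^bsub>?T\<^esub> a) = \<partial> (fob (decode i j A) a)" by (simp_all add: par_ob)
    assume "1 \<le> len ?T a"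
    then show "far (decode i j A) (\<p>\<^bsub>?T\<^esub> a) = \<p> (fob (decode i j A) a)" using b by simp
  next
    fix g' g assume "(g', g) \<in> dsq ?T"
    then obtain f' f where "g' = j f'" "g = j f" "(f', f) \<in> dsq A" using dsqE by blast
    then show "(far (decode i j A) g', far (decode i j A) g) \<in> dsq A" using dsqD by simp
  qed
qed

end

text \<open>The lifting property in the definition of cofibrancy is available for the copy of \<open>P\<close> on a subset of
  \<open>'u\<close>, since being a lifting equivalence is invariant under isomorphism of \<open>P\<close>.\<close>

lemma cofibrant_lifting_section:
  fixes A :: "'u sctx" and P :: "('p, 'q, 'x) ctx_scheme" and i :: "'p \<Rightarrow> 'u" and j :: "'q \<Rightarrow> 'u"
  assumes "cofibrant A" "lifting_equivalence P A p" "inj_on i (ob P)" "inj_on j (ar P)"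
  obtains s where "strict_morphism A P s" "fcmp A p s = idf A"
proof -
  interpret p: lifting_equivalence P A p by fact
  let ?T = "image_ctx i j P" and ?d = "decode i j P"
  have d: "strict_morphism ?T P ?d" by (rule p.A.decode_strict[OF assms(3,4)])
  interpret d: strict_morphism ?T P ?d by fact
  have T: "ob ?T = i ` ob P" "ar ?T = j ` ar P" by (simp_all add: image_ctx_def)
  have D [simp]: "fob ?d (i x) = x" if "x \<in> ob P" for x
    using that assms(3) by (simp add: decode_def)
  have D' [simp]: "far ?d (j f) = f" if "f \<in> ar P" for f
    using that assms(4) by (simp add: decode_def)
  have dinj: "x = y" if "x \<in> ob ?T" "y \<in> ob ?T" "fob ?d x = fob ?d y" for x y
    using that by (auto simp: T)
  have dinj': "f = g" if "f \<in> ar ?T" "g \<in> ar ?T" "far ?d f = far ?d g" for f g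
    using that by (auto simp: T)
  have dsurj: "\<exists>x\<in>ob ?T. fob ?d x = y" if "y \<in> ob P" for y using that by (auto simp: T)
  have dsurj': "\<exists>f\<in>ar ?T. far ?d f = g" if "g \<in> ar P" for g using that by (auto simp: T)
  have pd: "strict_morphism ?T A (fcmp ?T p ?d)"
    by (rule strict_morphism_fcmp[OF d p.strict_morphism_axioms])
  have "lifting_equivalence ?T A (fcmp ?T p ?d)"
    unfolding lifting_equivalence_def lifting_equivalence_axioms_def
  proof (intro conjI allI impI)
    show "strict_morphism ?T A (fcmp ?T p ?d)" by fact
    fix x y g assume x: "x \<in> ob ?T" and y: "y \<in> ob ?T"
      and g: "g \<in> hom A (fob (fcmp ?T p ?d) x) (fob (fcmp ?T p ?d) y)"
    then obtain f where f: "f \<in> hom P (fob ?d x) (fob ?d y)" "far p f = g"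
      using p.full[of "fob ?d x" "fob ?d y" g] d.fob_ob by auto
    then obtain h where h: "h \<in> ar ?T" "far ?d h = f" using dsurj' by (auto simp: hom_def)
    then have "fob ?d (src ?T h) = fob ?d x" "fob ?d (tgt ?T h) = fob ?d y"
      using f d.far_closed[of h] by (simp_all add: hom_def)
    then have "src ?T h = x" "tgt ?T h = y" using dinj h x y by simp_all
    then show "\<exists>f\<in>hom ?T x y. far (fcmp ?T p ?d) f = g"
      using h f by (intro bexI[of _ h]) (simp_all add: hom_def)
  next
    fix f g assume "f \<in> ar ?T" "g \<in> ar ?T" "src ?T f = src ?T g" "tgt ?T f = tgt ?T g"
      "far (fcmp ?T p ?d) f = far (fcmp ?T p ?d) g"
    then show "f = g" by - (rule dinj', simp_all, rule p.faithful, simp_all)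
  next
    fix x a assume x: "x \<in> ob ?T" and a: "a \<in> ob A" "1 \<le> len A a" "\<partial>\<^bsub>A\<^esub> a = fob (fcmp ?T p ?d) x"
    then obtain y where y: "y \<in> ob P" "\<partial>\<^bsub>P\<^esub> y = fob ?d x" "fob p y = a"
      using p.extend[of "fob ?d x" a] d.fob_ob by auto
    then obtain z where z: "z \<in> ob ?T" "fob ?d z = y" using dsurj by blast
    then have "\<partial>\<^bsub>?T\<^esub> z = x" using x y by - (rule dinj, simp_all add: d.A.par_ob d.fob_par)
    then show "\<exists>z\<in>ob ?T. \<partial>\<^bsub>?T\<^esub> z = x \<and> fob (fcmp ?T p ?d) z = a"
      using z y by (intro bexI[of _ z]) simp_all
  qed
  then have "acyclic_fibration ?T A (fcmp ?T p ?d)" by (rule acyclic_fibration_lifting_equivalence)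
  then obtain s where s: "strict_morphism A ?T s" "fcmp A (fcmp ?T p ?d) s = idf A"
    using cofibrant_section[OF assms(1)] by blast
  then have "fcmp A p (fcmp A ?d s) = idf A" using fcmp_assoc[of A ?T s p ?d] strict_morphismD(1)
    by metis
  then show thesis using that strict_morphism_fcmp[OF s(1) d] by blast
qed

section \<open>Naming the displays of a weak functor\<close>

text \<open>What strictification uses of a morphism of the associated display map categories. The set \<open>D\<close>
  consists of the objects of \<open>B\<close> whose strict display maps may be referred to by names; keeping it as a
  parameter keeps the set of names small when \<open>B\<close> is large.\<close>

locale weak_functor = A: contextual A + B: contextual B + cat_functor A B F
  for A :: "('o, 'a, 'x) ctx_scheme" and B :: "('p, 'b, 'y) ctx_scheme"
    and F :: "('o, 'a, 'p, 'b) fctr" +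
  fixes D :: "'p set"
  assumes D_len: "d \<in> D \<Longrightarrow> d \<in> ob B \<and> len B d \<ge> 1"
    and far_dsq_pullback: "(f', f) \<in> dsq A \<Longrightarrow>
      pullback B (far F f') (far F (\<p>\<^bsub>A\<^esub> (src A f'))) (far F (\<p>\<^bsub>A\<^esub> (tgt A f'))) (far F f)"
    and fob_root: "a \<in> ob A \<Longrightarrow> len A a = 0 \<Longrightarrow> terminal B (fob F a)"
    and D_covers: "a \<in> ob A \<Longrightarrow> len A a \<ge> 1 \<Longrightarrow>
      \<exists>w v. tgt B w \<in> D \<and> pullback B w (far F (\<p>\<^bsub>A\<^esub> a)) (\<p>\<^bsub>B\<^esub> (tgt B w)) v"
begin

text \<open>The list holds the names of \<open>F (\<p> a)\<close>, \<open>F (\<p> (\<partial> a))\<close>, and so on down to length 0. A name \<open>(w, v)\<close>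
  determines the display map it refers to, as that of the target of \<open>w\<close>. Recording arrows out of the
  objects \<open>F a\<close>, instead of pulled back objects of \<open>B\<close> with isomorphisms, has two advantages: names can
  be pulled back strictly functorially by composition, and there are few of them if \<open>B\<close> is locally
  small.\<close>

fun naming :: "'o \<Rightarrow> ('b \<times> 'b) list \<Rightarrow> bool" where
  "naming a [] \<longleftrightarrow> a \<in> ob A \<and> len A a = 0"
| "naming a ((w, v) # xs) \<longleftrightarrow> a \<in> ob A \<and> len A a \<ge> 1 \<and> naming (\<partial>\<^bsub>A\<^esub> a) xs \<and>
    tgt B w \<in> D \<and> pullback B w (far F (\<p>\<^bsub>A\<^esub> a)) (\<p>\<^bsub>B\<^esub> (tgt B w)) v"

lemma naming_ob: "naming a xs \<Longrightarrow> a \<in> ob A"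
  by (cases "(a, xs)" rule: naming.cases) simp_all

lemma naming_par: "naming a xs \<Longrightarrow> naming (\<partial>\<^bsub>A\<^esub> a) (tl xs)"
  by (cases "(a, xs)" rule: naming.cases) (simp_all add: A.par_ob A.len_par)

lemma naming_Cons:
  assumes "naming a xs" "len A a \<ge> 1"
  obtains w v ys where "xs = (w, v) # ys" "naming (\<partial>\<^bsub>A\<^esub> a) ys" "tgt B w \<in> D"
    "pullback B w (far F (\<p>\<^bsub>A\<^esub> a)) (\<p>\<^bsub>B\<^esub> (tgt B w)) v"
  using assms by (cases "(a, xs)" rule: naming.cases) auto

text \<open>Arrows ignore the names, so that different namings of the same object are isomorphic, through its
  identity. Names do matter for distinguished squares: the name of the top display
  in the source is the one pulled back from the target, while the other names of the source come with
  the source of the bottom arrow.\<close>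

definition named_ctx :: "('o \<times> ('b \<times> 'b) list,
    ('o \<times> ('b \<times> 'b) list) \<times> 'a \<times> ('o \<times> ('b \<times> 'b) list)) ctx" where
  "named_ctx =
    \<lparr>ob = {(a, xs). naming a xs},
     ar = {((a, xs), f, (b, ys)). naming a xs \<and> naming b ys \<and> f \<in> hom A a b},
     src = fst, tgt = (\<lambda>(x, f, y). y),
     ide = (\<lambda>x. (x, ide A (fst x), x)),
     cmp = (\<lambda>(_, g, z) (x, f, _). (x, g \<cdot>\<^bsub>A\<^esub> f, z)),
     len = (\<lambda>(a, xs). len A a),
     par = (\<lambda>(a, xs). (\<partial>\<^bsub>A\<^esub> a, tl xs)),
     dsp = (\<lambda>(a, xs). ((a, xs), \<p>\<^bsub>A\<^esub> a, (\<partial>\<^bsub>A\<^esub> a, tl xs))),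
     dsq = {(((a, (w', v') # xs), f', (b, (w, v) # ys)), ((\<partial>\<^bsub>A\<^esub> a, xs), f, (\<partial>\<^bsub>A\<^esub> b, ys))) |
       a b f' f w' v' w v xs ys. (f', f) \<in> dsq A \<and> src A f' = a \<and> tgt A f' = b \<and>
       naming a ((w', v') # xs) \<and> naming b ((w, v) # ys) \<and>
       w' = w \<cdot>\<^bsub>B\<^esub> far F f' \<and> v' = v \<cdot>\<^bsub>B\<^esub> far F f}\<rparr>"

lemma named_ctx_ob: "ob named_ctx = {(a, xs). naming a xs}"
  and named_ctx_ar: "ar named_ctx =
    {((a, xs), f, (b, ys)). naming a xs \<and> naming b ys \<and> f \<in> hom A a b}"
  by (simp_all add: named_ctx_def)

lemma named_ctx_simps [simp]:
  "(a, xs) \<in> ob named_ctx \<longleftrightarrow> naming a xs"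
  "((a, xs), f, (b, ys)) \<in> ar named_ctx \<longleftrightarrow>
    naming a xs \<and> naming b ys \<and> f \<in> ar A \<and> src A f = a \<and> tgt A f = b"
  "src named_ctx (x, f, y) = x" "tgt named_ctx (x, f, y) = y"
  "ide named_ctx (a, xs) = ((a, xs), ide A a, (a, xs))"
  "(y', g, z) \<cdot>\<^bsub>named_ctx\<^esub> (x, f, y) = (x, g \<cdot>\<^bsub>A\<^esub> f, z)"
  "len named_ctx (a, xs) = len A a"
  "\<partial>\<^bsub>named_ctx\<^esub> (a, xs) = (\<partial>\<^bsub>A\<^esub> a, tl xs)"
  "\<p>\<^bsub>named_ctx\<^esub> (a, xs) = ((a, xs), \<p>\<^bsub>A\<^esub> a, (\<partial>\<^bsub>A\<^esub> a, tl xs))"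
  by (simp_all add: named_ctx_def hom_def)

lemma named_ctx_dsq:
  "((x, f', y), (x', f, y')) \<in> dsq named_ctx \<longleftrightarrow> (\<exists>w v xs ys.
    (f', f) \<in> dsq A \<and> x = (src A f', (w \<cdot>\<^bsub>B\<^esub> far F f', v \<cdot>\<^bsub>B\<^esub> far F f) # xs) \<and> y = (tgt A f', (w, v) # ys) \<and>
    naming (fst x) (snd x) \<and> naming (fst y) (snd y) \<and>
    x' = (\<partial>\<^bsub>A\<^esub> (fst x), xs) \<and> y' = (\<partial>\<^bsub>A\<^esub> (fst y), ys))"
  unfolding named_ctx_def by (auto simp del: naming.simps)

lemma named_arE:
  assumes "g \<in> ar named_ctx"
  obtains a xs f b ys where "g = ((a, xs), f, (b, ys))" "naming a xs" "naming b ys"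
    "f \<in> ar A" "src A f = a" "tgt A f = b"
  using assms by (auto simp: named_ctx_ar hom_def)

lemma named_obE:
  assumes "x \<in> ob named_ctx"
  obtains a xs where "x = (a, xs)" "naming a xs" "a \<in> ob A"
  using assms by (auto simp: named_ctx_ob naming_ob)

lemma category_named_ctx: "category named_ctx"
proof
  fix f assume "f \<in> ar named_ctx"
  then show "src named_ctx f \<in> ob named_ctx" "tgt named_ctx f \<in> ob named_ctx"
    by (auto elim!: named_arE)
next
  fix x assume "x \<in> ob named_ctx"
  then show "ide named_ctx x \<in> hom named_ctx x x" by (auto simp: hom_def elim!: named_obE)
next
  fix f g x y z assume "f \<in> hom named_ctx x y" "g \<in> hom named_ctx y z"
  then show "g \<cdot>\<^bsub>named_ctx\<^esub> f \<in> hom named_ctx x z" by (auto simp: hom_def elim!: named_arE)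
next
  fix f x y assume "f \<in> hom named_ctx x y"
  then show "ide named_ctx y \<cdot>\<^bsub>named_ctx\<^esub> f = f" "f \<cdot>\<^bsub>named_ctx\<^esub> ide named_ctx x = f"
    by (auto simp: hom_def elim!: named_arE)
next
  fix f g h w x y z
  assume "f \<in> hom named_ctx w x" "g \<in> hom named_ctx x y" "h \<in> hom named_ctx y z"
  then show "h \<cdot>\<^bsub>named_ctx\<^esub> (g \<cdot>\<^bsub>named_ctx\<^esub> f) = (h \<cdot>\<^bsub>named_ctx\<^esub> g) \<cdot>\<^bsub>named_ctx\<^esub> f"
    by (auto simp: hom_def A.assoc elim!: named_arE)
qed

interpretation P: category named_ctx by (rule category_named_ctx)

text \<open>Pullbacks are reflected because the arrows are those of \<open>A\<close>.\<close>

lemma named_pullback: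
  assumes pb: "pullback A t l r b"
    and "naming (src A t) x" "naming (src A r) y" "naming (src A b) z" "naming (tgt A b) w"
  shows "pullback named_ctx ((src A t, x), t, (src A r, y)) ((src A t, x), l, (src A b, z))
    ((src A r, y), r, (tgt A b, w)) ((src A b, z), b, (tgt A b, w))"
    (is "pullback _ ?t ?l ?r ?b")
proof (rule P.pullbackI)
  note pbD = A.pullbackD[OF pb]
  { fix u v assume "u \<in> ar named_ctx" "v \<in> ar named_ctx" "src named_ctx u = src named_ctx v"
      "tgt named_ctx u = src named_ctx ?r" "tgt named_ctx v = src named_ctx ?b"
      "?r \<cdot>\<^bsub>named_ctx\<^esub> u = ?b \<cdot>\<^bsub>named_ctx\<^esub> v"
    then obtain c xs u' v' where uv: "u = ((c, xs), u', (src A r, y))" "v = ((c, xs), v', (src A b, z))"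
      "naming c xs" "src A u' = c" "u' \<in> ar A" "v' \<in> ar A" "src A u' = src A v'"
      "tgt A u' = src A r" "tgt A v' = src A b" "r \<cdot>\<^bsub>A\<^esub> u' = b \<cdot>\<^bsub>A\<^esub> v'"
      by (auto elim!: named_arE)
    then obtain h where "h \<in> ar A" "src A h = src A v'" "tgt A h = src A l" "t \<cdot>\<^bsub>A\<^esub> h = u'"
      "l \<cdot>\<^bsub>A\<^esub> h = v'" using A.pullback_ex[OF pb uv(5-)] by blast
    then show "\<exists>h. h \<in> ar named_ctx \<and> src named_ctx h = src named_ctx v \<and>
        tgt named_ctx h = src named_ctx ?l \<and> ?t \<cdot>\<^bsub>named_ctx\<^esub> h = u \<and> ?l \<cdot>\<^bsub>named_ctx\<^esub> h = v"
      using uv pbD assms by (intro exI[of _ "((c, xs), h, (src A t, x))"]) simp }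
  { fix h k assume "h \<in> ar named_ctx" "k \<in> ar named_ctx" "src named_ctx h = src named_ctx k"
      "tgt named_ctx h = src named_ctx ?l" "tgt named_ctx k = src named_ctx ?l"
      "?t \<cdot>\<^bsub>named_ctx\<^esub> h = ?t \<cdot>\<^bsub>named_ctx\<^esub> k" "?l \<cdot>\<^bsub>named_ctx\<^esub> h = ?l \<cdot>\<^bsub>named_ctx\<^esub> k"
    then obtain c h' k' where hk: "h = (c, h', (src A t, x))" "k = (c, k', (src A t, x))"
      "h' \<in> ar A" "k' \<in> ar A" "src A h' = src A k'" "tgt A h' = src A l" "tgt A k' = src A l"
      "t \<cdot>\<^bsub>A\<^esub> h' = t \<cdot>\<^bsub>A\<^esub> k'" "l \<cdot>\<^bsub>A\<^esub> h' = l \<cdot>\<^bsub>A\<^esub> k'"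
      using pbD by (auto elim!: named_arE)
    then show "h = k" using A.pullback_unique[OF pb hk(3-)] by simp }
qed (use A.pullbackD[OF pb] assms in simp_all)

text \<open>Pasting a name with the image of a distinguished square gives a name: this is where preservation of
  pullbacks by \<open>F\<close> enters.\<close>

lemma naming_pullback:
  assumes f: "(f', f) \<in> dsq A" and b: "naming (tgt A f') ((w, v) # ys)" and xs: "naming (src A f) xs"
  shows "naming (src A f') ((w \<cdot>\<^bsub>B\<^esub> far F f', v \<cdot>\<^bsub>B\<^esub> far F f) # xs)"
proof -
  note fD = A.dsqD[OF f]
  have pb: "pullback B w (far F (\<p>\<^bsub>A\<^esub> (tgt A f'))) (\<p>\<^bsub>B\<^esub> (tgt B w)) v" and w: "tgt B w \<in> D"
    using b by simp_all
  have "pullback B (w \<cdot>\<^bsub>B\<^esub> far F f') (far F (\<p>\<^bsub>A\<^esub> (src A f'))) (\<p>\<^bsub>B\<^esub> (tgt B w)) (v \<cdot>\<^bsub>B\<^esub> far F f)"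
    by (rule B.pullback_paste[OF far_dsq_pullback[OF f] pb])
  moreover have "tgt B (w \<cdot>\<^bsub>B\<^esub> far F f') = tgt B w"
    using B.pullbackD[OF pb] fD by simp
  ultimately show ?thesis using fD xs w by simp
qed

lemma contextual_named_ctx: "contextual named_ctx"
proof
  fix x assume "x \<in> ob named_ctx"
  then obtain a xs where x: "x = (a, xs)" "naming a xs" "a \<in> ob A" by (rule named_obE)
  then show "\<partial>\<^bsub>named_ctx\<^esub> x \<in> ob named_ctx" "len named_ctx (\<partial>\<^bsub>named_ctx\<^esub> x) = len named_ctx x - 1"
    by (simp_all add: naming_par A.len_par)
  { assume l: "1 \<le> len named_ctx x"
    then show "\<p>\<^bsub>named_ctx\<^esub> x \<in> hom named_ctx x (\<partial>\<^bsub>named_ctx\<^esub> x)"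
      using x by (simp add: hom_def naming_par)
    obtain w v ys where xs: "xs = (w, v) # ys" "pullback B w (far F (\<p>\<^bsub>A\<^esub> a)) (\<p>\<^bsub>B\<^esub> (tgt B w)) v"
      using naming_Cons[OF x(2)] x(1) l named_ctx_simps(7) by metis
    note pb = B.pullbackD[OF xs(2)]
    have "w \<cdot>\<^bsub>B\<^esub> far F (ide A a) = w" "v \<cdot>\<^bsub>B\<^esub> far F (ide A (\<partial>\<^bsub>A\<^esub> a)) = v"
      using pb x l by (simp_all add: far_ide A.par_ob)
    then show "(ide named_ctx x, ide named_ctx (\<partial>\<^bsub>named_ctx\<^esub> x)) \<in> dsq named_ctx"
      using x xs(1) l A.dsq_ide[of a] by (simp add: named_ctx_dsq del: naming.simps) }
  { assume "len named_ctx x = 0"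
    then have t: "terminal A a" using x A.len_0_terminal by simp
    show "terminal named_ctx x" unfolding terminal_def
    proof (intro conjI ballI)
      show "x \<in> ob named_ctx" using x by simp
      fix z assume "z \<in> ob named_ctx"
      then obtain c ys where z: "z = (c, ys)" "naming c ys" "c \<in> ob A" by (rule named_obE)
      obtain f where f: "f \<in> hom A c a" "\<And>g. g \<in> hom A c a \<Longrightarrow> g = f"
        using t z(3) unfolding terminal_def by blast
      show "\<exists>!f. f \<in> hom named_ctx z x"
      proof (rule ex1I[of _ "(z, f, x)"])
        show "(z, f, x) \<in> hom named_ctx z x" using f(1) x z by (simp add: hom_def)
        fix g assume "g \<in> hom named_ctx z x"
        then obtain h where h: "g = (z, h, x)" "h \<in> hom A c a"
          using x(1) z(1) by (auto simp: hom_def elim!: named_arE)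
        then show "g = (z, f, x)" using f(2)[OF h(2)] by simp
      qed
    qed }
next
  fix g' g assume "(g', g) \<in> dsq named_ctx"
  then obtain f' f w v xs ys where g: 
      "g' = ((src A f', (w \<cdot>\<^bsub>B\<^esub> far F f', v \<cdot>\<^bsub>B\<^esub> far F f) # xs), f', (tgt A f', (w, v) # ys))"
    "g = ((\<partial>\<^bsub>A\<^esub> (src A f'), xs), f, (\<partial>\<^bsub>A\<^esub> (tgt A f'), ys))"
    and f: "(f', f) \<in> dsq A" "naming (src A f') ((w \<cdot>\<^bsub>B\<^esub> far F f', v \<cdot>\<^bsub>B\<^esub> far F f) # xs)"
    "naming (tgt A f') ((w, v) # ys)"
    by (cases g; cases g') (auto simp: named_ctx_dsq simp del: naming.simps)
  note fD = A.dsqD[OF f(1)]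
  have n: "naming (\<partial>\<^bsub>A\<^esub> (src A f')) xs" "naming (\<partial>\<^bsub>A\<^esub> (tgt A f')) ys"
    using naming_par[OF f(2)] naming_par[OF f(3)] by simp_all
  show "g' \<in> ar named_ctx \<and> 1 \<le> len named_ctx (src named_ctx g') \<and> 1 \<le> len named_ctx (tgt named_ctx g') \<and>
      g \<in> hom named_ctx (\<partial>\<^bsub>named_ctx\<^esub> (src named_ctx g')) (\<partial>\<^bsub>named_ctx\<^esub> (tgt named_ctx g'))"
    using g f n fD by (simp add: hom_def del: naming.simps)
  show "pullback named_ctx g' (\<p>\<^bsub>named_ctx\<^esub> (src named_ctx g')) (\<p>\<^bsub>named_ctx\<^esub> (tgt named_ctx g')) g"
    using named_pullback[OF A.dsq_pullback[OF f(1)], of "snd (src named_ctx g')" "snd (tgt named_ctx g')" xs ys]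
      g f(2,3) n fD by (simp del: naming.simps)
next
  obtain a where a: "a \<in> ob A" "len A a = 0" "\<And>b. b \<in> ob A \<Longrightarrow> len A b = 0 \<Longrightarrow> b = a"
    using A.len_0_ex1 by blast
  show "\<exists>!x. x \<in> ob named_ctx \<and> len named_ctx x = 0"
  proof (rule ex1I[of _ "(a, [])"])
    show "(a, []) \<in> ob named_ctx \<and> len named_ctx (a, []) = 0" using a(1,2) by simp
    fix x assume "x \<in> ob named_ctx \<and> len named_ctx x = 0"
    then obtain b xs where "x = (b, xs)" "naming b xs" "b \<in> ob A" "len A b = 0"
      by (auto elim: named_obE)
    then show "x = (a, [])" using a(3) by (cases "(b, xs)" rule: naming.cases) auto
  qed
next
  fix y g assume "y \<in> ob named_ctx" "1 \<le> len named_ctx y" "g \<in> ar named_ctx"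
    "tgt named_ctx g = \<partial>\<^bsub>named_ctx\<^esub> y"
  then obtain b zs c xs f where y: "y = (b, zs)" "naming b zs" "b \<in> ob A" "1 \<le> len A b"
    and g: "g = ((c, xs), f, (\<partial>\<^bsub>A\<^esub> b, tl zs))" "naming c xs" "f \<in> ar A" "src A f = c" "tgt A f = \<partial>\<^bsub>A\<^esub> b"
    by (auto elim!: named_arE named_obE)
  then obtain w v ys where zs: "zs = (w, v) # ys" using naming_Cons by metis
  obtain f' where f': "(f', f) \<in> dsq A" "tgt A f' = b" using A.dsq_ex1[OF y(3,4) g(3,5)] by blast
  note fD = A.dsqD[OF f'(1)]
  let ?x = "(src A f', (w \<cdot>\<^bsub>B\<^esub> far F f', v \<cdot>\<^bsub>B\<^esub> far F f) # xs)"
  have n: "naming (fst ?x) (snd ?x)"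
    using naming_pullback[OF f'(1), of w v ys xs] y g zs f' by simp
  show "\<exists>!g'. (g', g) \<in> dsq named_ctx \<and> tgt named_ctx g' = y"
  proof (rule ex1I[of _ "(?x, f', y)"])
    show "((?x, f', y), g) \<in> dsq named_ctx \<and> tgt named_ctx (?x, f', y) = y"
      using n f' fD y g zs by (simp add: named_ctx_dsq del: naming.simps)
    fix g' assume g': "(g', g) \<in> dsq named_ctx \<and> tgt named_ctx g' = y"
    obtain x h' z where t: "g' = (x, h', z)" by (cases g')
    have "((x, h', (b, (w, v) # ys)), ((c, xs), f, (\<partial>\<^bsub>A\<^esub> b, ys))) \<in> dsq named_ctx" "z = y"
      using g' t g(1) y(1) zs by auto
    then have h': "g' = ((src A h', (w \<cdot>\<^bsub>B\<^esub> far F h', v \<cdot>\<^bsub>B\<^esub> far F f) # xs), h', y)"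
      "(h', f) \<in> dsq A" "tgt A h' = b"
      unfolding named_ctx_dsq t by auto
    then have "h' = f'" using A.dsq_unique f' by blast
    then show "g' = (?x, f', y)" using h' by simp
  qed
next
  fix f' f g' g assume dsq: "(f', f) \<in> dsq named_ctx" "(g', g) \<in> dsq named_ctx"
    and st: "tgt named_ctx f' = src named_ctx g'"
  obtain h' h w v xs ys where f: 
      "f' = ((src A h', (w \<cdot>\<^bsub>B\<^esub> far F h', v \<cdot>\<^bsub>B\<^esub> far F h) # xs), h', (tgt A h', (w, v) # ys))"
    "f = ((\<partial>\<^bsub>A\<^esub> (src A h'), xs), h, (\<partial>\<^bsub>A\<^esub> (tgt A h'), ys))"
    "(h', h) \<in> dsq A" "naming (src A h') ((w \<cdot>\<^bsub>B\<^esub> far F h', v \<cdot>\<^bsub>B\<^esub> far F h) # xs)"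
    "naming (tgt A h') ((w, v) # ys)"
    using dsq(1) by (cases f'; cases f) (auto simp: named_ctx_dsq simp del: naming.simps)
  obtain k' k w' v' ys' zs where g: 
      "g' = ((src A k', (w' \<cdot>\<^bsub>B\<^esub> far F k', v' \<cdot>\<^bsub>B\<^esub> far F k) # ys'), k', (tgt A k', (w', v') # zs))"
    "g = ((\<partial>\<^bsub>A\<^esub> (src A k'), ys'), k, (\<partial>\<^bsub>A\<^esub> (tgt A k'), zs))"
    "(k', k) \<in> dsq A" "naming (tgt A k') ((w', v') # zs)"
    using dsq(2) by (cases g'; cases g) (auto simp: named_ctx_dsq simp del: naming.simps)
  note hD = A.dsqD[OF f(3)] and kD = A.dsqD[OF g(3)]
  have eq: "tgt A h' = src A k'" "w = w' \<cdot>\<^bsub>B\<^esub> far F k'" "v = v' \<cdot>\<^bsub>B\<^esub> far F k" "ys = ys'"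
    using st f(1) g(1) by simp_all
  have "pullback B w' (far F (\<p>\<^bsub>A\<^esub> (tgt A k'))) (\<p>\<^bsub>B\<^esub> (tgt B w')) v'" using g(4) by simp
  note pb = B.pullbackD[OF this]
  have "w \<cdot>\<^bsub>B\<^esub> far F h' = w' \<cdot>\<^bsub>B\<^esub> far F (k' \<cdot>\<^bsub>A\<^esub> h')" "v \<cdot>\<^bsub>B\<^esub> far F h = v' \<cdot>\<^bsub>B\<^esub> far F (k \<cdot>\<^bsub>A\<^esub> h)"
    using eq hD kD pb by (simp_all add: B.assoc)
  moreover have "(k' \<cdot>\<^bsub>A\<^esub> h', k \<cdot>\<^bsub>A\<^esub> h) \<in> dsq A" using A.dsq_cmp f(3) g(3) eq by simp
  ultimately show "(g' \<cdot>\<^bsub>named_ctx\<^esub> f', g \<cdot>\<^bsub>named_ctx\<^esub> f) \<in> dsq named_ctx"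
    using f g(4) eq hD kD unfolding f(1,2) g(1,2) by (simp add: named_ctx_dsq del: naming.simps)
qed

definition forget_names :: "('o \<times> ('b \<times> 'b) list, ('o \<times> ('b \<times> 'b) list) \<times> 'a \<times> ('o \<times> ('b \<times> 'b) list),
    'o, 'a) fctr" where
  "forget_names = \<lparr>fob = (\<lambda>x \<in> ob named_ctx. fst x), far = (\<lambda>(x, f, y) \<in> ar named_ctx. f)\<rparr>"

lemma forget_names_simps [simp]:
  "naming a xs \<Longrightarrow> fob forget_names (a, xs) = a"
  "g \<in> ar named_ctx \<Longrightarrow> far forget_names g = fst (snd g)"
  by (auto simp: forget_names_def split: prod.split)

lemma lifting_equivalence_forget_names: "lifting_equivalence named_ctx A forget_names"
proof -
  interpret P: contextual named_ctx by (rule contextual_named_ctx)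
  interpret cat_functor named_ctx A forget_names
  proof (rule cat_functorI)
    show "fob forget_names \<in> extensional (ob named_ctx)" "far forget_names \<in> extensional (ar named_ctx)"
      by (simp_all add: forget_names_def)
  next
    fix f assume "f \<in> ar named_ctx"
    then show "far forget_names f \<in> ar A \<and> src A (far forget_names f) = fob forget_names (src named_ctx f) \<and>
        tgt A (far forget_names f) = fob forget_names (tgt named_ctx f)"
      by (auto elim!: named_arE)
  next
    fix f g assume "f \<in> ar named_ctx" "g \<in> ar named_ctx" "tgt named_ctx f = src named_ctx g"
    then show "far forget_names (g \<cdot>\<^bsub>named_ctx\<^esub> f) = far forget_names g \<cdot>\<^bsub>A\<^esub> far forget_names f"
      by (auto elim!: named_arE)
  qed (auto simp: A.category_axioms P.category_axioms elim!: named_obE)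
  show ?thesis
  proof
    fix x assume "x \<in> ob named_ctx"
    then obtain a xs where x: "x = (a, xs)" "naming a xs" "a \<in> ob A" by (rule named_obE)
    then show "len A (fob forget_names x) = len named_ctx x"
      "fob forget_names (\<partial>\<^bsub>named_ctx\<^esub> x) = \<partial>\<^bsub>A\<^esub> (fob forget_names x)" by (simp_all add: naming_par)
    assume "1 \<le> len named_ctx x"
    then show "far forget_names (\<p>\<^bsub>named_ctx\<^esub> x) = \<p>\<^bsub>A\<^esub> (fob forget_names x)"
      using x by (simp add: naming_par)
  next
    fix g' g assume g: "(g', g) \<in> dsq named_ctx"
    note D = P.dsqD[OF g]
    have "(fst (snd g'), fst (snd g)) \<in> dsq A"
      using g by (cases g'; cases g) (auto simp: named_ctx_dsq simp del: naming.simps)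
    then show "(far forget_names g', far forget_names g) \<in> dsq A" using D by simp
  next
    fix x y k assume "x \<in> ob named_ctx" "y \<in> ob named_ctx" "k \<in> hom A (fob forget_names x) (fob forget_names y)"
    then have "(x, k, y) \<in> hom named_ctx x y" "far forget_names (x, k, y) = k"
      by (auto simp: hom_def elim!: named_obE)
    then show "\<exists>f\<in>hom named_ctx x y. far forget_names f = k" by blast
  next
    fix f g assume "f \<in> ar named_ctx" "g \<in> ar named_ctx" "src named_ctx f = src named_ctx g"
      "tgt named_ctx f = tgt named_ctx g" "far forget_names f = far forget_names g"
    then show "f = g" by (auto elim!: named_arE)
  next
    fix x a assume "x \<in> ob named_ctx" and a: "a \<in> ob A" "1 \<le> len A a" "\<partial>\<^bsub>A\<^esub> a = fob forget_names x"
    then obtain xs where x: "x = (\<partial>\<^bsub>A\<^esub> a, xs)" "naming (\<partial>\<^bsub>A\<^esub> a) xs" by (auto elim!: named_obE)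
    obtain w v where "tgt B w \<in> D" "pullback B w (far F (\<p>\<^bsub>A\<^esub> a)) (\<p>\<^bsub>B\<^esub> (tgt B w)) v"
      using D_covers[OF a(1,2)] by blast
    then have n: "naming a ((w, v) # xs)" using a x by simp
    show "\<exists>y\<in>ob named_ctx. \<partial>\<^bsub>named_ctx\<^esub> y = x \<and> fob forget_names y = a"
      by (rule bexI[of _ "(a, (w, v) # xs)"]) (use n x(1) in \<open>simp_all del: naming.simps\<close>)
  qed
qed

end

section \<open>Realizing names by strict displays\<close>

text \<open>Replacing the base of the left side by an isomorphic object; it is used to compare \<open>F (\<p> a)\<close> with a
  strict display map over an isomorphic copy of \<open>F (\<partial> a)\<close>.\<close>

lemma (in category) pullback_transfer_iso:
  assumes "pullback C t l r b" "iso C m" "src C m = tgt C l"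
  shows "pullback C t (m \<cdot> l) r (b \<cdot> inverse_of C m)"
proof -
  note pb = pullbackD[OF assms(1)]
  have "pullback C (ide C (src C l)) (m \<cdot> l) l (inverse_of C m)"
    by (rule pullback_of_isos)
      (use pb assms in \<open>simp_all add: iso_ide iso_inverse_of inverse_of inverse_of_cancel iso_ar\<close>)
  from pullback_paste[OF this assms(1)] show ?thesis using pb by simp
qed

context weak_functor
begin

text \<open>The isomorphism from \<open>F a\<close> to the realization of the named object in \<open>B\<close>, which is its target. The
  realization is obtained from that of the parent by the distinguished square with top side \<open>q\<close>, over the
  base of the display map that the name refers to. The isomorphism is then induced by the universal
  property of this square; for length 0 it is the unique arrow to the terminal object. The choice
  operator only serves to extract these from their defining properties.\<close>

fun comparison :: "'o \<Rightarrow> ('b \<times> 'b) list \<Rightarrow> 'b" where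
  "comparison a [] = (SOME h. iso B h \<and> src B h = fob F a \<and> len B (tgt B h) = 0)"
| "comparison a ((w, v) # xs) = (SOME h. iso B h \<and> src B h = fob F a \<and>
    (\<exists>q. (q, v \<cdot>\<^bsub>B\<^esub> inverse_of B (comparison (\<partial>\<^bsub>A\<^esub> a) xs)) \<in> dsq B \<and> tgt B q = tgt B w \<and>
      src B q = tgt B h \<and> q \<cdot>\<^bsub>B\<^esub> h = w \<and>
      \<p>\<^bsub>B\<^esub> (tgt B h) \<cdot>\<^bsub>B\<^esub> h = comparison (\<partial>\<^bsub>A\<^esub> a) xs \<cdot>\<^bsub>B\<^esub> far F (\<p>\<^bsub>A\<^esub> a)))"

lemma comparison_Nil:
  assumes "naming a []"
  shows "iso B (comparison a []) \<and> src B (comparison a []) = fob F a \<and>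
    len B (tgt B (comparison a [])) = 0"
  unfolding comparison.simps
proof (rule someI_ex)
  have a: "a \<in> ob A" "len A a = 0" using assms by auto
  obtain r where r: "r \<in> ob B" "len B r = 0" using B.len_0_ex1 by blast
  note t = B.len_0_terminal[OF r]
  have "fob F a \<in> ob B" by (rule fob_ob[OF a(1)])
  then obtain h where h: "h \<in> hom B (fob F a) r" using t unfolding terminal_def by blast
  then have "iso B h" by (rule B.iso_between_terminal[OF fob_root[OF a] t])
  then show "\<exists>h. iso B h \<and> src B h = fob F a \<and> len B (tgt B h) = 0"
    using h r by (auto simp: hom_def)
qed

lemma comparison_Cons:
  assumes n: "naming a ((w, v) # xs)"
    and h0: "iso B (comparison (\<partial>\<^bsub>A\<^esub> a) xs)" "src B (comparison (\<partial>\<^bsub>A\<^esub> a) xs) = fob F (\<partial>\<^bsub>A\<^esub> a)"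
  shows "iso B (comparison a ((w, v) # xs)) \<and> src B (comparison a ((w, v) # xs)) = fob F a \<and>
    (\<exists>q. (q, v \<cdot>\<^bsub>B\<^esub> inverse_of B (comparison (\<partial>\<^bsub>A\<^esub> a) xs)) \<in> dsq B \<and> tgt B q = tgt B w \<and>
      src B q = tgt B (comparison a ((w, v) # xs)) \<and> q \<cdot>\<^bsub>B\<^esub> comparison a ((w, v) # xs) = w \<and>
      \<p>\<^bsub>B\<^esub> (tgt B (comparison a ((w, v) # xs))) \<cdot>\<^bsub>B\<^esub> comparison a ((w, v) # xs) =
        comparison (\<partial>\<^bsub>A\<^esub> a) xs \<cdot>\<^bsub>B\<^esub> far F (\<p>\<^bsub>A\<^esub> a))"
  unfolding comparison.simps
proof (rule someI_ex)
  let ?h0 = "comparison (\<partial>\<^bsub>A\<^esub> a) xs"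
  have a: "a \<in> ob A" "1 \<le> len A a" and w: "tgt B w \<in> D"
    and pb: "pullback B w (far F (\<p>\<^bsub>A\<^esub> a)) (\<p>\<^bsub>B\<^esub> (tgt B w)) v" using n by auto
  note pbD = B.pullbackD[OF pb] and d = D_len[OF w]
  have pb': "pullback B w (?h0 \<cdot>\<^bsub>B\<^esub> far F (\<p>\<^bsub>A\<^esub> a)) (\<p>\<^bsub>B\<^esub> (tgt B w)) (v \<cdot>\<^bsub>B\<^esub> inverse_of B ?h0)"
    by (rule B.pullback_transfer_iso[OF pb h0(1)]) (use h0 a in simp)
  have "v \<cdot>\<^bsub>B\<^esub> inverse_of B ?h0 \<in> ar B" "tgt B (v \<cdot>\<^bsub>B\<^esub> inverse_of B ?h0) = \<partial>\<^bsub>B\<^esub> (tgt B w)"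
    using B.pullbackD[OF pb'] d by simp_all
  then obtain q where q: "(q, v \<cdot>\<^bsub>B\<^esub> inverse_of B ?h0) \<in> dsq B" "tgt B q = tgt B w"
    using B.dsq_ex1 d by blast
  note qD = B.dsqD[OF q(1)]
  have "pullback B q (\<p>\<^bsub>B\<^esub> (src B q)) (\<p>\<^bsub>B\<^esub> (tgt B w)) (v \<cdot>\<^bsub>B\<^esub> inverse_of B ?h0)"
    using B.dsq_pullback[OF q(1)] q(2) by simp
  from B.pullback_comparison_iso[OF this pb']
  obtain h where "iso B h" "src B h = src B (?h0 \<cdot>\<^bsub>B\<^esub> far F (\<p>\<^bsub>A\<^esub> a))"
    "tgt B h = src B (\<p>\<^bsub>B\<^esub> (src B q))" "q \<cdot>\<^bsub>B\<^esub> h = w"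
    "\<p>\<^bsub>B\<^esub> (src B q) \<cdot>\<^bsub>B\<^esub> h = ?h0 \<cdot>\<^bsub>B\<^esub> far F (\<p>\<^bsub>A\<^esub> a)" by blast
  then show "\<exists>h. iso B h \<and> src B h = fob F a \<and>
    (\<exists>q. (q, v \<cdot>\<^bsub>B\<^esub> inverse_of B ?h0) \<in> dsq B \<and> tgt B q = tgt B w \<and>
      src B q = tgt B h \<and> q \<cdot>\<^bsub>B\<^esub> h = w \<and>
      \<p>\<^bsub>B\<^esub> (tgt B h) \<cdot>\<^bsub>B\<^esub> h = ?h0 \<cdot>\<^bsub>B\<^esub> far F (\<p>\<^bsub>A\<^esub> a))"
    using q qD h0 a by (intro exI[of _ h] conjI exI[of _ q]) (simp_all add: B.iso_ar)
qed

lemma comparison_iso: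
  "naming a xs \<Longrightarrow> iso B (comparison a xs) \<and> src B (comparison a xs) = fob F a"
proof (induction a xs rule: naming.induct)
  case (1 a)
  then show ?case using comparison_Nil by blast
next
  case (2 a w v xs)
  then have "iso B (comparison (\<partial>\<^bsub>A\<^esub> a) xs) \<and> src B (comparison (\<partial>\<^bsub>A\<^esub> a) xs) = fob F (\<partial>\<^bsub>A\<^esub> a)" by simp
  then show ?case using comparison_Cons[OF 2(2)] by blast
qed

lemma comparison_ar:
  assumes "naming a xs"
  shows "comparison a xs \<in> ar B" "src B (comparison a xs) = fob F a" "iso B (comparison a xs)"
  using comparison_iso[OF assms] by (simp_all add: B.iso_ar)

lemma comparison_dsq:
  assumes n: "naming a ((w, v) # xs)"
  obtains q where "(q, v \<cdot>\<^bsub>B\<^esub> inverse_of B (comparison (\<partial>\<^bsub>A\<^esub> a) xs)) \<in> dsq B" "tgt B q = tgt B w"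
    "src B q = tgt B (comparison a ((w, v) # xs))" "q \<cdot>\<^bsub>B\<^esub> comparison a ((w, v) # xs) = w"
    "\<p>\<^bsub>B\<^esub> (tgt B (comparison a ((w, v) # xs))) \<cdot>\<^bsub>B\<^esub> comparison a ((w, v) # xs) =
      comparison (\<partial>\<^bsub>A\<^esub> a) xs \<cdot>\<^bsub>B\<^esub> far F (\<p>\<^bsub>A\<^esub> a)"
proof -
  have "naming (\<partial>\<^bsub>A\<^esub> a) xs" using n by simp
  from comparison_Cons[OF n] comparison_iso[OF this] show thesis using that by blast
qed

lemma comparison_par:
  assumes n: "naming a ((w, v) # xs)"
  shows "len B (tgt B (comparison a ((w, v) # xs))) \<ge> 1"
    "\<partial>\<^bsub>B\<^esub> (tgt B (comparison a ((w, v) # xs))) = tgt B (comparison (\<partial>\<^bsub>A\<^esub> a) xs)"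
proof -
  obtain q where q: "(q, v \<cdot>\<^bsub>B\<^esub> inverse_of B (comparison (\<partial>\<^bsub>A\<^esub> a) xs)) \<in> dsq B"
    "src B q = tgt B (comparison a ((w, v) # xs))"
    by (rule comparison_dsq[OF n])
  note qD = B.dsqD[OF q(1)]
  have x: "naming (\<partial>\<^bsub>A\<^esub> a) xs" and pb: "pullback B w (far F (\<p>\<^bsub>A\<^esub> a)) (\<p>\<^bsub>B\<^esub> (tgt B w)) v"
    and a: "a \<in> ob A" "1 \<le> len A a"
    using n by auto
  note h0 = comparison_ar[OF x]
  have "src B (v \<cdot>\<^bsub>B\<^esub> inverse_of B (comparison (\<partial>\<^bsub>A\<^esub> a) xs)) = tgt B (comparison (\<partial>\<^bsub>A\<^esub> a) xs)"
    using B.pullbackD[OF pb] h0 a by (simp add: B.inverse_of)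
  then show "len B (tgt B (comparison a ((w, v) # xs))) \<ge> 1"
    "\<partial>\<^bsub>B\<^esub> (tgt B (comparison a ((w, v) # xs))) = tgt B (comparison (\<partial>\<^bsub>A\<^esub> a) xs)"
    using qD q by simp_all
qed

lemma comparison_len:
  "naming a xs \<Longrightarrow> len B (tgt B (comparison a xs)) = len A a"
proof (induction a xs rule: naming.induct)
  case (1 a)
  then show ?case using comparison_Nil[OF 1] by simp
next
  case (2 a w v xs)
  note h = comparison_ar[OF 2(2)] and p = comparison_par[OF 2(2)]
  have "len B (tgt B (comparison (\<partial>\<^bsub>A\<^esub> a) xs)) = len A (\<partial>\<^bsub>A\<^esub> a)" using 2 by simp
  moreover have "a \<in> ob A" "1 \<le> len A a" using 2(2) by auto
  ultimately show ?case
    using p B.len_par[of "tgt B (comparison a ((w, v) # xs))"] h(1) A.len_par[of a] by simp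
qed

text \<open>On arrows this is \<open>F\<close> conjugated by the comparison isomorphisms. Functoriality and naturality of the
  comparison are therefore automatic, and strictness is what has to be checked.\<close>

definition realization :: "('o \<times> ('b \<times> 'b) list,
    ('o \<times> ('b \<times> 'b) list) \<times> 'a \<times> ('o \<times> ('b \<times> 'b) list), 'p, 'b) fctr" where
  "realization =
    \<lparr>fob = (\<lambda>(a, xs) \<in> ob named_ctx. tgt B (comparison a xs)),
     far = (\<lambda>((a, xs), f, (b, ys)) \<in> ar named_ctx.
       comparison b ys \<cdot>\<^bsub>B\<^esub> (far F f \<cdot>\<^bsub>B\<^esub> inverse_of B (comparison a xs)))\<rparr>"

lemma realization_simps [simp]:
  "naming a xs \<Longrightarrow> fob realization (a, xs) = tgt B (comparison a xs)"
  "((a, xs), f, (b, ys)) \<in> ar named_ctx \<Longrightarrow> far realization ((a, xs), f, (b, ys)) =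
    comparison b ys \<cdot>\<^bsub>B\<^esub> (far F f \<cdot>\<^bsub>B\<^esub> inverse_of B (comparison a xs))"
  by (simp_all add: realization_def)

text \<open>Let \<open>k\<close> be the realization of the bottom arrow and \<open>k'\<close> the top of the distinguished square over \<open>k\<close>
  with the realization of the target on the right. Because names are pulled back by composition, \<open>k'\<close>
  followed by \<open>qb\<close> lies over the same arrow as \<open>qa\<close>, so the two are equal by uniqueness of distinguished
  squares. Hence \<open>k'\<close> starts at the realization of the source. That it is the realization of the top
  arrow is checked after composition with both projections of the pullback.\<close>

lemma realization_dsq:
  assumes f: "(f', f) \<in> dsq A" and b: "naming (tgt A f') ((w, v) # ys)"
    and a: "naming (src A f') ((w \<cdot>\<^bsub>B\<^esub> far F f', v \<cdot>\<^bsub>B\<^esub> far F f) # xs)"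
  shows "(far realization ((src A f', (w \<cdot>\<^bsub>B\<^esub> far F f', v \<cdot>\<^bsub>B\<^esub> far F f) # xs), f', (tgt A f', (w, v) # ys)),
    far realization ((\<partial>\<^bsub>A\<^esub> (src A f'), xs), f, (\<partial>\<^bsub>A\<^esub> (tgt A f'), ys))) \<in> dsq B"
proof -
  let ?w = "w \<cdot>\<^bsub>B\<^esub> far F f'" and ?v = "v \<cdot>\<^bsub>B\<^esub> far F f"
  let ?a = "src A f'" and ?b = "tgt A f'"
  define ha where "ha = comparison ?a ((?w, ?v) # xs)"
  define hb where "hb = comparison ?b ((w, v) # ys)"
  define ha0 where "ha0 = comparison (\<partial>\<^bsub>A\<^esub> ?a) xs"
  define hb0 where "hb0 = comparison (\<partial>\<^bsub>A\<^esub> ?b) ys"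
  note defs = ha_def[symmetric] hb_def[symmetric] ha0_def[symmetric] hb0_def[symmetric]
  note fD = A.dsqD[OF f]
  have na: "naming (\<partial>\<^bsub>A\<^esub> ?a) xs" and nb: "naming (\<partial>\<^bsub>A\<^esub> ?b) ys"
    using naming_par[OF a] naming_par[OF b] by simp_all
  note h = comparison_ar[OF a, unfolded defs] comparison_ar[OF b, unfolded defs]
    comparison_ar[OF na, unfolded defs] comparison_ar[OF nb, unfolded defs]
  note inv = B.inverse_of[OF h(9)] B.inverse_of[OF h(3)]
  obtain qa where qa: "(qa, ?v \<cdot>\<^bsub>B\<^esub> inverse_of B ha0) \<in> dsq B" "tgt B qa = tgt B ?w"
    "src B qa = tgt B ha" "qa \<cdot>\<^bsub>B\<^esub> ha = ?w" "\<p>\<^bsub>B\<^esub> (tgt B ha) \<cdot>\<^bsub>B\<^esub> ha = ha0 \<cdot>\<^bsub>B\<^esub> far F (\<p>\<^bsub>A\<^esub> ?a)"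
    using comparison_dsq[OF a] unfolding defs by blast
  obtain qb where qb: "(qb, v \<cdot>\<^bsub>B\<^esub> inverse_of B hb0) \<in> dsq B" "tgt B qb = tgt B w"
    "src B qb = tgt B hb" "qb \<cdot>\<^bsub>B\<^esub> hb = w" "\<p>\<^bsub>B\<^esub> (tgt B hb) \<cdot>\<^bsub>B\<^esub> hb = hb0 \<cdot>\<^bsub>B\<^esub> far F (\<p>\<^bsub>A\<^esub> ?b)"
    using comparison_dsq[OF b] unfolding defs by blast
  note pa = comparison_par[OF a, unfolded defs] and pb = comparison_par[OF b, unfolded defs]
  have wv: "pullback B w (far F (\<p>\<^bsub>A\<^esub> ?b)) (\<p>\<^bsub>B\<^esub> (tgt B w)) v" using b by simp
  note wvD = B.pullbackD[OF wv]
  define k where "k = hb0 \<cdot>\<^bsub>B\<^esub> (far F f \<cdot>\<^bsub>B\<^esub> inverse_of B ha0)"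
  have k: "k \<in> ar B" "src B k = tgt B ha0" "tgt B k = tgt B hb0"
    unfolding k_def using h inv fD by simp_all
  have hbob: "tgt B hb \<in> ob B" "tgt B ha \<in> ob B" using h by simp_all
  obtain k' where k': "(k', k) \<in> dsq B" "tgt B k' = tgt B hb"
    using B.dsq_ex1[OF hbob(1) pb(1) k(1)] k(3) pb(2) by auto
  note k'D = B.dsqD[OF k'(1)] and qaD = B.dsqD[OF qa(1)] and qbD = B.dsqD[OF qb(1)]
  \<comment> \<open>Composing with the square that realizes the target gives the square of the source.\<close>
  have "(qb \<cdot>\<^bsub>B\<^esub> k', (v \<cdot>\<^bsub>B\<^esub> inverse_of B hb0) \<cdot>\<^bsub>B\<^esub> k) \<in> dsq B"
    by (rule B.dsq_cmp[OF k'(1) qb(1)]) (simp add: k'(2) qb(3))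
  moreover have "(v \<cdot>\<^bsub>B\<^esub> inverse_of B hb0) \<cdot>\<^bsub>B\<^esub> k = ?v \<cdot>\<^bsub>B\<^esub> inverse_of B ha0"
    unfolding k_def using h inv fD wvD B.inverse_of[OF h(12)]
    by (simp add: B.assoc B.inverse_of_cancel)
  ultimately have "(qb \<cdot>\<^bsub>B\<^esub> k', ?v \<cdot>\<^bsub>B\<^esub> inverse_of B ha0) \<in> dsq B" by simp
  moreover have "tgt B (qb \<cdot>\<^bsub>B\<^esub> k') = tgt B qa"
    using k'D qbD k'(2) qb(2,3) qa(2) wvD fD by simp
  ultimately have qk: "qb \<cdot>\<^bsub>B\<^esub> k' = qa" using B.dsq_unique qa(1) by blast
  then have sk: "src B k' = tgt B ha" using k'D qbD k'(2) qb(3) qa(3) B.cmp_closed(2)[of k' qb]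
    by simp
  have pbk: "pullback B qb (\<p>\<^bsub>B\<^esub> (tgt B hb)) (\<p>\<^bsub>B\<^esub> (tgt B w)) (v \<cdot>\<^bsub>B\<^esub> inverse_of B hb0)"
    using B.dsq_pullback[OF qb(1)] qb(2,3) by simp
  have pk: "\<p>\<^bsub>B\<^esub> (tgt B hb) \<cdot>\<^bsub>B\<^esub> k' = k \<cdot>\<^bsub>B\<^esub> \<p>\<^bsub>B\<^esub> (tgt B ha)"
    using B.pullbackD(9)[OF B.dsq_pullback[OF k'(1)]] k'(2) sk by simp
  have ppa: "\<p>\<^bsub>B\<^esub> (tgt B ha) \<in> ar B" "src B (\<p>\<^bsub>B\<^esub> (tgt B ha)) = tgt B ha" "tgt B (\<p>\<^bsub>B\<^esub> (tgt B ha)) = tgt B ha0"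
    "\<p>\<^bsub>B\<^esub> (tgt B hb) \<in> ar B" "src B (\<p>\<^bsub>B\<^esub> (tgt B hb)) = tgt B hb" "tgt B (\<p>\<^bsub>B\<^esub> (tgt B hb)) = tgt B hb0"
    using hbob pa pb by simp_all
  have obs: "?a \<in> ob A" "?b \<in> ob A" using fD by simp_all
  have "k' \<cdot>\<^bsub>B\<^esub> ha = hb \<cdot>\<^bsub>B\<^esub> far F f'"
  proof (rule B.pullback_unique[OF pbk])
    have "qb \<cdot>\<^bsub>B\<^esub> (k' \<cdot>\<^bsub>B\<^esub> ha) = (qb \<cdot>\<^bsub>B\<^esub> k') \<cdot>\<^bsub>B\<^esub> ha"
      using h k'D k'(2) qb(3) sk qbD by (simp add: B.assoc)
    also have "\<dots> = (qb \<cdot>\<^bsub>B\<^esub> hb) \<cdot>\<^bsub>B\<^esub> far F f'" using qk qa(4) qb(4) by simp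
    also have "\<dots> = qb \<cdot>\<^bsub>B\<^esub> (hb \<cdot>\<^bsub>B\<^esub> far F f')" using h fD qb(3) qbD by (simp add: B.assoc)
    finally show "qb \<cdot>\<^bsub>B\<^esub> (k' \<cdot>\<^bsub>B\<^esub> ha) = qb \<cdot>\<^bsub>B\<^esub> (hb \<cdot>\<^bsub>B\<^esub> far F f')" .
    have "\<p>\<^bsub>B\<^esub> (tgt B hb) \<cdot>\<^bsub>B\<^esub> (k' \<cdot>\<^bsub>B\<^esub> ha) = k \<cdot>\<^bsub>B\<^esub> (\<p>\<^bsub>B\<^esub> (tgt B ha) \<cdot>\<^bsub>B\<^esub> ha)"
      by (rule B.commute_cmp[OF pk]) (use h k k'D k'(2) sk ppa in simp_all)
    also have "\<dots> = hb0 \<cdot>\<^bsub>B\<^esub> (far F f \<cdot>\<^bsub>B\<^esub> far F (\<p>\<^bsub>A\<^esub> ?a))"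
      unfolding qa(5) k_def using h inv fD obs by (simp add: B.assoc B.inverse_of_cancel)
    also have "far F f \<cdot>\<^bsub>B\<^esub> far F (\<p>\<^bsub>A\<^esub> ?a) = far F (\<p>\<^bsub>A\<^esub> ?b) \<cdot>\<^bsub>B\<^esub> far F f'"
      by (rule far_square[OF A.pullbackD(9)[OF A.dsq_pullback[OF f], symmetric]])
        (use fD obs in simp_all)
    also have "hb0 \<cdot>\<^bsub>B\<^esub> (far F (\<p>\<^bsub>A\<^esub> ?b) \<cdot>\<^bsub>B\<^esub> far F f') = \<p>\<^bsub>B\<^esub> (tgt B hb) \<cdot>\<^bsub>B\<^esub> (hb \<cdot>\<^bsub>B\<^esub> far F f')"
      by (rule B.commute_cmp[OF qb(5), symmetric]) (use h fD obs ppa in simp_all)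
    finally show "\<p>\<^bsub>B\<^esub> (tgt B hb) \<cdot>\<^bsub>B\<^esub> (k' \<cdot>\<^bsub>B\<^esub> ha) = \<p>\<^bsub>B\<^esub> (tgt B hb) \<cdot>\<^bsub>B\<^esub> (hb \<cdot>\<^bsub>B\<^esub> far F f')" .
  qed (use h k'D k'(2) sk ppa fD in simp_all)
  then have "(k' \<cdot>\<^bsub>B\<^esub> ha) \<cdot>\<^bsub>B\<^esub> inverse_of B ha = (hb \<cdot>\<^bsub>B\<^esub> far F f') \<cdot>\<^bsub>B\<^esub> inverse_of B ha" by simp
  then have "k' = hb \<cdot>\<^bsub>B\<^esub> (far F f' \<cdot>\<^bsub>B\<^esub> inverse_of B ha)"
    using h inv k'D sk fD by (simp add: B.assoc)
  moreover have "((?a, (?w, ?v) # xs), f', (?b, (w, v) # ys)) \<in> ar named_ctx"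
    using a b fD by (simp del: naming.simps)
  moreover have "((\<partial>\<^bsub>A\<^esub> ?a, xs), f, (\<partial>\<^bsub>A\<^esub> ?b, ys)) \<in> ar named_ctx" using na nb fD by simp
  ultimately show ?thesis using k'(1) unfolding k_def ha_def hb_def ha0_def hb0_def
    by (simp only: realization_simps)
qed

lemma strict_morphism_realization: "strict_morphism named_ctx B realization"
proof -
  interpret P: contextual named_ctx by (rule contextual_named_ctx)
  note inv = comparison_ar B.inverse_of B.inverse_of_cancel B.assoc
  interpret cat_functor named_ctx B realization
  proof (rule cat_functorI)
    show "fob realization \<in> extensional (ob named_ctx)" "far realization \<in> extensional (ar named_ctx)"
      by (simp_all add: realization_def)
  next
    fix x assume "x \<in> ob named_ctx"
    then obtain a xs where "x = (a, xs)" "naming a xs" "a \<in> ob A" by (rule named_obE)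
    then show "fob realization x \<in> ob B" "far realization (ide named_ctx x) = ide B (fob realization x)"
      by (simp_all add: inv far_ide fob_ob)
  next
    fix g assume "g \<in> ar named_ctx"
    then show "far realization g \<in> ar B \<and> src B (far realization g) = fob realization (src named_ctx g) \<and>
        tgt B (far realization g) = fob realization (tgt named_ctx g)"
      by (auto simp: inv elim!: named_arE)
  next
    fix f g assume "f \<in> ar named_ctx" "g \<in> ar named_ctx" "tgt named_ctx f = src named_ctx g"
    then show "far realization (g \<cdot>\<^bsub>named_ctx\<^esub> f) = far realization g \<cdot>\<^bsub>B\<^esub> far realization f"
      by (auto simp: inv elim!: named_arE)
  qed (rule P.category_axioms B.category_axioms)+
  show ?thesis
  proof
    fix x assume "x \<in> ob named_ctx"
    then obtain a xs where x: "x = (a, xs)" "naming a xs" "a \<in> ob A" by (rule named_obE)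
    then show "len B (fob realization x) = len named_ctx x" by (simp add: comparison_len)
    show "fob realization (\<partial>\<^bsub>named_ctx\<^esub> x) = \<partial>\<^bsub>B\<^esub> (fob realization x)"
    proof (cases xs)
      case Nil
      have n: "naming a []" "naming (\<partial>\<^bsub>A\<^esub> a) []" using x Nil A.len_par[of a] A.par_ob[of a] by auto
      \<comment> \<open>The object of length 0 is its own parent, in \<open>A\<close> as well as in \<open>B\<close>.\<close>
      have "a = \<partial>\<^bsub>A\<^esub> a" using n A.len_0_ex1 by auto
      moreover have "\<partial>\<^bsub>B\<^esub> (tgt B (comparison a [])) = tgt B (comparison a [])"
        using B.len_0_ex1 comparison_len[OF n(1)] comparison_ar[OF n(1)] n(1)
          B.len_par[of "tgt B (comparison a [])"] B.par_ob[of "tgt B (comparison a [])"]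
        by (metis B.src_tgt_ob(2) diff_0_eq_0 naming.simps(1))
      ultimately show ?thesis using x Nil n by (simp del: comparison.simps)
    next
      case (Cons e ys)
      obtain w v where e: "e = (w, v)" by (cases e)
      have n: "naming a ((w, v) # ys)" "naming (\<partial>\<^bsub>A\<^esub> a) ys" using x Cons e by auto
      then show ?thesis using x Cons e comparison_par(2)[OF n(1)]
        by (simp del: naming.simps comparison.simps)
    qed
    assume "1 \<le> len named_ctx x"
    then have l: "1 \<le> len A a" using x by simp
    obtain w v ys where xs: "xs = (w, v) # ys" "naming (\<partial>\<^bsub>A\<^esub> a) ys"
      by (rule naming_Cons[OF x(2) l])
    have n: "naming a ((w, v) # ys)" using x xs by simp
    have q: "\<p>\<^bsub>B\<^esub> (tgt B (comparison a ((w, v) # ys))) \<cdot>\<^bsub>B\<^esub> comparison a ((w, v) # ys) =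
        comparison (\<partial>\<^bsub>A\<^esub> a) ys \<cdot>\<^bsub>B\<^esub> far F (\<p>\<^bsub>A\<^esub> a)"
      using comparison_dsq[OF n] by blast
    note h = comparison_ar[OF n] comparison_ar[OF xs(2)]
    have "((a, (w, v) # ys), \<p>\<^bsub>A\<^esub> a, (\<partial>\<^bsub>A\<^esub> a, ys)) \<in> ar named_ctx" using n xs(2) x(3) l
      by (simp del: naming.simps)
    then have "far realization (\<p>\<^bsub>named_ctx\<^esub> x) = comparison (\<partial>\<^bsub>A\<^esub> a) ys \<cdot>\<^bsub>B\<^esub>
        (far F (\<p>\<^bsub>A\<^esub> a) \<cdot>\<^bsub>B\<^esub> inverse_of B (comparison a ((w, v) # ys)))"
      using x(1) xs(1) by (simp del: naming.simps comparison.simps named_ctx_simps(2))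
    also have "\<dots> = (\<p>\<^bsub>B\<^esub> (tgt B (comparison a ((w, v) # ys))) \<cdot>\<^bsub>B\<^esub> comparison a ((w, v) # ys)) \<cdot>\<^bsub>B\<^esub>
        inverse_of B (comparison a ((w, v) # ys))"
      unfolding q by (rule B.assoc[symmetric]) (use h x(3) l in \<open>simp_all add: B.inverse_of del: comparison.simps\<close>)
    also have "\<dots> = \<p>\<^bsub>B\<^esub> (tgt B (comparison a ((w, v) # ys)))"
      using h comparison_par[OF n] by (simp add: B.assoc B.inverse_of del: comparison.simps)
    finally show "far realization (\<p>\<^bsub>named_ctx\<^esub> x) = \<p>\<^bsub>B\<^esub> (fob realization x)"
      using x(1) xs(1) n by (simp del: naming.simps comparison.simps)
  next
    fix g' g assume d: "(g', g) \<in> dsq named_ctx"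
    obtain x f' y x' f y' where g: "g' = (x, f', y)" "g = (x', f, y')" by (cases g'; cases g)
    show "(far realization g', far realization g) \<in> dsq B"
      using d realization_dsq unfolding g named_ctx_dsq
      by (auto simp del: naming.simps realization_simps)
  qed
qed

text \<open>A section of the forgetful morphism equips every \<open>a\<close> with names; the comparison isomorphisms for
  these names are the components.\<close>

lemma strict_morphism_nat_isomorphic:
  assumes s: "strict_morphism A named_ctx s" "fcmp A forget_names s = idf A"
  shows "nat_isomorphic A B F (fcmp A realization s)"
proof -
  interpret s: strict_morphism A named_ctx s by fact
  have G: "strict_morphism A B (fcmp A realization s)"
    by (rule strict_morphism_fcmp[OF s(1) strict_morphism_realization])
  interpret G: strict_morphism A B "fcmp A realization s" by fact
  have ob: "\<exists>xs. fob s a = (a, xs) \<and> naming a xs" if a: "a \<in> ob A" for a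
  proof -
    obtain b xs where x: "fob s a = (b, xs)" "naming b xs" using s.fob_ob[OF a] named_obE by metis
    moreover have "fob forget_names (fob s a) = a"
      using arg_cong[OF s(2), of "\<lambda>H. fob H a"] a by simp
    ultimately show ?thesis by simp
  qed
  have ar: "far s f = (fob s (src A f), f, fob s (tgt A f))" if f: "f \<in> ar A" for f
  proof -
    have "far forget_names (far s f) = f" using arg_cong[OF s(2), of "\<lambda>H. far H f"] f by simp
    moreover have "far s f \<in> ar named_ctx" "src named_ctx (far s f) = fob s (src A f)"
      "tgt named_ctx (far s f) = fob s (tgt A f)" using f by simp_all
    ultimately show ?thesis by (cases "far s f") simp
  qed
  let ?h = "\<lambda>a. comparison a (snd (fob s a))"
  let ?t = "\<lparr>ndom = F, ncod = fcmp A realization s, ncmp = (\<lambda>a\<in>ob A. ?h a)\<rparr>"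
  have h: "?h a \<in> ar B" "src B (?h a) = fob F a" "tgt B (?h a) = fob (fcmp A realization s) a"
    "iso B (?h a)" if a: "a \<in> ob A" for a
    using ob[OF a] a comparison_ar by auto
  have "nat_trans A B ?t"
  proof (rule nat_transI)
    fix f assume f: "f \<in> ar A"
    let ?a = "src A f" and ?b = "tgt A f"
    obtain xs ys where xs: "fob s ?a = (?a, xs)" "naming ?a xs" and ys: "fob s ?b = (?b, ys)" "naming ?b ys"
      using ob[of ?a] ob[of ?b] f by auto
    have "far (fcmp A realization s) f =
        comparison ?b ys \<cdot>\<^bsub>B\<^esub> (far F f \<cdot>\<^bsub>B\<^esub> inverse_of B (comparison ?a xs))"
      using f xs ys ar[OF f] by simp
    then show "ncmp ?t ?b \<cdot>\<^bsub>B\<^esub> far (ndom ?t) f = far (ncod ?t) f \<cdot>\<^bsub>B\<^esub> ncmp ?t ?a"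
      using f xs ys comparison_ar[OF xs(2)] comparison_ar[OF ys(2)]
      by (simp add: B.assoc B.inverse_of)
  qed (simp_all add: h cat_functor_axioms G.cat_functor_axioms del: fcmp_apply)
  then show ?thesis unfolding nat_isomorphic_def using h by (intro exI[of _ ?t]) simp
qed

end

section \<open>Smallness\<close>

text \<open>The notion of smallness by which \<open>locally_small\<close> is defined. For an infinite type, small sets are closed
  under the constructions by which names are built from arrows.\<close>

definition small_set :: "'u itself \<Rightarrow> 'x set \<Rightarrow> bool" where
  "small_set U X \<longleftrightarrow> (\<exists>e :: 'x \<Rightarrow> 'u. inj_on e X)"

lemma small_set_iff: "small_set TYPE('u) X \<longleftrightarrow> (card_of X, card_of (UNIV :: 'u set)) \<in> ordLeq"
  unfolding small_set_def card_of_ordLeq[symmetric] by simp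

lemma small_set_subset: "small_set U Y \<Longrightarrow> X \<subseteq> Y \<Longrightarrow> small_set U X"
  unfolding small_set_def using inj_on_subset by blast

lemma small_set_image: "small_set TYPE('u) X \<Longrightarrow> small_set TYPE('u) (f ` X)"
  unfolding small_set_iff using card_of_image ordLeq_transitive by blast

lemma small_set_of_type: "small_set TYPE('u) (X :: 'u set)"
  unfolding small_set_def by (intro exI[of _ id]) simp

lemma small_set_UN:
  assumes "infinite (UNIV :: 'u set)" "small_set TYPE('u) I" "\<And>i. i \<in> I \<Longrightarrow> small_set TYPE('u) (X i)"
  shows "small_set TYPE('u) (\<Union>i\<in>I. X i)"
  using card_of_UNION_ordLeq_infinite[OF assms(1)] assms(2,3) unfolding small_set_iff by blast

lemma small_set_nat: "infinite (UNIV :: 'u set) \<Longrightarrow> small_set TYPE('u) (UNIV :: nat set)"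
  unfolding small_set_iff using infinite_iff_card_of_nat by blast

lemma small_set_Un:
  assumes "infinite (UNIV :: 'u set)" "small_set TYPE('u) X" "small_set TYPE('u) Y"
  shows "small_set TYPE('u) (X \<union> Y)"
proof -
  have "small_set TYPE('u) (\<Union>n\<in>(UNIV :: nat set). if n = 0 then X else Y)"
    by (rule small_set_UN[OF assms(1) small_set_nat[OF assms(1)]]) (simp add: assms(2,3))
  then show ?thesis by (rule small_set_subset) (auto intro: exI[of _ 0] exI[of _ "Suc 0"])
qed

lemma small_set_Times:
  assumes "infinite (UNIV :: 'u set)" "small_set TYPE('u) X" "small_set TYPE('u) Y"
  shows "small_set TYPE('u) (X \<times> Y)"
proof -
  have "small_set TYPE('u) (\<Union>x\<in>X. Pair x ` Y)"
    by (intro small_set_UN[OF assms(1,2)] small_set_image[OF assms(3)])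
  then show ?thesis by (rule small_set_subset) auto
qed

lemma small_set_lists:
  assumes "infinite (UNIV :: 'u set)" "small_set TYPE('u) X"
  shows "small_set TYPE('u) (lists X)"
proof -
  have "small_set TYPE('u) {xs \<in> lists X. length xs = n}" for n
  proof (induction n)
    case 0
    have "inj_on e {xs \<in> lists X. length xs = 0}" for e :: "_ \<Rightarrow> 'u" by (simp add: inj_on_def)
    then show ?case unfolding small_set_def by blast
  next
    case (Suc n)
    have "{xs \<in> lists X. length xs = Suc n} \<subseteq>
        (\<lambda>(x, xs). x # xs) ` (X \<times> {xs \<in> lists X. length xs = n})"
      by (auto simp: length_Suc_conv image_iff)
    then show ?case
      using small_set_subset small_set_image small_set_Times[OF assms Suc] by blast
  qed
  then have "small_set TYPE('u) (\<Union>n\<in>(UNIV :: nat set). {xs \<in> lists X. length xs = n})"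
    by (intro small_set_UN[OF assms(1) small_set_nat[OF assms(1)]])
  moreover have "(\<Union>n\<in>(UNIV :: nat set). {xs \<in> lists X. length xs = n}) = lists X" by blast
  ultimately show ?thesis by simp
qed

text \<open>All arrows that occur in names run between objects in the images of \<open>A\<close> under \<open>F\<close>, in \<open>D\<close> or among the
  parents of objects in \<open>D\<close>. These objects form a small set, so the arrows do as well, by local
  smallness.\<close>

lemma small_named_ctx:
  fixes A :: "('u, 'u) ctx" and B :: "('o, 'a) ctx" and F :: "('u, 'u, 'o, 'a) fctr"
  assumes "weak_functor A B F D" and inf: "infinite (UNIV :: 'u set)"
    and loc: "locally_small TYPE('u) B" and D: "small_set TYPE('u) D"
  shows "small_set TYPE('u) (ob (weak_functor.named_ctx A B F D))"
    and "small_set TYPE('u) (ar (weak_functor.named_ctx A B F D))"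
proof -
  interpret weak_functor A B F D by fact
  define M where "M = fob F ` ob A \<union> (D \<union> par B ` D)"
  define V where "V = (\<Union>x\<in>M. \<Union>y\<in>M. hom B x y)"
  have M: "small_set TYPE('u) M" unfolding M_def
    by (intro small_set_Un[OF inf] small_set_image small_set_of_type D)
  have "M \<subseteq> ob B" using fob_ob D_len B.par_ob by (auto simp: M_def)
  then have "small_set TYPE('u) (hom B x y)" if "x \<in> M" "y \<in> M" for x y
    using loc that unfolding locally_small_def small_set_def by blast
  then have V: "small_set TYPE('u) V" unfolding V_def by (intro small_set_UN[OF inf M])
  have n: "naming a xs \<Longrightarrow> xs \<in> lists (V \<times> V)" for a xs
  proof (induction a xs rule: naming.induct)
    case (2 a w v xs)
    then have a: "a \<in> ob A" "1 \<le> len A a" and d: "tgt B w \<in> D"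
      and pb: "pullback B w (far F (\<p>\<^bsub>A\<^esub> a)) (\<p>\<^bsub>B\<^esub> (tgt B w)) v" by auto
    note pbD = B.pullbackD[OF pb] and dD = D_len[OF d]
    have "w \<in> hom B (fob F a) (tgt B w)" "v \<in> hom B (fob F (\<partial>\<^bsub>A\<^esub> a)) (\<partial>\<^bsub>B\<^esub> (tgt B w))"
      using pbD a dD by (simp_all add: hom_def)
    moreover have "fob F a \<in> M" "fob F (\<partial>\<^bsub>A\<^esub> a) \<in> M" "tgt B w \<in> M" "\<partial>\<^bsub>B\<^esub> (tgt B w) \<in> M"
      using a d A.par_ob by (auto simp: M_def)
    ultimately have "w \<in> V" "v \<in> V" unfolding V_def by blast+
    then show ?case using 2 by simp
  qed simp
  have "ob named_ctx \<subseteq> UNIV \<times> lists (V \<times> V)" using n by (auto simp: named_ctx_ob)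
  moreover have "small_set TYPE('u) ((UNIV :: 'u set) \<times> lists (V \<times> V))"
    by (intro small_set_Times[OF inf] small_set_lists[OF inf] small_set_of_type V)
  ultimately show ob: "small_set TYPE('u) (ob named_ctx)" by (rule small_set_subset[rotated])
  have "ar named_ctx \<subseteq> ob named_ctx \<times> UNIV \<times> ob named_ctx" by (auto elim!: named_arE)
  moreover have "small_set TYPE('u) (ob named_ctx \<times> (UNIV :: 'u set) \<times> ob named_ctx)"
    by (intro small_set_Times[OF inf] small_set_of_type ob)
  ultimately show "small_set TYPE('u) (ar named_ctx)" by (rule small_set_subset[rotated])
qed

section \<open>Strictification\<close>

text \<open>One strict display map for each object of positive length of \<open>A\<close> is enough, so that \<open>D\<close> can be taken to be an image of a
  subset of \<open>'u\<close>. An isomorphism of arrows is a pullback square, which supplies the names.\<close>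

lemma weak_functor_of_dmc_morphism:
  assumes A: "contextual A" and B: "contextual B" and F: "dmc_morphism (weak A) (weak B) F"
  obtains c where "weak_functor A B F (c ` {a \<in> ob A. 1 \<le> len A a})"
proof -
  interpret A: contextual A by fact
  interpret B: contextual B by fact
  have fF: "cat_functor A B F" using F cat_functor_weak[of A B] by (auto simp: dmc_morphism_def)
  interpret F: cat_functor A B F by fact
  have dm: "far F p \<in> dmaps (weak B)" if "p \<in> dmaps (weak A)" for p
    using F that unfolding dmc_morphism_def dmc_morphism_axioms_def by blast
  have pb: "pullback B (far F t) (far F l) (far F p) (far F f)"
    if "p \<in> dmaps (weak A)" "pullback A t l p f" for t l p f
    using F that unfolding dmc_morphism_def dmc_morphism_axioms_def by simp
  have t: "terminal B (fob F x)" if "terminal A x" for x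
    using F that unfolding dmc_morphism_def dmc_morphism_axioms_def by simp
  have "\<exists>c w v. c \<in> ob B \<and> 1 \<le> len B c \<and> tgt B w = c \<and>
      pullback B w (far F (\<p>\<^bsub>A\<^esub> a)) (\<p>\<^bsub>B\<^esub> c) v" if a: "a \<in> ob A" "1 \<le> len A a" for a
  proof -
    have p: "far F (\<p>\<^bsub>A\<^esub> a) \<in> dmaps (weak B)" by (rule dm[OF A.dsp_dmaps[OF a]])
    obtain c u v where c: "far F (\<p>\<^bsub>A\<^esub> a) \<in> ar B" "c \<in> ob B" "1 \<le> len B c" "iso B u" "iso B v"
      "src B u = src B (far F (\<p>\<^bsub>A\<^esub> a))" "tgt B u = c" "src B v = tgt B (far F (\<p>\<^bsub>A\<^esub> a))"
      "tgt B v = \<partial>\<^bsub>B\<^esub> c" "\<p>\<^bsub>B\<^esub> c \<cdot>\<^bsub>B\<^esub> u = v \<cdot>\<^bsub>B\<^esub> far F (\<p>\<^bsub>A\<^esub> a)"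
      by (rule B.dmaps_weakE[OF p])
    have "pullback B u (far F (\<p>\<^bsub>A\<^esub> a)) (\<p>\<^bsub>B\<^esub> c) v"
      by (rule B.pullback_of_isos) (use c in simp_all)
    then show ?thesis using c by blast
  qed
  then obtain c where c: "\<And>a. a \<in> ob A \<Longrightarrow> 1 \<le> len A a \<Longrightarrow> c a \<in> ob B \<and> 1 \<le> len B (c a) \<and>
      (\<exists>w v. tgt B w = c a \<and> pullback B w (far F (\<p>\<^bsub>A\<^esub> a)) (\<p>\<^bsub>B\<^esub> (c a)) v)"
    by metis
  have "weak_functor A B F (c ` {a \<in> ob A. 1 \<le> len A a})"
  proof
    fix d assume "d \<in> c ` {a \<in> ob A. 1 \<le> len A a}"
    then show "d \<in> ob B \<and> 1 \<le> len B d" using c by blast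
  next
    fix f' f assume f: "(f', f) \<in> dsq A"
    show "pullback B (far F f') (far F (\<p>\<^bsub>A\<^esub> (src A f'))) (far F (\<p>\<^bsub>A\<^esub> (tgt A f'))) (far F f)"
      by (rule pb[OF A.dsp_dmaps A.dsq_pullback[OF f]]) (use A.dsqD[OF f] in simp_all)
  next
    fix a assume "a \<in> ob A" "len A a = 0"
    then show "terminal B (fob F a)" using t A.len_0_terminal by blast
  next
    fix a assume a: "a \<in> ob A" "1 \<le> len A a"
    then obtain w v where "tgt B w = c a" "pullback B w (far F (\<p>\<^bsub>A\<^esub> a)) (\<p>\<^bsub>B\<^esub> (c a)) v"
      using c by blast
    then show "\<exists>w v. tgt B w \<in> c ` {a \<in> ob A. 1 \<le> len A a} \<and>
        pullback B w (far F (\<p>\<^bsub>A\<^esub> a)) (\<p>\<^bsub>B\<^esub> (tgt B w)) v"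
      using a by (intro exI[of _ w] exI[of _ v]) simp
  qed
  then show thesis by (rule that)
qed

lemma cofibrant_strictification:
  fixes A :: "('u, 'u) ctx" and B :: "('o, 'a) ctx"
  assumes "infinite (UNIV :: 'u set)"
    and "contextual A" and "cofibrant A"
    and "contextual B" and "locally_small TYPE('u) B"
    and F: "dmc_morphism (weak A) (weak B) F"
  shows "\<exists>G. strict_morphism A B G \<and> nat_isomorphic A B F G"
proof -
  obtain c where wf: "weak_functor A B F (c ` {a \<in> ob A. 1 \<le> len A a})"
    by (rule weak_functor_of_dmc_morphism[OF assms(2,4) F])
  interpret F: weak_functor A B F "c ` {a \<in> ob A. 1 \<le> len A a}" by fact
  have D: "small_set TYPE('u) (c ` {a \<in> ob A. 1 \<le> len A a})"
    by (intro small_set_image small_set_of_type)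
  obtain i :: "_ \<Rightarrow> 'u" and j :: "_ \<Rightarrow> 'u"
    where ij: "inj_on i (ob F.named_ctx)" "inj_on j (ar F.named_ctx)"
    using small_named_ctx[OF wf assms(1,5) D] unfolding small_set_def by blast
  obtain s where s: "strict_morphism A F.named_ctx s" "fcmp A F.forget_names s = idf A"
    by (rule cofibrant_lifting_section[OF assms(3) F.lifting_equivalence_forget_names ij])
  show ?thesis
    using strict_morphism_fcmp[OF s(1) F.strict_morphism_realization]
      F.strict_morphism_nat_isomorphic[OF s] by blast
qed

theorem proposition5p11:
  fixes A :: "('u, 'u) ctx" and B :: "('o, 'a) ctx"
  assumes "infinite (UNIV :: 'u set)"
    and "contextual A" and "cofibrant A"
    and "contextual B" and "locally_small TYPE('u) B"
  shows "equivalence (Cont_cat A B) (DMC_cat (weak A) (weak B)) (inclusion A B)"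
  using equivalence_inclusion[OF assms(2,4)] cofibrant_strictification[OF assms] by blast

end
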